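(* For the speed-scaled Euclidean TSPD model with drone speed factor $\alpha\ge1$, and every $h>0$, $$\beta_{\mathsf{TSPD}}\le\frac{1}{3h}\,\mathbb{E}[C_4],$$ $$C_4=\min\Big\{\max\big\{L_{01}+L_{13},\tfrac1\alpha(L_{02}+L_{23})\big\},\ \max\big\{L_{02}+L_{23},\tfrac1\alpha(L_{01}+L_{13})\big\}\Big\},$$ where $Z_1,Z_2,Z_3$ are $\mathrm{Exponential}(1)$, $U_0,\ldots,U_3$ are $\mathrm{Uniform}[0,1]$, all independent, $W_0=0$, $W_i=\sum_{j=1}^iZ_j$, and $L_{ij}=\sqrt{(W_j-W_i)^2+h^4(U_i-U_j)^2}$. Consequently, $$\beta_{\mathsf{TSPD}}\le\frac13\sqrt{\frac12+\frac1{\alpha^2}}\;\sqrt{2\sqrt{\frac{128}{3}}}.$$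
   Context: Traveling Salesman Problem with Drone (TSPD). Let $\|\cdot\|_T$ (truck metric) and $\|\cdot\|_D$ (drone metric) be norms on $\mathbb{R}^2$, and let $\mathcal X\subset\mathbb{R}^2$ be a finite set of customer points (nodes). In a solution each node is exactly one of: a truck node (visited only by the truck), a drone node (served only by the drone), or a combined node (visited by both vehicles; a synchronization point). A ring $r$ is given by two distinct combined nodes serving as start and end nodes, together with at most one drone node and any number (possibly zero) of truck nodes between them. In ring $r$ the truck follows a path $\mathcal T_r$ from the start node through all truck nodes of the ring (in some order) to the end node, and, if a drone node is present, the drone follows the path $\mathcal D_r$ from the start node to the drone node to the end node. With $t(\mathcal T_r)$ the sum of the $\|\cdot\|_T$-lengths of the edges of $\mathcal T_r$ and $d(\mathcal D_r)$ the sum of the $\|\cdot\|_D$-lengths of the edges of $\mathcal D_r$, the cost $c(r)$ of the ring is the minimum, over the choices of $\mathcal T_r,\mathcal D_r$, of $\max\{t(\mathcal T_r),d(\mathcal D_r)\}$ if the ring contains a drone node, and of $t(\mathcal T_r)$ otherwise. A feasible solution for $\mathcal X$ is a set $\mathcal R(\mathcal X)$ of rings that together cover all points of $\mathcal X$ and are concatenated through their combined nodes to form a single cyclic tour; each point of $\mathcal X$ is served exactly once: a combined node is shared by exactly two adjacent rings, and every other point belongs to exactly one ring. The optimal makespan is $\mathsf{TSPD}(\mathcal X)=\min_{\mathcal R(\mathcal X)}\sum_{r\in\mathcal R(\mathcal X)}c(r)$. Conventions: $\mathsf{TSPD}(\mathcal X)=0$ if $|\mathcal X|\le1$, and $\mathsf{TSPD}(\{x,y\})=2\|x-y\|_T$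 for $x\ne y$. Speed-scaled Euclidean model: $\|p\|_T=\|p\|_2$ and $\|p\|_D=\frac1\alpha\|p\|_2$, where $\alpha\ge1$. Asymptotic constant: for $X_1,X_2,\ldots$ i.i.d. uniform on $[0,1]^2$, $\beta_{\mathsf{TSPD}}$ is the constant such that $\mathsf{TSPD}(\{X_1,\ldots,X_n\})/\sqrt n\to\beta_{\mathsf{TSPD}}$ almost surely and in expectation as $n\to\infty$ (this limit is known to exist). *)

theory Defs
  imports "HOL-Probability.Probability"
begin

type_synonym point = "real^2"

text \<open>
  Rings are oriented, so that a tour with only two combined nodes consists of two different rings.
  The arguments \<open>nT\<close> and \<open>nD\<close> below are the truck norm and the drone norm.
\<close>

record tspd_ring =
  ring_start :: point
  ring_end :: point
  ring_truck :: "point set"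
  ring_drone :: "point option"

definition ring_combined :: "tspd_ring \<Rightarrow> point set" where
  "ring_combined r = {ring_start r, ring_end r}"

definition ring_interior :: "tspd_ring \<Rightarrow> point set" where
  "ring_interior r = ring_truck r \<union> set_option (ring_drone r)"

definition valid_ring :: "tspd_ring \<Rightarrow> bool" where
  "valid_ring r \<longleftrightarrow>
     ring_start r \<noteq> ring_end r \<and>
     finite (ring_truck r) \<and>
     ring_truck r \<inter> set_option (ring_drone r) = {} \<and>
     ring_combined r \<inter> ring_interior r = {}"

fun path_length :: "(point \<Rightarrow> real) \<Rightarrow> point list \<Rightarrow> real" where
  "path_length N (p # q # ps) = N (q - p) + path_length N (q # ps)"
| "path_length N _ = 0"

definition truck_paths :: "tspd_ring \<Rightarrow> point list set" where
  "truck_paths r =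
     {ring_start r # ps @ [ring_end r] | ps. distinct ps \<and> set ps = ring_truck r}"

definition ring_cost :: "(point \<Rightarrow> real) \<Rightarrow> (point \<Rightarrow> real) \<Rightarrow> tspd_ring \<Rightarrow> real" where
  "ring_cost nT nD r =
     (case ring_drone r of
        None \<Rightarrow> Min {path_length nT P | P. P \<in> truck_paths r}
      | Some d \<Rightarrow>
          Min {max (path_length nT P) (path_length nD [ring_start r, d, ring_end r]) | P.
                 P \<in> truck_paths r})"

text \<open>
  In a cyclic tour, distinctness of the start nodes says that each combined node is shared by
  exactly two rings, the one ending there and the one starting there.
\<close>

definition cyclic_tour :: "tspd_ring set \<Rightarrow> bool" where
  "cyclic_tour R \<longleftrightarrow>
     (\<exists>rs. rs \<noteq> [] \<and> set rs = R \<and> distinct (map ring_start rs) \<and>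
        (\<forall>i<length rs. ring_end (rs ! i) = ring_start (rs ! (Suc i mod length rs))))"

definition feasible_solution :: "point set \<Rightarrow> tspd_ring set \<Rightarrow> bool" where
  "feasible_solution X R \<longleftrightarrow>
     (\<forall>r\<in>R. valid_ring r) \<and>
     cyclic_tour R \<and>
     (\<Union>r\<in>R. ring_combined r \<union> ring_interior r) = X \<and>
     (\<Union>r\<in>R. ring_combined r) \<inter> (\<Union>r\<in>R. ring_interior r) = {} \<and>
     (\<forall>r\<in>R. \<forall>r'\<in>R. r \<noteq> r' \<longrightarrow> ring_interior r \<inter> ring_interior r' = {})"

text \<open>
  The value on two-point sets needs no separate clause, see \<open>TSPD_two_points\<close> below.
\<close>

definition TSPD :: "(point \<Rightarrow> real) \<Rightarrow> (point \<Rightarrow> real) \<Rightarrow> point set \<Rightarrow> real" where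
  "TSPD nT nD X =
     (if card X \<le> 1 then 0
      else Min {\<Sum>r\<in>R. ring_cost nT nD r | R. feasible_solution X R})"

definition TSPD_speed :: "real \<Rightarrow> point set \<Rightarrow> real" where
  "TSPD_speed \<alpha> = TSPD norm (\<lambda>p. (1 / \<alpha>) * norm p)"

lemma finite_feasible_solutions:
  assumes "finite X"
  shows "finite {R. feasible_solution X R}"
proof -
  define mk where
    "mk = (\<lambda>(a, b, T, d). \<lparr>ring_start = a, ring_end = b, ring_truck = T, ring_drone = d\<rparr>)"
  let ?S = "X \<times> X \<times> Pow X \<times> insert None (Some ` X)"
  have "r \<in> mk ` ?S" if "feasible_solution X R" "r \<in> R" for R r
  proof
    show "r = mk (ring_start r, ring_end r, ring_truck r, ring_drone r)"
      by (simp add: mk_def)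
    have "(\<Union>r\<in>R. ring_combined r \<union> ring_interior r) = X"
      using that(1) by (simp add: feasible_solution_def)
    then have "ring_combined r \<union> ring_interior r \<subseteq> X"
      using that(2) by blast
    then show "(ring_start r, ring_end r, ring_truck r, ring_drone r) \<in> ?S"
      by (cases "ring_drone r") (auto simp: ring_combined_def ring_interior_def)
  qed
  then have "{R. feasible_solution X R} \<subseteq> Pow (mk ` ?S)"
    by blast
  moreover have "finite (Pow (mk ` ?S))"
    using assms by simp
  ultimately show ?thesis
    by (rule finite_subset)
qed

lemma TSPD_two_points:
  assumes "x \<noteq> y" and sym: "\<And>p. nT (- p) = nT p"
  shows "TSPD nT nD {x, y} = 2 * nT (x - y)"
proof -
  define mk where
    "mk = (\<lambda>a b. \<lparr>ring_start = a, ring_end = b, ring_truck = {}, ring_drone = None\<rparr>)"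
  have cost: "ring_cost nT nD (mk a b) = nT (b - a)" for a b
    by (simp add: mk_def ring_cost_def truck_paths_def)
  have sym': "nT (y - x) = nT (x - y)"
    using sym[of "x - y"] by simp
  have mk_ne: "mk x y \<noteq> mk y x"
    using assms(1) by (simp add: mk_def)
  have feas: "feasible_solution {x, y} {mk x y, mk y x}"
  proof -
    have "cyclic_tour {mk x y, mk y x}"
      unfolding cyclic_tour_def
      by (rule exI[of _ "[mk x y, mk y x]"])
        (use assms(1) in \<open>auto simp: mk_def less_Suc_eq nth_Cons' numeral_2_eq_2\<close>)
    then show ?thesis
      using assms(1)
      by (auto simp: feasible_solution_def valid_ring_def ring_combined_def ring_interior_def mk_def)
  qed
  have uniq: "R = {mk x y, mk y x}" if R: "feasible_solution {x, y} R" for R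
  proof -
    have form: "r = mk x y \<or> r = mk y x" if "r \<in> R" for r
    proof -
      have v: "valid_ring r"
        using R that by (simp add: feasible_solution_def)
      have "(\<Union>r\<in>R. ring_combined r \<union> ring_interior r) = {x, y}"
        using R by (simp add: feasible_solution_def)
      then have sub: "ring_combined r \<union> ring_interior r \<subseteq> {x, y}"
        using that by blast
      have se: "ring_start r = x \<and> ring_end r = y \<or> ring_start r = y \<and> ring_end r = x"
      proof -
        have "ring_start r \<in> {x, y}" "ring_end r \<in> {x, y}" "ring_start r \<noteq> ring_end r"
          using v sub by (simp_all add: valid_ring_def ring_combined_def)
        then show ?thesis
          by (metis empty_iff insert_iff)
      qed
      then have "ring_combined r = {x, y}"
        by (auto simp: ring_combined_def)
      then have "ring_interior r = {}"
        using v sub by (simp add: valid_ring_def) blast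
      then have "ring_truck r = {}" "ring_drone r = None"
        by (auto simp: ring_interior_def)
      then have "r = mk (ring_start r) (ring_end r)"
        by (simp add: mk_def)
      with se show ?thesis
        by metis
    qed
    have "cyclic_tour R"
      using R by (simp add: feasible_solution_def)
    then obtain rs where rs: "rs \<noteq> []" "set rs = R"
      and next_ring: "\<forall>i<length rs. ring_end (rs ! i) = ring_start (rs ! (Suc i mod length rs))"
      unfolding cyclic_tour_def by (elim exE conjE)
    have succ: "\<exists>r'\<in>R. ring_start r' = ring_end r" if "r \<in> R" for r
    proof -
      have "r \<in> set rs"
        using that rs(2) by simp
      then obtain i where i: "i < length rs" "rs ! i = r"
        unfolding in_set_conv_nth by (elim exE conjE)
      have "Suc i mod length rs < length rs"
        using rs(1) by simp
      then have "rs ! (Suc i mod length rs) \<in> R"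
        using rs(2) nth_mem by blast
      moreover have "ring_start (rs ! (Suc i mod length rs)) = ring_end r"
        using next_ring[rule_format, OF i(1)] unfolding i(2) by (rule HOL.sym)
      ultimately show ?thesis ..
    qed
    obtain r where r: "r \<in> R"
      using rs(1,2) by (metis list.set_sel(1))
    obtain r' where r': "r' \<in> R" "ring_start r' = ring_end r"
      using succ[OF r] by blast
    show ?thesis
    proof -
      have "r \<noteq> r'"
        using r r' R by (auto simp: feasible_solution_def valid_ring_def)
      then show ?thesis
        using form r r'(1) by blast
    qed
  qed
  have "{\<Sum>r\<in>R. ring_cost nT nD r | R. feasible_solution {x, y} R} = {2 * nT (x - y)}"
  proof -
    have "(\<Sum>r\<in>{mk x y, mk y x}. ring_cost nT nD r) = 2 * nT (x - y)"
      using mk_ne by (simp add: cost sym')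
    moreover have "{R. feasible_solution {x, y} R} = {{mk x y, mk y x}}"
      using feas by (intro equalityI subsetI) (simp_all add: uniq)
    ultimately show ?thesis
      by (simp only: setcompr_eq_image image_insert image_empty)
  qed
  then show ?thesis
    using assms(1) by (simp add: TSPD_def)
qed

definition strip_W :: "(nat \<Rightarrow> real) \<Rightarrow> nat \<Rightarrow> real" where
  "strip_W z i = (\<Sum>j=1..i. z j)"

definition strip_L :: "real \<Rightarrow> (nat \<Rightarrow> real) \<Rightarrow> (nat \<Rightarrow> real) \<Rightarrow> nat \<Rightarrow> nat \<Rightarrow> real" where
  "strip_L h z u i j = sqrt ((strip_W z j - strip_W z i)\<^sup>2 + h ^ 4 * (u i - u j)\<^sup>2)"

definition C4 :: "real \<Rightarrow> real \<Rightarrow> (nat \<Rightarrow> real) \<Rightarrow> (nat \<Rightarrow> real) \<Rightarrow> real" where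
  "C4 \<alpha> h z u =
     (let L = strip_L h z u in
        min (max (L 0 1 + L 1 3) ((1 / \<alpha>) * (L 0 2 + L 2 3)))
            (max (L 0 2 + L 2 3) ((1 / \<alpha>) * (L 0 1 + L 1 3))))"

end

theory Submission
  imports Defs "HOL-Real_Asymp.Real_Asymp"
begin

text \<open>
  Cut the unit square into \<open>m\<close> horizontal strips of height \<open>1 / m\<close> with \<open>m \<approx> sqrt n / h\<close> and traverse
  them in snake order. In the coordinate \<open>t \<in> [0, m]\<close> along the snake and the normalised height
  \<open>u \<in> [0, 1]\<close> inside the strip, the points are still uniform. Rings are formed by four consecutive
  points, the better of the two inner points going to the drone. Since the three possible offsets of
  the rings can be averaged, three times the optimum is at most the sum of the ring costs over
  \<^emph>\<open>all\<close> runs of four consecutive points, up to a constant. The expectation of this sum is exact: a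
  fixed quadruple with coordinates \<open>t\<^sub>0 < t\<^sub>1 < t\<^sub>2 < t\<^sub>3\<close> is consecutive with probability
  \<open>(1 - (t\<^sub>3 - t\<^sub>0) / m) ^ (n - 4) \<le> exp (- (n - 4) / m * (t\<^sub>3 - t\<^sub>0))\<close>, so that the rescaled gaps are
  dominated by independent exponential variables and no Poissonization is needed. Quadruples that meet
  two strips contribute \<open>O(1)\<close>.

  For the explicit constant, \<open>C\<^sub>4\<^sup>2 \<le> (1 / 2 + 1 / \<alpha>\<^sup>2) (a\<^sup>2 + b\<^sup>2)\<close> for the two truck lengths \<open>a\<close> and \<open>b\<close>
  through one inner point, \<open>E (a\<^sup>2 + b\<^sup>2) \<le> 32 + 4 / 3 * h ^ 4\<close>, and \<open>h ^ 4 = 24\<close> is optimal.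
\<close>

section \<open>Rings from consecutive points\<close>

text \<open>One chain of rings uses only every third run of the sorted sample, so its expected cost
  depends on ranks. Summing the three offsets removes this dependence: a run becomes a quadruple of
  indices with a condition on the other points, and independence with Fubini gives its mean
  directly.

  Scales: the \<open>k = n - 4\<close> other points have density \<open>lam = k / m\<close> along
  the snake, so gaps have length about \<open>1 / lam\<close>. In this unit the strip height
  \<open>1 / m\<close> is \<open>lam / m = k / m ^ 2\<close>, close to \<open>h ^ 2\<close>; its
  square is the weight \<open>h ^ 4\<close> under the root in \<open>strip_L\<close>. Each of the
  \<open>n ^ 4\<close> index quadruples contributes about \<open>k ^ (-3) * (1 / lam)\<close> times
  the mean of \<open>C4\<close>, in total \<open>m\<close> times that mean, and
  \<open>m / (3 * sqrt n)\<close> tends to \<open>1 / (3 * h)\<close>.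

  A run that meets two strips starts within about \<open>1 / lam\<close> of a turn, which has
  probability of order \<open>1 / lam\<close>, and costs order \<open>1 / lam\<close> as well. With
  \<open>n\<close> runs the total is of order \<open>n / lam ^ 2\<close>, which is bounded because
  \<open>lam\<close> grows like \<open>sqrt n\<close>.\<close>

definition ring4 :: "real \<Rightarrow> real \<Rightarrow> real \<Rightarrow> real" where
  "ring4 \<alpha> a b = min (max a (b / \<alpha>)) (max b (a / \<alpha>))"

definition dist_cost :: "real \<Rightarrow> point \<Rightarrow> point \<Rightarrow> point \<Rightarrow> point \<Rightarrow> real" where
  "dist_cost \<alpha> p q r s = ring4 \<alpha> (dist p q + dist q s) (dist p r + dist r s)"

text \<open>\<open>Min\<close> bounds its members from below only on a finite set; with finiteness,
  any single truck order gives an upper bound for the ring cost.\<close>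

lemma finite_truck_paths:
  assumes "finite (ring_truck r)"
  shows "finite (truck_paths r)"
proof -
  have "finite {ps. set ps \<subseteq> ring_truck r \<and> distinct ps}"
    using assms by (rule finite_subset_distinct)
  then have "finite ((\<lambda>ps. ring_start r # ps @ [ring_end r]) ` {ps. set ps \<subseteq> ring_truck r \<and> distinct ps})"
    by simp
  then show ?thesis
    by (rule rev_finite_subset) (auto simp: truck_paths_def)
qed

lemma ring_cost_le_truck:
  assumes "finite (ring_truck r)" "ring_drone r = None" "P \<in> truck_paths r"
  shows "ring_cost nT nD r \<le> path_length nT P"
  using assms finite_truck_paths[OF assms(1)]
  by (auto simp: ring_cost_def setcompr_eq_image intro!: Min_le)

lemma ring_cost_le_drone:
  assumes "finite (ring_truck r)" "ring_drone r = Some d" "P \<in> truck_paths r"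
  shows "ring_cost nT nD r \<le> max (path_length nT P) (path_length nD [ring_start r, d, ring_end r])"
  using assms finite_truck_paths[OF assms(1)]
  by (auto simp: ring_cost_def setcompr_eq_image simp del: path_length.simps intro!: Min_le)

lemma TSPD_le_feasible:
  assumes "finite X" "1 < card X" "feasible_solution X R"
  shows "TSPD nT nD X \<le> (\<Sum>r\<in>R. ring_cost nT nD r)"
proof -
  have "finite {\<Sum>r\<in>R. ring_cost nT nD r | R. feasible_solution X R}"
    using finite_feasible_solutions[OF assms(1)] by (simp add: setcompr_eq_image)
  then show ?thesis
    using assms(2,3) by (auto simp: TSPD_def intro!: Min_le)
qed

text \<open>Every third point up to position \<open>3 * k\<close> is a combined node. One further
  ring without a drone closes the tour: its truck collects all points after position
  \<open>3 * k\<close> and returns to the start, so no divisibility of the number of points is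
  required.\<close>

lemma TSPD_speed_le_chain:
  fixes Q :: "point list"
  assumes dist: "distinct Q" and k: "1 \<le> k" "3 * k < length Q"
  shows "TSPD_speed \<alpha> (set Q) \<le>
    (\<Sum>i<k. dist_cost \<alpha> (Q ! (3*i)) (Q ! (3*i+1)) (Q ! (3*i+2)) (Q ! (3*i+3))) +
    path_length norm (Q ! (3*k) # drop (3*k+1) Q @ [Q ! 0])"
proof -
  define n where "n = length Q"
  define a where "a i = dist (Q ! (3*i)) (Q ! (3*i+1)) + dist (Q ! (3*i+1)) (Q ! (3*i+3))" for i
  define b where "b i = dist (Q ! (3*i)) (Q ! (3*i+2)) + dist (Q ! (3*i+2)) (Q ! (3*i+3))" for i
  \<comment> \<open>Truck and drone share the two inner positions so that the ring attains the
    minimum in \<open>ring4\<close>.\<close>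
  define tr where "tr i = (if max (a i) (b i / \<alpha>) \<le> max (b i) (a i / \<alpha>) then 3*i+1 else 3*i+2)" for i
  define dr where "dr i = (if max (a i) (b i / \<alpha>) \<le> max (b i) (a i / \<alpha>) then 3*i+2 else 3*i+1)" for i
  define rg where "rg i = \<lparr>ring_start = Q ! (3*i), ring_end = Q ! (3*i+3),
    ring_truck = {Q ! tr i}, ring_drone = Some (Q ! dr i)\<rparr>" for i
  define cl where "cl = \<lparr>ring_start = Q ! (3*k), ring_end = Q ! 0,
    ring_truck = set (drop (3*k+1) Q), ring_drone = None\<rparr>"
  define S where "S i = (if i = k then cl else rg i)" for i
  \<comment> \<open>Positions of the interior and the combined nodes of ring \<open>i\<close>. Since
    \<open>(!) Q\<close> is injective on positions, the disjointness and covering conditions of a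
    feasible solution become arithmetic on these index sets.\<close>
  define In where "In i = (if i = k then {3*k+1..<n} else {3*i+1,3*i+2})" for i
  define Co where "Co i = (if i = k then {3*k,0} else {3*i,3*i+3})" for i
  define R where "R = S ` {..k}"
  let ?nD = "\<lambda>p::point. (1 / \<alpha>) * norm p"
  have kn: "3 * k < n" using k n_def by simp
  have inj: "inj_on ((!) Q) {..<n}"
    using dist by (auto simp: inj_on_def n_def nth_eq_iff_index_eq)
  have trdr: "{tr i, dr i} = {3*i+1,3*i+2}" "tr i \<noteq> dr i" for i
    by (auto simp: tr_def dr_def)
  have In_sub: "In i \<subseteq> {..<n}" "Co i \<subseteq> {..<n}" if "i \<le> k" for i
    using that kn by (auto simp: In_def Co_def)
  have dropset: "set (drop (3*k+1) Q) = (!) Q ` {3*k+1..<n}"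
  proof -
    have "drop (3*k+1) Q = map ((!) Q) [3*k+1..<n]"
      by (rule nth_equalityI) (auto simp: n_def)
    then show ?thesis by simp
  qed
  have interior: "ring_interior (S i) = (!) Q ` In i" for i
  proof (cases "i = k")
    case True
    then show ?thesis using dropset by (simp add: ring_interior_def S_def In_def cl_def)
  next
    case False
    have "ring_interior (S i) = (!) Q ` {tr i, dr i}"
      using False by (auto simp: ring_interior_def S_def rg_def)
    then show ?thesis using False trdr(1)[of i] by (simp add: In_def)
  qed
  have combined: "ring_combined (S i) = (!) Q ` Co i" for i
    by (auto simp: ring_combined_def S_def Co_def rg_def cl_def)
  have CI: "Co i \<inter> In j = {}" if "i \<le> k" "j \<le> k" for i j
    using that by (auto simp: Co_def In_def split: if_splits; presburger)
  have II: "In i \<inter> In j = {}" if "i \<le> k" "j \<le> k" "i \<noteq> j" for i j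
    using that by (auto simp: In_def split: if_splits; presburger)
  have CI': "ring_combined (S i) \<inter> ring_interior (S j) = {}" if "i \<le> k" "j \<le> k" for i j
    using that CI[of i j] In_sub inj unfolding combined interior
    by (metis image_empty inj_on_image_Int)
  have II': "ring_interior (S i) \<inter> ring_interior (S j) = {}" if "i \<le> k" "j \<le> k" "i \<noteq> j" for i j
    using that II[of i j] In_sub inj unfolding interior
    by (metis image_empty inj_on_image_Int)
  have starts: "ring_start (S i) = Q ! (3*i)" for i
    by (simp add: S_def rg_def cl_def)
  have ends: "ring_end (S i) = Q ! (if i = k then 0 else 3*i+3)" for i
    by (simp add: S_def rg_def cl_def)
  have injS: "inj_on (\<lambda>i. Q ! (3*i)) {..k}"
  proof (rule inj_onI)
    fix x y assume "x \<in> {..k}" "y \<in> {..k}" "Q ! (3*x) = Q ! (3*y)"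
    then show "x = y" using kn inj_onD[OF inj, of "3*x" "3*y"] by simp
  qed
  \<comment> \<open>Distinct start nodes keep the rings apart, so the cost of the set
    \<open>R\<close> is a sum over indices without collapsing terms.\<close>
  have injS2: "inj_on S {..k}"
    using injS by (metis (mono_tags, lifting) inj_on_def starts)
  have valid: "valid_ring (S i)" if "i \<le> k" for i
  proof -
    have "ring_start (S i) \<noteq> ring_end (S i)"
      using inj_onD[OF inj, of "3*i" "if i = k then 0 else 3*i+3"] that k kn
      by (auto simp: starts ends)
    moreover have "finite (ring_truck (S i))"
      by (simp add: S_def rg_def cl_def)
    moreover have "ring_truck (S i) \<inter> set_option (ring_drone (S i)) = {}"
    proof (cases "i = k")
      case False
      have "tr i < n" "dr i < n"
        using that False kn by (auto simp: tr_def dr_def)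
      then have "Q ! tr i \<noteq> Q ! dr i"
        using trdr(2)[of i] inj by (auto simp: inj_on_def)
      then show ?thesis using False by (auto simp: S_def rg_def)
    qed (simp add: S_def cl_def)
    ultimately show ?thesis
      using CI'[OF that that] by (simp add: valid_ring_def)
  qed
  have cyc: "cyclic_tour R"
    unfolding cyclic_tour_def
  proof (intro exI[of _ "map S [0..<k+1]"] conjI allI impI)
    show "set (map S [0..<k+1]) = R"
      by (simp add: R_def atLeast0LessThan lessThan_Suc_atMost del: upt_Suc)
    have "map ring_start (map S [0..<k+1]) = map (\<lambda>i. Q ! (3*i)) [0..<k+1]"
      by (simp add: starts)
    moreover have "distinct (map (\<lambda>i. Q ! (3*i)) [0..<k+1])"
      using injS by (simp add: distinct_map lessThan_Suc_atMost atLeast0LessThan del: upt_Suc)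
    ultimately show "distinct (map ring_start (map S [0..<k+1]))" by (simp only:)
  next
    fix i assume "i < length (map S [0..<k+1])"
    then have i: "i \<le> k" by simp
    show "ring_end (map S [0..<k+1] ! i) =
      ring_start (map S [0..<k+1] ! (Suc i mod length (map S [0..<k+1])))"
    proof (cases "i = k")
      case True
      then show ?thesis by (simp add: starts ends del: upt_Suc)
    next
      case False
      then show ?thesis using i
        by (simp add: starts ends add.commute del: upt_Suc)
    qed
  qed simp
  have cover: "(\<Union>i\<le>k. Co i \<union> In i) = {..<n}"
  proof
    show "(\<Union>i\<le>k. Co i \<union> In i) \<subseteq> {..<n}" using In_sub by blast
    show "{..<n} \<subseteq> (\<Union>i\<le>k. Co i \<union> In i)"
    proof
      fix j assume "j \<in> {..<n}"
      then have j: "j < n" by simp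
      show "j \<in> (\<Union>i\<le>k. Co i \<union> In i)"
      proof (cases "3 * k \<le> j")
        case True
        then have "j \<in> Co k \<union> In k" using j by (auto simp: Co_def In_def)
        then show ?thesis by blast
      next
        case False
        then have jk: "j div 3 < k" by linarith
        have "j = 3 * (j div 3) + j mod 3" by simp
        moreover have "j mod 3 = 0 \<or> j mod 3 = 1 \<or> j mod 3 = 2" by linarith
        ultimately have "j \<in> Co (j div 3) \<union> In (j div 3)"
          using jk by (auto simp: Co_def In_def)
        then show ?thesis using jk by (intro UN_I[of "j div 3"]) auto
      qed
    qed
  qed
  have "feasible_solution (set Q) R"
    unfolding feasible_solution_def
  proof (intro conjI)
    show "\<forall>r\<in>R. valid_ring r" using valid by (auto simp: R_def)
    show "cyclic_tour R" by (rule cyc)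
    have "(\<Union>r\<in>R. ring_combined r \<union> ring_interior r) = (!) Q ` (\<Union>i\<le>k. Co i \<union> In i)"
      unfolding R_def by (simp add: combined interior image_UN image_Un)
    also have "\<dots> = set Q"
      unfolding cover n_def by (auto simp: set_conv_nth)
    finally show "(\<Union>r\<in>R. ring_combined r \<union> ring_interior r) = set Q" .
    show "(\<Union> (ring_combined ` R)) \<inter> (\<Union> (ring_interior ` R)) = {}"
      using CI' by (auto simp: R_def; blast)
    show "\<forall>r\<in>R. \<forall>r'\<in>R. r \<noteq> r' \<longrightarrow> ring_interior r \<inter> ring_interior r' = {}"
      using II' by (auto simp: R_def; blast)
  qed
  moreover have "1 < card (set Q)"
    using dist kn k by (simp add: distinct_card n_def)
  ultimately have "TSPD_speed \<alpha> (set Q) \<le> (\<Sum>r\<in>R. ring_cost norm ?nD r)"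
    unfolding TSPD_speed_def by (intro TSPD_le_feasible) auto
  also have "\<dots> = (\<Sum>i\<le>k. ring_cost norm ?nD (S i))"
    unfolding R_def using injS2 by (simp add: sum.reindex)
  also have "\<dots> = (\<Sum>i<k. ring_cost norm ?nD (rg i)) + ring_cost norm ?nD cl"
    by (simp add: S_def lessThan_Suc_atMost[symmetric])
  also have "\<dots> \<le> (\<Sum>i<k. dist_cost \<alpha> (Q ! (3*i)) (Q ! (3*i+1)) (Q ! (3*i+2)) (Q ! (3*i+3))) +
    path_length norm (Q ! (3*k) # drop (3*k+1) Q @ [Q ! 0])"
  proof (intro add_mono sum_mono)
    fix i
    have "ring_cost norm ?nD (rg i) \<le> max (path_length norm [Q ! (3*i), Q ! tr i, Q ! (3*i+3)])
       (path_length ?nD [ring_start (rg i), Q ! dr i, ring_end (rg i)])"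
      by (rule ring_cost_le_drone) (auto simp: rg_def truck_paths_def intro!: exI[of _ "[Q ! tr i]"])
    also have "\<dots> = dist_cost \<alpha> (Q ! (3*i)) (Q ! (3*i+1)) (Q ! (3*i+2)) (Q ! (3*i+3))"
    proof -
      let ?c = "max (a i) (b i / \<alpha>) \<le> max (b i) (a i / \<alpha>)"
      have "path_length norm [Q ! (3*i), Q ! tr i, Q ! (3*i+3)] = (if ?c then a i else b i)"
        by (simp add: tr_def a_def b_def dist_norm norm_minus_commute)
      moreover have "path_length ?nD [ring_start (rg i), Q ! dr i, ring_end (rg i)] =
        (if ?c then b i / \<alpha> else a i / \<alpha>)"
        by (simp add: dr_def rg_def a_def b_def dist_norm norm_minus_commute add_divide_distrib)
      moreover have "dist_cost \<alpha> (Q ! (3*i)) (Q ! (3*i+1)) (Q ! (3*i+2)) (Q ! (3*i+3)) = ring4 \<alpha> (a i) (b i)"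
        by (simp add: dist_cost_def a_def b_def)
      ultimately show ?thesis
        by (simp add: ring4_def min_def)
    qed
    finally show "ring_cost norm ?nD (rg i) \<le> dist_cost \<alpha> (Q ! (3*i)) (Q ! (3*i+1)) (Q ! (3*i+2)) (Q ! (3*i+3))" .
  next
    show "ring_cost norm ?nD cl \<le> path_length norm (Q ! (3*k) # drop (3*k+1) Q @ [Q ! 0])"
      using dist by (intro ring_cost_le_truck) (auto simp: cl_def truck_paths_def)
  qed
  finally show ?thesis .
qed

lemma path_length_le:
  assumes "\<And>p q. p \<in> set ps \<Longrightarrow> q \<in> set ps \<Longrightarrow> N (q - p) \<le> D" "0 \<le> D"
  shows "path_length N ps \<le> real (length ps - 1) * D"
  using assms
proof (induction N ps rule: path_length.induct)
  case (1 N p q ps)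
  have "N (q - p) \<le> D" using 1 by simp
  moreover have "path_length N (q # ps) \<le> real (length (q # ps) - 1) * D"
    using 1 by (intro 1) auto
  ultimately show ?case by (simp add: algebra_simps)
qed auto

text \<open>
  The three tours obtained by starting the rings at positions 0, 1, 2 use every run of four
  consecutive points exactly once; the closing ring has at most five edges.
\<close>

lemma TSPD_speed_le_consecutive:
  fixes Q :: "point list"
  assumes dist: "distinct Q" and len: "6 \<le> length Q"
    and D: "\<And>p q. p \<in> set Q \<Longrightarrow> q \<in> set Q \<Longrightarrow> dist p q \<le> D"
  shows "3 * TSPD_speed \<alpha> (set Q) \<le>
    (\<Sum>j<length Q - 3. dist_cost \<alpha> (Q ! j) (Q ! (j+1)) (Q ! (j+2)) (Q ! (j+3))) + 15 * D"
proof -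
  define n where "n = length Q"
  \<comment> \<open>From position \<open>c\<close> there are \<open>n - 1 - c\<close> steps to the
    last point, and each ring advances by three.\<close>
  define k where "k c = (n - 1 - c) div 3" for c
  let ?f = "\<lambda>j. dist_cost \<alpha> (Q ! j) (Q ! (j+1)) (Q ! (j+2)) (Q ! (j+3))"
  have D0: "0 \<le> D"
    using D[of "hd Q" "hd Q"] len by (cases Q) auto
  have each: "TSPD_speed \<alpha> (set Q) \<le> (\<Sum>i<k c. ?f (c + 3 * i)) + 5 * D" if "c < 3" for c
  proof -
    \<comment> \<open>Rotating the list moves the \<open>c\<close> skipped points to the end, where
      the closing ring picks them up.\<close>
    define P where "P = drop c Q @ take c Q"
    have cn: "c < n" "6 \<le> n" using that len by (auto simp: n_def)
    have sP: "set P = set Q"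
      unfolding P_def by (metis append_take_drop_id set_append sup_commute)
    have lP: "length P = n" using cn by (simp add: P_def n_def)
    have dP: "distinct P"
      using sP lP dist by (metis card_distinct distinct_card n_def)
    have k: "1 \<le> k c" "3 * k c \<le> n - 1 - c" "n - 1 - c < 3 * k c + 3"
      using cn that unfolding k_def by auto
    have nth: "P ! i = Q ! (c + i)" if "i < n - c" for i
      using that cn by (simp add: P_def n_def nth_append)
    let ?p = "P ! (3 * k c) # drop (3 * k c + 1) P @ [P ! 0]"
    have "TSPD_speed \<alpha> (set P) \<le>
      (\<Sum>i<k c. dist_cost \<alpha> (P ! (3*i)) (P ! (3*i+1)) (P ! (3*i+2)) (P ! (3*i+3))) + path_length norm ?p"
      using dP k lP cn by (intro TSPD_speed_le_chain) auto
    also have "(\<Sum>i<k c. dist_cost \<alpha> (P ! (3*i)) (P ! (3*i+1)) (P ! (3*i+2)) (P ! (3*i+3))) = (\<Sum>i<k c. ?f (c + 3 * i))"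
    proof (rule sum.cong[OF refl])
      fix i assume "i \<in> {..<k c}"
      then have "3 * i + 3 < n - c" using k cn by auto
      then show "dist_cost \<alpha> (P ! (3*i)) (P ! (3*i+1)) (P ! (3*i+2)) (P ! (3*i+3)) = ?f (c + 3 * i)"
        by (simp add: nth add.assoc)
    qed
    also have "path_length norm ?p \<le> real (length ?p - 1) * D"
    proof (rule path_length_le)
      fix p q assume pq: "p \<in> set ?p" "q \<in> set ?p"
      have "set ?p \<subseteq> set P"
        using k lP cn by (auto dest: in_set_dropD)
      then show "norm (q - p) \<le> D"
        using D[of q p] pq sP by (auto simp: dist_norm)
    qed (rule D0)
    \<comment> \<open>The closing path has \<open>n - 3 * k c\<close> edges. By the choice of
      \<open>k\<close> this is at most \<open>c + 3\<close>, and \<open>c \<le> 2\<close>.\<close>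
    also have "\<dots> \<le> 5 * D"
      using k cn that lP D0 by (intro mult_right_mono) auto
    finally show ?thesis using sP by simp
  qed
  have "(\<Sum>c<3. \<Sum>i<k c. ?f (c + 3 * i)) = (\<Sum>(c,i)\<in>(SIGMA c:{..<3}. {..<k c}). ?f (c + 3 * i))"
    by (simp add: sum.Sigma)
  \<comment> \<open>Division by three with remainder: the start position \<open>j\<close> occurs in
    the tour with offset \<open>j mod 3\<close>, as ring number \<open>j div 3\<close>, and in no
    other place.\<close>
  also have "\<dots> = (\<Sum>j<n - 3. ?f j)"
  proof (rule sum.reindex_bij_witness[where i = "\<lambda>j. (j mod 3, j div 3)" and j = "\<lambda>(c,i). c + 3 * i"])
    fix z assume "z \<in> (SIGMA c:{..<3}. {..<k c})"
    then obtain c i where z: "z = (c, i)" "c < 3" "i < k c" by auto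
    from z(3) have "3 * i + 3 \<le> n - 1 - c" unfolding k_def by linarith
    then show "(case z of (c, i) \<Rightarrow> c + 3 * i) \<in> {..<n - 3}"
      using z len by (simp add: n_def)
  next
    fix j assume "j \<in> {..<n - 3}"
    then have "j < n - 3" by simp
    moreover have "3 * (j div 3) + j mod 3 = j" by simp
    moreover have "(q + 1) * 3 \<le> n - 1 - r" if "j < n - 3" "3 * q + r = j" for q r :: nat
      using that by auto
    ultimately have "(j div 3 + 1) * 3 \<le> n - 1 - j mod 3" by blast
    then have "j div 3 + 1 \<le> k (j mod 3)"
      unfolding k_def by (subst less_eq_div_iff_mult_less_eq) auto
    then have "j div 3 < k (j mod 3)" by simp
    then show "(j mod 3, j div 3) \<in> (SIGMA c:{..<3}. {..<k c})" by simp
  qed auto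
  finally have "(\<Sum>c<3. \<Sum>i<k c. ?f (c + 3 * i)) = (\<Sum>j<n - 3. ?f j)" .
  then have "(\<Sum>i<k 0. ?f (0 + 3 * i)) + (\<Sum>i<k 1. ?f (1 + 3 * i)) + (\<Sum>i<k 2. ?f (2 + 3 * i)) = (\<Sum>j<n - 3. ?f j)"
    by (simp add: eval_nat_numeral)
  then show ?thesis
    using each[of 0] each[of 1] each[of 2] unfolding n_def by linarith
qed

section \<open>Snake coordinates\<close>

lemma ring4_nonneg: "0 \<le> \<alpha> \<Longrightarrow> 0 \<le> a \<Longrightarrow> 0 \<le> b \<Longrightarrow> 0 \<le> ring4 \<alpha> a b"
  by (simp add: ring4_def le_max_iff_disj)

lemma ring4_mono: "0 \<le> \<alpha> \<Longrightarrow> a \<le> a' \<Longrightarrow> b \<le> b' \<Longrightarrow> ring4 \<alpha> a b \<le> ring4 \<alpha> a' b'"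
  unfolding ring4_def by (intro min.mono max.mono divide_right_mono) auto

lemma ring4_le:
  assumes "1 \<le> \<alpha>" "a \<le> c" "b \<le> c" "0 \<le> c"
  shows "ring4 \<alpha> a b \<le> c"
proof -
  have "b / \<alpha> \<le> c / 1"
    using assms by (intro frac_le) auto
  then show ?thesis using assms by (simp add: ring4_def)
qed

lemma ring4_scale:
  assumes "0 \<le> c" "0 \<le> \<alpha>"
  shows "ring4 \<alpha> (c * a) (c * b) = c * ring4 \<alpha> a b"
  using assms by (simp add: ring4_def min_mult_distrib_left max_mult_distrib_left)

text \<open>
  Odd strips are traversed from right to left. The coordinate of a point with abscissa in \<open>(0, 1)\<close> lies
  strictly between the number of its strip and the next integer.
\<close>

definition snake_t :: "nat \<Rightarrow> point \<Rightarrow> real" where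
  "snake_t m p = (let j = \<lfloor>real m * p $ 2\<rfloor> in of_int j + (if even j then p $ 1 else 1 - p $ 1))"

definition snake_u :: "nat \<Rightarrow> point \<Rightarrow> real" where
  "snake_u m p = frac (real m * p $ 2)"

definition flat_dist :: "nat \<Rightarrow> real \<times> real \<Rightarrow> real \<times> real \<Rightarrow> real" where
  "flat_dist m y y' = sqrt ((fst y - fst y')\<^sup>2 + ((snd y - snd y') / real m)\<^sup>2)"

lemma dist_point: "dist (p::point) q = sqrt ((p $ 1 - q $ 1)\<^sup>2 + (p $ 2 - q $ 2)\<^sup>2)"
  by (simp add: dist_vec_def L2_set_def sum_2 dist_real_def)

lemma floor_snake_t:
  assumes "0 < p $ 1" "p $ 1 < 1"
  shows "\<lfloor>snake_t m p\<rfloor> = \<lfloor>real m * p $ 2\<rfloor>"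
  using assms by (simp add: snake_t_def Let_def floor_eq_iff)

text \<open>Inside one strip the snake coordinates arise by a translation or a reflection of the
  abscissa and by a rescaling of the height, which \<open>flat_dist\<close> undoes.\<close>

lemma dist_eq_flat_dist:
  assumes "0 < m" "0 < p $ 1" "p $ 1 < 1" "0 < q $ 1" "q $ 1 < 1"
    and "\<lfloor>snake_t m p\<rfloor> = \<lfloor>snake_t m q\<rfloor>"
  shows "dist p q = flat_dist m (snake_t m p, snake_u m p) (snake_t m q, snake_u m q)"
proof -
  have eq: "\<lfloor>real m * p $ 2\<rfloor> = \<lfloor>real m * q $ 2\<rfloor>"
    using assms by (simp add: floor_snake_t)
  have "(snake_t m p - snake_t m q)\<^sup>2 = (p $ 1 - q $ 1)\<^sup>2"
    using eq by (auto simp: snake_t_def Let_def power2_commute)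
  moreover have "(snake_u m p - snake_u m q) / real m = p $ 2 - q $ 2"
    using eq assms(1) by (simp add: snake_u_def frac_def field_simps)
  ultimately show ?thesis by (simp add: dist_point flat_dist_def)
qed

text \<open>Neighbouring strips are joined at a common side of the square, so the way along the
  snake goes from one point to that side and back to the other, at least the difference of the
  abscissae. If the strip numbers differ by two or more, the coordinates differ by more than 1, the
  width of the square.\<close>

lemma abs_x_le_snake_t:
  assumes p: "0 < p $ 1" "p $ 1 < 1" and q: "0 < q $ 1" "q $ 1 < 1"
  shows "\<bar>p $ 1 - q $ 1\<bar> \<le> \<bar>snake_t m p - snake_t m q\<bar>"
proof -
  have aux: "\<bar>p $ 1 - q $ 1\<bar> \<le> snake_t m q - snake_t m p"
    if p: "0 < p $ 1" "p $ 1 < 1" and q: "0 < q $ 1" "q $ 1 < 1"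
      and less: "\<lfloor>real m * p $ 2\<rfloor> < \<lfloor>real m * q $ 2\<rfloor>" for p q :: point
  proof -
    define i j where "i = \<lfloor>real m * p $ 2\<rfloor>" and "j = \<lfloor>real m * q $ 2\<rfloor>"
    have t: "snake_t m p = of_int i + (if even i then p $ 1 else 1 - p $ 1)"
      "snake_t m q = of_int j + (if even j then q $ 1 else 1 - q $ 1)"
      by (simp_all add: snake_t_def Let_def i_def j_def)
    show ?thesis
    proof (cases "j = i + 1")
      case True
      then show ?thesis using p q unfolding t by auto
    next
      case False
      then have "i + 2 \<le> j" using less by (simp add: i_def j_def)
      then have "real_of_int i + 2 \<le> real_of_int j" by linarith
      then show ?thesis using p q unfolding t by auto
    qed
  qed
  consider "\<lfloor>real m * p $ 2\<rfloor> < \<lfloor>real m * q $ 2\<rfloor>" | "\<lfloor>real m * p $ 2\<rfloor> = \<lfloor>real m * q $ 2\<rfloor>"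
    | "\<lfloor>real m * q $ 2\<rfloor> < \<lfloor>real m * p $ 2\<rfloor>" by linarith
  then show ?thesis
  proof cases
    case 1 then show ?thesis using aux[of p q] assms by linarith
  next
    case 2 then show ?thesis by (auto simp: snake_t_def Let_def)
  next
    case 3 then show ?thesis using aux[of q p] assms by linarith
  qed
qed

text \<open>A crude bound that also holds across strips. Both \<open>m * p $ 2\<close> and
  \<open>snake_t m p\<close> lie between the strip number and the next integer, so passing from one
  to the other costs at most 1 for each point. This gives the 2 in \<open>2 / m\<close>; the factor
  2 adds the horizontal and the vertical part.\<close>

lemma dist_le_snake_t:
  assumes m: "0 < m" and p: "0 < p $ 1" "p $ 1 < 1" and q: "0 < q $ 1" "q $ 1 < 1"
  shows "dist p q \<le> 2 * \<bar>snake_t m p - snake_t m q\<bar> + 2 / real m"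
proof -
  define w where "w = \<bar>snake_t m p - snake_t m q\<bar>"
  have "real m * \<bar>p $ 2 - q $ 2\<bar> = \<bar>real m * p $ 2 - real m * q $ 2\<bar>"
    by (simp add: abs_mult flip: right_diff_distrib)
  also have "\<dots> \<le> w + 2"
  proof -
    have "of_int \<lfloor>real m * r $ 2\<rfloor> \<le> snake_t m r" "snake_t m r \<le> of_int \<lfloor>real m * r $ 2\<rfloor> + 1"
      if "0 < r $ 1" "r $ 1 < 1" for r :: point
      using that by (auto simp: snake_t_def Let_def)
    from this[OF p] this[OF q] show ?thesis
      unfolding w_def by linarith
  qed
  finally have "\<bar>p $ 2 - q $ 2\<bar> \<le> (w + 2) / real m"
    using m by (simp add: field_simps)
  also have "\<dots> \<le> w + 2 / real m"
  proof -
    have "w / real m \<le> w / 1"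
      using m by (intro divide_left_mono) (auto simp: w_def)
    then show ?thesis by (simp add: add_divide_distrib)
  qed
  finally have "\<bar>p $ 2 - q $ 2\<bar> \<le> w + 2 / real m" .
  moreover have "\<bar>p $ 1 - q $ 1\<bar> \<le> w"
    unfolding w_def by (rule abs_x_le_snake_t[OF p q])
  moreover have "dist p q \<le> \<bar>p $ 1 - q $ 1\<bar> + \<bar>p $ 2 - q $ 2\<bar>"
    unfolding dist_point by (rule sqrt_sum_squares_le_sum_abs)
  moreover have "d \<le> 2 * w + e" if "a \<le> w + e" "b \<le> w" "d \<le> b + a" for a b d e :: real
    using that by linarith
  ultimately show ?thesis unfolding w_def by blast
qed

definition flat_cost :: "real \<Rightarrow> nat \<Rightarrow> real \<times> real \<Rightarrow> real \<times> real \<Rightarrow> real \<times> real \<Rightarrow> real \<times> real \<Rightarrow> real" where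
  "flat_cost \<alpha> m y\<^sub>0 y\<^sub>1 y\<^sub>2 y\<^sub>3 =
     ring4 \<alpha> (flat_dist m y\<^sub>0 y\<^sub>1 + flat_dist m y\<^sub>1 y\<^sub>3) (flat_dist m y\<^sub>0 y\<^sub>2 + flat_dist m y\<^sub>2 y\<^sub>3)"

text \<open>A route through one inner point has two edges, each at most \<open>2 * w + 2 / m\<close>
  by \<open>dist_le_snake_t\<close>, where \<open>w\<close> is the distance of the outer points
  along the snake.\<close>

definition cross_cost :: "nat \<Rightarrow> real \<times> real \<Rightarrow> real \<times> real \<Rightarrow> real" where
  "cross_cost m y\<^sub>0 y\<^sub>3 =
     (if \<lfloor>fst y\<^sub>0\<rfloor> = \<lfloor>fst y\<^sub>3\<rfloor> then 0 else 4 * (fst y\<^sub>3 - fst y\<^sub>0) + 4 / real m)"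

lemma flat_cost_nonneg: "0 \<le> \<alpha> \<Longrightarrow> 0 \<le> flat_cost \<alpha> m y\<^sub>0 y\<^sub>1 y\<^sub>2 y\<^sub>3"
  unfolding flat_cost_def by (intro ring4_nonneg add_nonneg_nonneg) (auto simp: flat_dist_def)

definition snake :: "nat \<Rightarrow> point \<Rightarrow> real \<times> real" where
  "snake m p = (snake_t m p, snake_u m p)"

text \<open>Across strips \<open>flat_cost\<close> is not a length in the square. It is kept there
  as a nonnegative extra term, which frees the main integral from any condition on strips.\<close>

lemma dist_cost_le_flat_cost:
  assumes \<alpha>: "1 \<le> \<alpha>" and m: "0 < m"
    and x: "\<And>r. r \<in> {p0,p1,p2,p3} \<Longrightarrow> 0 < r $ 1 \<and> r $ 1 < 1"
    and mono: "snake_t m p0 \<le> snake_t m p1" "snake_t m p1 \<le> snake_t m p2" "snake_t m p2 \<le> snake_t m p3"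
  shows "dist_cost \<alpha> p0 p1 p2 p3 \<le>
    flat_cost \<alpha> m (snake m p0) (snake m p1) (snake m p2) (snake m p3) + cross_cost m (snake m p0) (snake m p3)"
proof (cases "\<lfloor>snake_t m p0\<rfloor> = \<lfloor>snake_t m p3\<rfloor>")
  case True
  have "\<lfloor>snake_t m p0\<rfloor> \<le> \<lfloor>snake_t m p1\<rfloor>" "\<lfloor>snake_t m p1\<rfloor> \<le> \<lfloor>snake_t m p2\<rfloor>" "\<lfloor>snake_t m p2\<rfloor> \<le> \<lfloor>snake_t m p3\<rfloor>"
    using mono by (auto intro: floor_mono)
  then have fl: "\<lfloor>snake_t m p1\<rfloor> = \<lfloor>snake_t m p3\<rfloor>" "\<lfloor>snake_t m p2\<rfloor> = \<lfloor>snake_t m p3\<rfloor>"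
    using True by auto
  have "dist_cost \<alpha> p0 p1 p2 p3 = flat_cost \<alpha> m (snake m p0) (snake m p1) (snake m p2) (snake m p3)"
    unfolding dist_cost_def flat_cost_def snake_def
    using x True fl m by (simp add: dist_eq_flat_dist)
  then show ?thesis using True by (simp add: cross_cost_def snake_def)
next
  case False
  let ?w = "snake_t m p3 - snake_t m p0"
  have d: "dist p q \<le> 2 * ?w + 2 / real m" if "p \<in> {p0,p1,p2,p3}" "q \<in> {p0,p1,p2,p3}" for p q
  proof -
    have "\<bar>snake_t m p - snake_t m q\<bar> \<le> ?w" using that mono by auto
    moreover have "dist p q \<le> 2 * \<bar>snake_t m p - snake_t m q\<bar> + 2 / real m"
      using x[OF that(1)] x[OF that(2)] m by (intro dist_le_snake_t) auto
    moreover have "d \<le> 2 * w + e" if "a \<le> w" "d \<le> 2 * a + e" for a d e w :: real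
      using that by linarith
    ultimately show ?thesis by blast
  qed
  have "dist_cost \<alpha> p0 p1 p2 p3 \<le> 4 * ?w + 4 / real m"
    unfolding dist_cost_def
    using d[of p0 p1] d[of p1 p3] d[of p0 p2] d[of p2 p3] mono \<alpha> by (intro ring4_le) auto
  then show ?thesis
    using False flat_cost_nonneg[of \<alpha> m] \<alpha> by (simp add: cross_cost_def snake_def add_increasing)
qed

section \<open>Runs of four consecutive points\<close>

text \<open>Formulated for fixed indices instead of positions in a sorted list: given the four
  points, it is an intersection of independent conditions on the remaining ones.\<close>

definition consecutive :: "('i \<Rightarrow> real) \<Rightarrow> 'i set \<Rightarrow> 'i \<Rightarrow> 'i \<Rightarrow> 'i \<Rightarrow> 'i \<Rightarrow> bool" where
  "consecutive key I a b c d \<longleftrightarrow> key a < key b \<and> key b < key c \<and> key c < key d \<and>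
     (\<forall>l\<in>I - {a,b,c,d}. \<not> (key a < key l \<and> key l < key d))"

text \<open>A run is determined by its first position, so the runs of the sorted list embed
  injectively into the quadruples of indices. Nonnegativity of \<open>f\<close> lets the sum be
  extended to all quadruples.\<close>

lemma sum_sorted_le_sum_consecutive:
  fixes key :: "'i \<Rightarrow> real" and f :: "'i \<Rightarrow> 'i \<Rightarrow> 'i \<Rightarrow> 'i \<Rightarrow> real"
  assumes I: "finite I" and inj: "inj_on key I" and nonneg: "\<And>a b c d. 0 \<le> f a b c d"
  obtains xs where "distinct xs" "set xs = I"
    "(\<Sum>j<length xs - 3. f (xs ! j) (xs ! (j+1)) (xs ! (j+2)) (xs ! (j+3))) \<le>
     (\<Sum>a\<in>I. \<Sum>b\<in>I. \<Sum>c\<in>I. \<Sum>d\<in>I. if consecutive key I a b c d then f a b c d else 0)"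
proof -
  obtain ys where ys: "set ys = I" "distinct ys"
    using finite_distinct_list[OF I] by blast
  define xs where "xs = sort_key key ys"
  have xs: "distinct xs" "set xs = I" "sorted (map key xs)"
    using ys by (auto simp: xs_def)
  have "distinct (map key xs)"
    using xs inj by (simp add: distinct_map)
  then have strict: "sorted_wrt (<) (map key xs)"
    using xs(3) strict_sorted_iff by blast
  have less: "key (xs ! i) < key (xs ! j) \<longleftrightarrow> i < j" if "i < length xs" "j < length xs" for i j
  proof -
    have "key (xs ! i) < key (xs ! j)" if "i < j" "j < length xs" for i j
      using sorted_wrt_nth_less[OF strict, of i j] that by simp
    from this[of i j] this[of j i] show ?thesis
      using that by (metis less_irrefl less_trans linorder_neqE_nat)
  qed
  let ?g = "\<lambda>(a,b,c,d). if consecutive key I a b c d then f a b c d else 0"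
  let ?q = "\<lambda>j. (xs ! j, xs ! (j+1), xs ! (j+2), xs ! (j+3))"
  have cons: "consecutive key I (xs ! j) (xs ! (j+1)) (xs ! (j+2)) (xs ! (j+3))"
    if "j < length xs - 3" for j
    unfolding consecutive_def
  proof (intro conjI ballI)
    fix l assume l: "l \<in> I - {xs ! j, xs ! (j+1), xs ! (j+2), xs ! (j+3)}"
    then obtain i where i: "i < length xs" "l = xs ! i"
      using xs(2) by (metis DiffD1 in_set_conv_nth)
    have "i \<noteq> j" "i \<noteq> j + 1" "i \<noteq> j + 2" "i \<noteq> j + 3"
      using l i by auto
    then show "\<not> (key (xs ! j) < key l \<and> key l < key (xs ! (j+3)))"
      using that i less[of j i] less[of i "j+3"] by auto
  qed (use that less in auto)
  have "(\<Sum>j<length xs - 3. f (xs ! j) (xs ! (j+1)) (xs ! (j+2)) (xs ! (j+3))) = (\<Sum>j<length xs - 3. ?g (?q j))"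
    using cons by (intro sum.cong) auto
  also have "\<dots> = sum ?g (?q ` {..<length xs - 3})"
  proof (subst sum.reindex)
    show "inj_on ?q {..<length xs - 3}"
      using xs(1) by (auto simp: inj_on_def nth_eq_iff_index_eq)
  qed (simp add: o_def)
  also have "\<dots> \<le> sum ?g (I \<times> I \<times> I \<times> I)"
    using xs(2) I nonneg by (intro sum_mono2) (auto simp: nth_mem)
  also have "\<dots> = (\<Sum>a\<in>I. \<Sum>b\<in>I. \<Sum>c\<in>I. \<Sum>d\<in>I. if consecutive key I a b c d then f a b c d else 0)"
    by (simp add: sum.cartesian_product[symmetric] del: sum.cartesian_product')
  finally show ?thesis using that xs by blast
qed

lemma TSPD_speed_le_sum_consecutive:
  fixes x :: "'i \<Rightarrow> point"
  assumes \<alpha>: "1 \<le> \<alpha>" and m: "0 < m" and I: "finite I" "6 \<le> card I"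
    and inj: "inj_on (\<lambda>i. snake_t m (x i)) I"
    and x: "\<And>i. i \<in> I \<Longrightarrow> 0 < x i $ 1 \<and> x i $ 1 < 1 \<and> 0 \<le> x i $ 2 \<and> x i $ 2 \<le> 1"
  shows "3 * TSPD_speed \<alpha> (x ` I) \<le>
    (\<Sum>a\<in>I. \<Sum>b\<in>I. \<Sum>c\<in>I. \<Sum>d\<in>I. if consecutive (\<lambda>i. snake_t m (x i)) I a b c d then
        flat_cost \<alpha> m (snake m (x a)) (snake m (x b)) (snake m (x c)) (snake m (x d)) +
        cross_cost m (snake m (x a)) (snake m (x d)) else 0) + 30"
proof -
  let ?f = "\<lambda>a b c d. dist_cost \<alpha> (x a) (x b) (x c) (x d)"
  let ?key = "\<lambda>i. snake_t m (x i)"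
  have nonneg: "0 \<le> ?f a b c d" for a b c d
    using \<alpha> unfolding dist_cost_def by (intro ring4_nonneg) auto
  obtain xs where xs: "distinct xs" "set xs = I"
    "(\<Sum>j<length xs - 3. ?f (xs ! j) (xs ! (j+1)) (xs ! (j+2)) (xs ! (j+3))) \<le>
     (\<Sum>a\<in>I. \<Sum>b\<in>I. \<Sum>c\<in>I. \<Sum>d\<in>I. if consecutive ?key I a b c d then ?f a b c d else 0)"
    using sum_sorted_le_sum_consecutive[OF I(1) inj, of ?f] nonneg by blast
  have "inj_on x I"
    using inj by (auto simp: inj_on_def)
  then have dist: "distinct (map x xs)"
    using xs by (simp add: distinct_map)
  have len: "6 \<le> length xs"
    using xs I by (metis distinct_card)
  \<comment> \<open>The diameter of the square is bounded by the sum of its side lengths;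
    \<open>15 * D\<close> then becomes 30.\<close>
  have D: "dist p q \<le> 2" if pq: "p \<in> set (map x xs)" "q \<in> set (map x xs)" for p q
  proof -
    obtain i j where "p = x i" "q = x j" "i \<in> I" "j \<in> I"
      using pq xs(2) by auto
    then have "\<bar>p $ 1 - q $ 1\<bar> \<le> 1" "\<bar>p $ 2 - q $ 2\<bar> \<le> 1"
      using x[of i] x[of j] by (simp_all add: abs_le_iff)
    then show ?thesis
      using sqrt_sum_squares_le_sum_abs[of "p $ 1 - q $ 1" "p $ 2 - q $ 2"] unfolding dist_point by linarith
  qed
  have "3 * TSPD_speed \<alpha> (x ` I) \<le> (\<Sum>j<length xs - 3. ?f (xs ! j) (xs ! (j+1)) (xs ! (j+2)) (xs ! (j+3))) + 30"
    using TSPD_speed_le_consecutive[OF dist, of 2 \<alpha>] D len xs(2) by simp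
  also have "\<dots> \<le> (\<Sum>a\<in>I. \<Sum>b\<in>I. \<Sum>c\<in>I. \<Sum>d\<in>I. if consecutive ?key I a b c d then ?f a b c d else 0) + 30"
    using xs(3) by simp
  also have "\<dots> \<le> (\<Sum>a\<in>I. \<Sum>b\<in>I. \<Sum>c\<in>I. \<Sum>d\<in>I. if consecutive ?key I a b c d then
        flat_cost \<alpha> m (snake m (x a)) (snake m (x b)) (snake m (x c)) (snake m (x d)) +
        cross_cost m (snake m (x a)) (snake m (x d)) else 0) + 30"
  proof (intro add_right_mono sum_mono)
    fix a b c d assume "a \<in> I" "b \<in> I" "c \<in> I" "d \<in> I"
    then have "\<And>r. r \<in> {x a, x b, x c, x d} \<Longrightarrow> 0 < r $ 1 \<and> r $ 1 < 1" using x by blast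
    then show "(if consecutive ?key I a b c d then ?f a b c d else 0) \<le> (if consecutive ?key I a b c d then
        flat_cost \<alpha> m (snake m (x a)) (snake m (x b)) (snake m (x c)) (snake m (x d)) +
        cross_cost m (snake m (x a)) (snake m (x d)) else 0)"
      using dist_cost_le_flat_cost[OF \<alpha> m, of "x a" "x b" "x c" "x d"]
      by (auto simp: consecutive_def)
  qed
  finally show ?thesis .
qed

section \<open>Uniformity of the snake coordinates\<close>

definition mk_point :: "real \<times> real \<Rightarrow> point" where
  "mk_point z = (\<chi> i. if i = 1 then fst z else snd z)"

lemma mk_point_nth [simp]: "mk_point z $ 1 = fst z" "mk_point z $ 2 = snd z"
  by (simp_all add: mk_point_def)

lemma measurable_mk_point [measurable]: "mk_point \<in> borel_measurable borel"
proof (rule borel_measurable_continuous_onI)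
  have "continuous_on UNIV (\<lambda>z::real \<times> real. if i = (1::2) then fst z else snd z)" for i
    by (cases "i = 1") (auto intro!: continuous_intros)
  then show "continuous_on UNIV mk_point"
    unfolding mk_point_def by (intro continuous_on_vec_lambda)
qed

lemma Basis_point: "(Basis :: point set) = {axis 1 1, axis 2 1}"
  by (auto simp: Basis_vec_def UNIV_2)

text \<open>Lebesgue measure is determined by its values on open boxes, and on these both sides give
  the product of the side lengths. This carries integrals on \<open>real^2\<close> to pairs, where
  Fubini applies.\<close>

lemma lborel_point: "(lborel :: point measure) = distr lborel borel mk_point"
proof (rule lborel_eqI)
  fix l u :: point assume lu: "\<And>b. b \<in> Basis \<Longrightarrow> l \<bullet> b \<le> u \<bullet> b"
  have le: "l $ 1 \<le> u $ 1" "l $ 2 \<le> u $ 2"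
    using lu[of "axis 1 1"] lu[of "axis 2 1"] by (auto simp: Basis_point inner_axis)
  have "mk_point -` box l u = {l $ 1 <..< u $ 1} \<times> {l $ 2 <..< u $ 2}"
    by (auto simp: mem_box_cart forall_2)
  then have "emeasure (distr lborel borel mk_point) (box l u) =
    emeasure (lborel \<Otimes>\<^sub>M lborel) ({l $ 1 <..< u $ 1} \<times> {l $ 2 <..< u $ 2})"
    by (simp add: emeasure_distr lborel_prod)
  also have "\<dots> = ennreal (u $ 1 - l $ 1) * ennreal (u $ 2 - l $ 2)"
    using le by (subst lborel.emeasure_pair_measure_Times) auto
  also have "\<dots> = ennreal (\<Prod>b\<in>Basis. (u - l) \<bullet> b)"
    using le by (simp add: Basis_point inner_axis ennreal_mult axis_eq_axis)
  finally show "emeasure (distr lborel borel mk_point) (box l u) = ennreal (\<Prod>b\<in>Basis. (u - l) \<bullet> b)" .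
qed simp

lemma nn_integral_lborel_point:
  assumes [measurable]: "f \<in> borel_measurable borel"
  shows "(\<integral>\<^sup>+p. f p \<partial>lborel) = (\<integral>\<^sup>+x. \<integral>\<^sup>+y. f (mk_point (x, y)) \<partial>lborel \<partial>lborel)"
proof -
  have "(\<integral>\<^sup>+p. f p \<partial>lborel) = (\<integral>\<^sup>+z. f (mk_point z) \<partial>lborel)"
    by (subst lborel_point, subst nn_integral_distr) auto
  also have "\<dots> = (\<integral>\<^sup>+z. f (mk_point z) \<partial>(lborel \<Otimes>\<^sub>M lborel))"
    by (simp add: lborel_prod)
  also have "\<dots> = (\<integral>\<^sup>+x. \<integral>\<^sup>+y. f (mk_point (x, y)) \<partial>lborel \<partial>lborel)"
    by (rule lborel.nn_integral_fst[symmetric]) (simp add: lborel_prod)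
  finally show ?thesis .
qed

lemma measurable_point_nth [measurable]: "(\<lambda>p::point. p $ i) \<in> borel_measurable borel"
  by (intro borel_measurable_continuous_onI continuous_intros)

lemma measurable_snake_t [measurable]: "snake_t m \<in> borel_measurable borel"
proof -
  have *: "snake_t m = (\<lambda>p. of_int \<lfloor>real m * p $ 2\<rfloor> + (if even \<lfloor>real m * p $ 2\<rfloor> then p $ 1 else 1 - p $ 1))"
    by (simp add: fun_eq_iff snake_t_def Let_def)
  show ?thesis unfolding * by measurable
qed

lemma measurable_snake_u [measurable]: "snake_u m \<in> borel_measurable borel"
  unfolding snake_u_def frac_def by measurable

lemma measurable_snake [measurable]: "snake m \<in> borel_measurable borel"
  unfolding snake_def by measurable

lemma nn_integral_split_unit:
  fixes K :: "real \<Rightarrow> ennreal"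
  assumes [measurable]: "K \<in> borel_measurable borel"
  shows "(\<integral>\<^sup>+t. K t * indicator {0..<real m} t \<partial>lborel) =
    (\<Sum>j<m. \<integral>\<^sup>+s. K (real j + s) * indicator {0..<1} s \<partial>lborel)"
proof -
  have "(indicator {0..<real m} t :: ennreal) = (\<Sum>j<m. indicator {real j..<real j + 1} t)" for t
    by (induction m) (auto simp: indicator_def)
  then have "(\<integral>\<^sup>+t. K t * indicator {0..<real m} t \<partial>lborel) =
    (\<integral>\<^sup>+t. (\<Sum>j<m. K t * indicator {real j..<real j + 1} t) \<partial>lborel)"
    by (simp add: sum_distrib_left)
  also have "\<dots> = (\<Sum>j<m. \<integral>\<^sup>+t. K t * indicator {real j..<real j + 1} t \<partial>lborel)"
    by (rule nn_integral_sum) simp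
  also have "\<dots> = (\<Sum>j<m. \<integral>\<^sup>+s. K (real j + s) * indicator {0..<1} s \<partial>lborel)"
  proof (rule sum.cong[OF refl])
    fix j
    show "(\<integral>\<^sup>+t. K t * indicator {real j..<real j + 1} t \<partial>lborel) =
      (\<integral>\<^sup>+s. K (real j + s) * indicator {0..<1} s \<partial>lborel)"
      by (subst nn_integral_real_affine[of _ 1 "real j"])
        (auto intro!: nn_integral_cong simp: indicator_def)
  qed
  finally show ?thesis .
qed

lemma nn_integral_reflect_unit:
  fixes K :: "real \<Rightarrow> ennreal"
  assumes [measurable]: "K \<in> borel_measurable borel"
  shows "(\<integral>\<^sup>+x. K (1 - x) * indicator {0..1} x \<partial>lborel) = (\<integral>\<^sup>+x. K x * indicator {0..1} x \<partial>lborel)"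
  by (subst (2) nn_integral_real_affine[of _ "-1" 1])
    (auto intro!: nn_integral_cong simp: indicator_def)

text \<open>Half-open intervals tile the line without overlap and keep the floor constant, closed
  ones are symmetric under reflection; the two versions differ by a null set.\<close>

lemma nn_integral_half_open:
  fixes K :: "real \<Rightarrow> ennreal"
  shows "(\<integral>\<^sup>+x. K x * indicator {a..<b} x \<partial>lborel) = (\<integral>\<^sup>+x. K x * indicator {a..b} x \<partial>lborel)"
  by (rule nn_integral_cong_AE) (use AE_lborel_singleton[of b] in \<open>auto simp: indicator_def\<close>)

definition square_unif :: "point measure" where
  "square_unif = uniform_measure lborel (cbox 0 1)"

definition flat_unif :: "nat \<Rightarrow> (real \<times> real) measure" where
  "flat_unif m = distr square_unif borel (snake m)"

lemma nn_integral_square_unif: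
  assumes [measurable]: "f \<in> borel_measurable borel"
  shows "(\<integral>\<^sup>+p. f p \<partial>square_unif) =
    (\<integral>\<^sup>+x. (\<integral>\<^sup>+y. f (mk_point (x, y)) * indicator {0..1} y \<partial>lborel) * indicator {0..1} x \<partial>lborel)"
proof -
  have "emeasure lborel (cbox 0 (1::point)) = 1"
    by (subst emeasure_lborel_cbox) (auto simp: Basis_point inner_axis axis_eq_axis)
  then have "(\<integral>\<^sup>+p. f p \<partial>square_unif) = (\<integral>\<^sup>+p. f p * indicator (cbox 0 1) p \<partial>lborel)"
    unfolding square_unif_def by (subst nn_integral_uniform_measure) (auto simp: divide_ennreal_def)
  also have "\<dots> = (\<integral>\<^sup>+x. \<integral>\<^sup>+y. f (mk_point (x, y)) * indicator (cbox 0 1) (mk_point (x, y)) \<partial>lborel \<partial>lborel)"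
    by (rule nn_integral_lborel_point) measurable
  also have "\<dots> = (\<integral>\<^sup>+x. \<integral>\<^sup>+y. f (mk_point (x, y)) * indicator {0..1} y * indicator {0..1} x \<partial>lborel \<partial>lborel)"
    by (intro nn_integral_cong) (auto simp: indicator_def mem_box_cart forall_2)
  also have "\<dots> = (\<integral>\<^sup>+x. (\<integral>\<^sup>+y. f (mk_point (x, y)) * indicator {0..1} y \<partial>lborel) * indicator {0..1} x \<partial>lborel)"
    by (intro nn_integral_cong nn_integral_multc) (measurable)
  finally show ?thesis .
qed

text \<open>Rescaling the height by \<open>m\<close> gives the factor \<open>1 / m\<close> and turns
  the strips into unit intervals. On the \<open>j\<close>-th of them the snake map is affine in the
  abscissa, with a reflection if \<open>j\<close> is odd, and reflection preserves Lebesgue measure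
  on the unit interval. The separate form by strips serves the estimate near the turns.\<close>

lemma nn_integral_flat_unif_strips:
  fixes H :: "real \<times> real \<Rightarrow> ennreal"
  assumes m: "0 < m" and [measurable]: "H \<in> borel_measurable borel"
  shows "(\<integral>\<^sup>+y. H y \<partial>flat_unif m) =
    ennreal (1 / real m) * (\<Sum>j<m. \<integral>\<^sup>+s. (\<integral>\<^sup>+u. H (real j + s, u) * indicator {0..1} u \<partial>lborel) * indicator {0..1} s \<partial>lborel)"
proof -
  let ?c = "ennreal (1 / real m)"
  let ?\<sigma> = "\<lambda>j x. if even j then x else 1 - x :: real"
  let ?V = "\<lambda>t. \<integral>\<^sup>+u. H (t, u) * indicator {0..1} u \<partial>lborel"
  have strip: "(\<integral>\<^sup>+y. H (snake m (mk_point (x, y))) * indicator {0..1} y \<partial>lborel) =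
    ?c * (\<Sum>j<m. ?V (real j + ?\<sigma> j x))" for x
  proof -
    have "(\<integral>\<^sup>+y. H (snake m (mk_point (x, y))) * indicator {0..1} y \<partial>lborel) =
      (\<integral>\<^sup>+y. H (snake m (mk_point (x, y))) * indicator {0..<1} y \<partial>lborel)"
      by (rule nn_integral_half_open[symmetric])
    also have "\<dots> = ?c * (\<integral>\<^sup>+z. H (snake m (mk_point (x, z / m))) * indicator {0..<1} (z / m) \<partial>lborel)"
      using m by (subst nn_integral_real_affine[of _ "1 / m" 0]) auto
    also have "(\<integral>\<^sup>+z. H (snake m (mk_point (x, z / m))) * indicator {0..<1} (z / m) \<partial>lborel) =
      (\<integral>\<^sup>+z. H (snake m (mk_point (x, z / m))) * indicator {0..<real m} z \<partial>lborel)"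
      using m by (intro nn_integral_cong) (auto simp: indicator_def field_simps)
    also have "\<dots> = (\<Sum>j<m. \<integral>\<^sup>+u. H (snake m (mk_point (x, (real j + u) / m))) * indicator {0..<1} u \<partial>lborel)"
      by (rule nn_integral_split_unit) measurable
    also have "\<dots> = (\<Sum>j<m. \<integral>\<^sup>+u. H (real j + ?\<sigma> j x, u) * indicator {0..<1} u \<partial>lborel)"
    proof (intro sum.cong refl nn_integral_cong)
      fix j u
      show "H (snake m (mk_point (x, (real j + u) / m))) * indicator {0..<1} u =
        H (real j + ?\<sigma> j x, u) * indicator {0..<1} u"
      proof (cases "u \<in> {0..<1}")
        case True
        then have "\<lfloor>real j + u\<rfloor> = int j" by (simp add: floor_eq_iff)
        then show ?thesis using m
          by (simp add: snake_def snake_t_def snake_u_def frac_def Let_def)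
      qed simp
    qed
    also have "\<dots> = (\<Sum>j<m. ?V (real j + ?\<sigma> j x))"
      by (simp only: nn_integral_half_open)
    finally show ?thesis .
  qed
  have "(\<integral>\<^sup>+y. H y \<partial>flat_unif m) = (\<integral>\<^sup>+p. H (snake m p) \<partial>square_unif)"
    unfolding flat_unif_def by (rule nn_integral_distr) (simp_all add: square_unif_def)
  also have "\<dots> = (\<integral>\<^sup>+x. (?c * (\<Sum>j<m. ?V (real j + ?\<sigma> j x))) * indicator {0..1} x \<partial>lborel)"
    by (subst nn_integral_square_unif) (auto simp only: strip, measurable)
  also have "\<dots> = (\<integral>\<^sup>+x. ?c * (\<Sum>j<m. ?V (real j + ?\<sigma> j x) * indicator {0..1} x) \<partial>lborel)"
    by (simp add: sum_distrib_right mult.assoc)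
  also have "\<dots> = ?c * (\<Sum>j<m. \<integral>\<^sup>+x. ?V (real j + ?\<sigma> j x) * indicator {0..1} x \<partial>lborel)"
    by (subst nn_integral_cmult, measurable, subst nn_integral_sum, measurable)
  also have "(\<Sum>j<m. \<integral>\<^sup>+x. ?V (real j + ?\<sigma> j x) * indicator {0..1} x \<partial>lborel) =
    (\<Sum>j<m. \<integral>\<^sup>+s. ?V (real j + s) * indicator {0..1} s \<partial>lborel)"
  proof (rule sum.cong[OF refl])
    fix j
    have "(\<integral>\<^sup>+x. ?V (real j + (1 - x)) * indicator {0..1} x \<partial>lborel) =
      (\<integral>\<^sup>+s. ?V (real j + s) * indicator {0..1} s \<partial>lborel)"
      by (rule nn_integral_reflect_unit[where K="\<lambda>s. ?V (real j + s)"]) measurable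
    then show "(\<integral>\<^sup>+x. ?V (real j + ?\<sigma> j x) * indicator {0..1} x \<partial>lborel) =
      (\<integral>\<^sup>+s. ?V (real j + s) * indicator {0..1} s \<partial>lborel)"
      by (cases "even j") auto
  qed
  finally show ?thesis .
qed

text \<open>The unit intervals of the strips glue together, so the snake coordinates of a uniform
  point are uniform on a rectangle of length \<open>m\<close> and height 1.\<close>

lemma nn_integral_flat_unif:
  fixes H :: "real \<times> real \<Rightarrow> ennreal"
  assumes m: "0 < m" and [measurable]: "H \<in> borel_measurable borel"
  shows "(\<integral>\<^sup>+y. H y \<partial>flat_unif m) = ennreal (1 / real m) *
    (\<integral>\<^sup>+t. (\<integral>\<^sup>+u. H (t, u) * indicator {0..1} u \<partial>lborel) * indicator {0..real m} t \<partial>lborel)"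
proof -
  let ?V = "\<lambda>t. \<integral>\<^sup>+u. H (t, u) * indicator {0..1} u \<partial>lborel"
  have "(\<integral>\<^sup>+t. ?V t * indicator {0..real m} t \<partial>lborel) = (\<Sum>j<m. \<integral>\<^sup>+s. ?V (real j + s) * indicator {0..1} s \<partial>lborel)"
    by (subst nn_integral_half_open[symmetric], subst nn_integral_split_unit) (simp_all add: nn_integral_half_open)
  then show ?thesis using m by (simp add: nn_integral_flat_unif_strips)
qed

section \<open>Probability of being consecutive\<close>

lemma (in prob_space) nn_integral_indep_vars:
  assumes indep: "indep_vars (\<lambda>_. borel) Y I" and I: "I \<noteq> {}"
    and F: "F \<in> borel_measurable (\<Pi>\<^sub>M i\<in>I. borel)"
  shows "(\<integral>\<^sup>+\<omega>. F (\<lambda>i\<in>I. Y i \<omega>) \<partial>M) = (\<integral>\<^sup>+x. F x \<partial>(\<Pi>\<^sub>M i\<in>I. distr M borel (Y i)))"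
proof -
  have rv: "\<And>i. i \<in> I \<Longrightarrow> random_variable borel (Y i)"
    using indep by (auto simp: indep_vars_def)
  have "(\<integral>\<^sup>+\<omega>. F (\<lambda>i\<in>I. Y i \<omega>) \<partial>M) = (\<integral>\<^sup>+x. F x \<partial>distr M (\<Pi>\<^sub>M i\<in>I. borel) (\<lambda>\<omega>. \<lambda>i\<in>I. Y i \<omega>))"
    using rv F by (subst nn_integral_distr) (auto intro!: measurable_restrict)
  then show ?thesis
    using indep_vars_iff_distr_eq_PiM'[OF I, where M'="\<lambda>_. borel" and X=Y] rv indep by simp
qed

lemma measurable_fst_borel [measurable]: "(fst :: real \<times> real \<Rightarrow> real) \<in> borel_measurable borel"
  by (intro borel_measurable_continuous_onI continuous_intros)

lemma measurable_snd_borel [measurable]: "(snd :: real \<times> real \<Rightarrow> real) \<in> borel_measurable borel"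
  by (intro borel_measurable_continuous_onI continuous_intros)

definition avoid :: "real \<times> real \<Rightarrow> real \<times> real \<Rightarrow> (real \<times> real) set" where
  "avoid y\<^sub>0 y\<^sub>3 = {y. \<not> (fst y\<^sub>0 < fst y \<and> fst y < fst y\<^sub>3)}"

text \<open>Conditionally on the four chosen points, the other \<open>card I - 4\<close> points
  independently avoid the open interval between the outer two, which produces the power. The four
  coordinates are split off the product measure one at a time; for indices that are not distinct the
  left side vanishes.\<close>

lemma (in prob_space) nn_integral_consecutive:
  fixes Y :: "'i \<Rightarrow> 'a \<Rightarrow> real \<times> real"
    and G :: "real \<times> real \<Rightarrow> real \<times> real \<Rightarrow> real \<times> real \<Rightarrow> real \<times> real \<Rightarrow> ennreal"
  assumes indep: "indep_vars (\<lambda>_. borel) Y I" and I: "finite I" "{a,b,c,d} \<subseteq> I"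
    and P: "\<And>i. i \<in> I \<Longrightarrow> distr M borel (Y i) = P"
    and G[measurable]: "(\<lambda>(y0,y1,y2,y3). G y0 y1 y2 y3) \<in> borel_measurable (borel \<Otimes>\<^sub>M borel \<Otimes>\<^sub>M borel \<Otimes>\<^sub>M borel)"
  shows "(\<integral>\<^sup>+\<omega>. (if consecutive (\<lambda>i. fst (Y i \<omega>)) I a b c d
        then G (Y a \<omega>) (Y b \<omega>) (Y c \<omega>) (Y d \<omega>) else 0) \<partial>M) \<le>
    (\<integral>\<^sup>+y0. \<integral>\<^sup>+y1. \<integral>\<^sup>+y2. \<integral>\<^sup>+y3. (if fst y0 < fst y1 \<and> fst y1 < fst y2 \<and> fst y2 < fst y3
      then G y0 y1 y2 y3 * emeasure P (avoid y0 y3) ^ (card I - 4) else 0) \<partial>P \<partial>P \<partial>P \<partial>P)"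
    (is "?lhs \<le> ?rhs")
proof (cases "distinct [a,b,c,d]")
  case False
  then have "\<not> consecutive k I a b c d" for k :: "'i \<Rightarrow> real"
    by (auto simp: consecutive_def)
  then show ?thesis by simp
next
  case True
  define J where "J = I - {a,b,c,d}"
  have J: "finite J" "a \<notin> J" "b \<notin> J" "c \<notin> J" "d \<notin> J"
    and IJ: "I = insert a (insert b (insert c (insert d J)))"
    using I by (auto simp: J_def)
  have cardJ: "card J = card I - 4"
    using True J by (simp add: IJ)
  have ne: "a \<noteq> b" "a \<noteq> c" "a \<noteq> d" "b \<noteq> c" "b \<noteq> d" "c \<noteq> d" using True by auto
  have rv: "\<And>i. i \<in> I \<Longrightarrow> random_variable borel (Y i)"
    using indep by (auto simp: indep_vars_def)
  have prob_P: "prob_space P"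
    using P[of a] rv[of a] I(2) by (metis insert_subset prob_space_distr)
  have sets_P[measurable_cong]: "sets P = sets borel"
    using P[of a] I(2) by (metis insert_subset sets_distr)
  interpret P: prob_space P by (rule prob_P)
  interpret PJ: product_sigma_finite "\<lambda>_::'i. P" by standard
  define H where "H y0 y1 y2 y3 = (if fst y0 < fst y1 \<and> fst y1 < fst y2 \<and> fst y2 < fst y3
      then G y0 y1 y2 y3 else 0)" for y0 y1 y2 y3
  have H[measurable]: "(\<lambda>(y0,y1,y2,y3). H y0 y1 y2 y3) \<in> borel_measurable (borel \<Otimes>\<^sub>M borel \<Otimes>\<^sub>M borel \<Otimes>\<^sub>M borel)"
  proof -
    have [measurable]: "(\<lambda>x. G (fst x) (fst (snd x)) (fst (snd (snd x))) (snd (snd (snd x))))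
      \<in> borel_measurable (borel \<Otimes>\<^sub>M borel \<Otimes>\<^sub>M borel \<Otimes>\<^sub>M borel)"
      using G by (simp add: split_beta')
    show ?thesis unfolding H_def split_beta' by measurable
  qed
  \<comment> \<open>The event that no other point falls in between, as a product of indicators over
    \<open>J\<close>, so that its integral factorises.\<close>
  define R :: "real \<times> real \<Rightarrow> real \<times> real \<Rightarrow> ('i \<Rightarrow> real \<times> real) \<Rightarrow> ennreal"
    where "R y0 y3 x = (\<Prod>l\<in>J. indicator (avoid y0 y3) (x l))" for y0 y3 and x :: "'i \<Rightarrow> real \<times> real"
  have avoid[measurable]: "avoid y0 y3 \<in> sets borel" for y0 y3
    unfolding avoid_def by measurable
  define F where "F = (\<lambda>x. H (x a) (x b) (x c) (x d) * R (x a) (x d) x)"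
  have comp: "(\<lambda>x. x i) \<in> PiM K (\<lambda>_. P) \<rightarrow>\<^sub>M borel" if "i \<in> K" for i :: 'i and K
    using measurable_component_singleton[OF that, of "\<lambda>_. P"] sets_P measurable_cong_sets by blast
  have R_meas: "(\<lambda>x. R (f x) (g x) x) \<in> borel_measurable (PiM K (\<lambda>_. P))"
    if [measurable]: "f \<in> PiM K (\<lambda>_. P) \<rightarrow>\<^sub>M borel" "g \<in> PiM K (\<lambda>_. P) \<rightarrow>\<^sub>M borel" and "J \<subseteq> K" for f g K
  proof -
    have "(\<lambda>x. indicator (avoid (f x) (g x)) (x l) :: ennreal) \<in> borel_measurable (PiM K (\<lambda>_. P))" if "l \<in> J" for l
    proof -
      have [measurable]: "(\<lambda>x. x l) \<in> PiM K (\<lambda>_. P) \<rightarrow>\<^sub>M borel"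
        using that \<open>J \<subseteq> K\<close> by (intro comp) auto
      have *: "(\<lambda>x. indicator (avoid (f x) (g x)) (x l) :: ennreal) =
        (\<lambda>x. if fst (f x) < fst (x l) \<and> fst (x l) < fst (g x) then 0 else 1)"
        by (auto simp: avoid_def fun_eq_iff)
      show ?thesis unfolding * by measurable
    qed
    then show ?thesis unfolding R_def by (intro borel_measurable_prod_ennreal)
  qed
  have H_meas: "(\<lambda>x. H (f0 x) (f1 x) (f2 x) (f3 x)) \<in> borel_measurable N"
    if "f0 \<in> N \<rightarrow>\<^sub>M borel" "f1 \<in> N \<rightarrow>\<^sub>M borel" "f2 \<in> N \<rightarrow>\<^sub>M borel" "f3 \<in> N \<rightarrow>\<^sub>M borel" 
    for f0 f1 f2 f3 and N :: "'c measure"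
    using measurable_compose[OF measurable_Pair[OF that(1) measurable_Pair[OF that(2) measurable_Pair[OF that(3,4)]]] H]
    by simp
  have setsI: "sets (\<Pi>\<^sub>M i\<in>I. borel) = sets (PiM I (\<lambda>_. P))"
    using sets_P by (intro sets_PiM_cong) auto
  have F: "F \<in> borel_measurable (PiM I (\<lambda>_. P))"
    unfolding F_def using I
    by (intro borel_measurable_times_ennreal H_meas R_meas comp) (auto simp: J_def)
  \<comment> \<open>Splitting off a coordinate leaves a function update in the integrand;
    \<open>R\<close> reads only coordinates in \<open>J\<close> and ignores updates
    elsewhere.\<close>
  have upd: "R y0 y3 (x(i := y)) = R y0 y3 x" if "i \<notin> J" for y0 y3 x i y
    using that unfolding R_def by (intro prod.cong) auto
  have "?lhs = (\<integral>\<^sup>+\<omega>. F (\<lambda>i\<in>I. Y i \<omega>) \<partial>M)"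
  proof (rule nn_integral_cong)
    fix \<omega>
    have "R (Y a \<omega>) (Y d \<omega>) (\<lambda>i\<in>I. Y i \<omega>) =
      (if \<forall>l\<in>J. \<not> (fst (Y a \<omega>) < fst (Y l \<omega>) \<and> fst (Y l \<omega>) < fst (Y d \<omega>)) then 1 else 0)"
    proof (cases "\<forall>l\<in>J. \<not> (fst (Y a \<omega>) < fst (Y l \<omega>) \<and> fst (Y l \<omega>) < fst (Y d \<omega>))")
      case True
      then show ?thesis unfolding R_def
        by (simp, intro prod.neutral) (auto simp: avoid_def IJ)
    next
      case False
      then obtain l where l: "l \<in> J" "fst (Y a \<omega>) < fst (Y l \<omega>) \<and> fst (Y l \<omega>) < fst (Y d \<omega>)" by blast
      then have "R (Y a \<omega>) (Y d \<omega>) (\<lambda>i\<in>I. Y i \<omega>) = 0"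
        unfolding R_def using J by (intro prod_zero bexI[of _ l]) (auto simp: avoid_def IJ)
      then show ?thesis using False by auto
    qed
    then show "(if consecutive (\<lambda>i. fst (Y i \<omega>)) I a b c d
        then G (Y a \<omega>) (Y b \<omega>) (Y c \<omega>) (Y d \<omega>) else 0) = F (\<lambda>i\<in>I. Y i \<omega>)"
      using I(2) by (auto simp: F_def H_def consecutive_def J_def)
  qed
  also have "\<dots> = (\<integral>\<^sup>+x. F x \<partial>(\<Pi>\<^sub>M i\<in>I. distr M borel (Y i)))"
    using I F by (intro nn_integral_indep_vars indep) (auto simp: measurable_cong_sets[OF setsI refl])
  also have "(\<Pi>\<^sub>M i\<in>I. distr M borel (Y i)) = PiM I (\<lambda>_. P)"
    using P by (intro PiM_cong) auto
  also have "PiM I (\<lambda>_. P) = PiM (insert a (insert b (insert c (insert d J)))) (\<lambda>_. P)"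
    by (simp only: IJ)
  also have "(\<integral>\<^sup>+x. F x \<partial>PiM (insert a (insert b (insert c (insert d J)))) (\<lambda>_. P)) =
    (\<integral>\<^sup>+y0. \<integral>\<^sup>+x. H y0 (x b) (x c) (x d) * R y0 (x d) x \<partial>PiM (insert b (insert c (insert d J))) (\<lambda>_. P) \<partial>P)"
    using J ne PJ.product_nn_integral_insert_rev[OF _ _ F[unfolded IJ]] by (simp add: F_def upd)
  also have "\<dots> = (\<integral>\<^sup>+y0. \<integral>\<^sup>+y1. \<integral>\<^sup>+x. H y0 y1 (x c) (x d) * R y0 (x d) x \<partial>PiM (insert c (insert d J)) (\<lambda>_. P) \<partial>P \<partial>P)"
  proof (rule nn_integral_cong)
    fix y0
    have "(\<lambda>x. H y0 (x b) (x c) (x d) * R y0 (x d) x) \<in> borel_measurable (PiM (insert b (insert c (insert d J))) (\<lambda>_. P))"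
      by (intro borel_measurable_times_ennreal H_meas R_meas comp) auto
    from PJ.product_nn_integral_insert_rev[OF _ _ this]
    show "(\<integral>\<^sup>+x. H y0 (x b) (x c) (x d) * R y0 (x d) x \<partial>PiM (insert b (insert c (insert d J))) (\<lambda>_. P)) =
      (\<integral>\<^sup>+y1. \<integral>\<^sup>+x. H y0 y1 (x c) (x d) * R y0 (x d) x \<partial>PiM (insert c (insert d J)) (\<lambda>_. P) \<partial>P)"
      using J ne by (simp add: upd)
  qed
  also have "\<dots> = (\<integral>\<^sup>+y0. \<integral>\<^sup>+y1. \<integral>\<^sup>+y2. \<integral>\<^sup>+x. H y0 y1 y2 (x d) * R y0 (x d) x \<partial>PiM (insert d J) (\<lambda>_. P) \<partial>P \<partial>P \<partial>P)"
  proof (intro nn_integral_cong)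
    fix y0 y1
    have "(\<lambda>x. H y0 y1 (x c) (x d) * R y0 (x d) x) \<in> borel_measurable (PiM (insert c (insert d J)) (\<lambda>_. P))"
      by (intro borel_measurable_times_ennreal H_meas R_meas comp) auto
    from PJ.product_nn_integral_insert_rev[OF _ _ this]
    show "(\<integral>\<^sup>+x. H y0 y1 (x c) (x d) * R y0 (x d) x \<partial>PiM (insert c (insert d J)) (\<lambda>_. P)) =
      (\<integral>\<^sup>+y2. \<integral>\<^sup>+x. H y0 y1 y2 (x d) * R y0 (x d) x \<partial>PiM (insert d J) (\<lambda>_. P) \<partial>P)"
      using J ne by (simp add: upd)
  qed
  also have "\<dots> = (\<integral>\<^sup>+y0. \<integral>\<^sup>+y1. \<integral>\<^sup>+y2. \<integral>\<^sup>+y3. \<integral>\<^sup>+x. H y0 y1 y2 y3 * R y0 y3 x \<partial>PiM J (\<lambda>_. P) \<partial>P \<partial>P \<partial>P \<partial>P)"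
  proof (intro nn_integral_cong)
    fix y0 y1 y2
    have "(\<lambda>x. H y0 y1 y2 (x d) * R y0 (x d) x) \<in> borel_measurable (PiM (insert d J) (\<lambda>_. P))"
      by (intro borel_measurable_times_ennreal H_meas R_meas comp) auto
    from PJ.product_nn_integral_insert_rev[OF _ _ this]
    show "(\<integral>\<^sup>+x. H y0 y1 y2 (x d) * R y0 (x d) x \<partial>PiM (insert d J) (\<lambda>_. P)) =
      (\<integral>\<^sup>+y3. \<integral>\<^sup>+x. H y0 y1 y2 y3 * R y0 y3 x \<partial>PiM J (\<lambda>_. P) \<partial>P)"
      using J by (simp add: upd)
  qed
  also have "\<dots> = (\<integral>\<^sup>+y0. \<integral>\<^sup>+y1. \<integral>\<^sup>+y2. \<integral>\<^sup>+y3. H y0 y1 y2 y3 * emeasure P (avoid y0 y3) ^ card J \<partial>P \<partial>P \<partial>P \<partial>P)"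
  proof (intro nn_integral_cong)
    fix y0 y1 y2 y3
    have avP: "avoid y0 y3 \<in> sets P" by measurable
    have "(\<integral>\<^sup>+x. H y0 y1 y2 y3 * R y0 y3 x \<partial>PiM J (\<lambda>_. P)) = H y0 y1 y2 y3 * (\<integral>\<^sup>+x. R y0 y3 x \<partial>PiM J (\<lambda>_. P))"
      by (intro nn_integral_cmult R_meas) auto
    also have "(\<integral>\<^sup>+x. R y0 y3 x \<partial>PiM J (\<lambda>_. P)) = (\<Prod>l\<in>J. \<integral>\<^sup>+y. indicator (avoid y0 y3) y \<partial>P)"
      unfolding R_def using J avP by (intro PJ.product_nn_integral_prod) auto
    also have "\<dots> = emeasure P (avoid y0 y3) ^ card J"
      using avP by simp
    finally show "(\<integral>\<^sup>+x. H y0 y1 y2 y3 * R y0 y3 x \<partial>PiM J (\<lambda>_. P)) = H y0 y1 y2 y3 * emeasure P (avoid y0 y3) ^ card J" .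
  qed
  also have "\<dots> = ?rhs"
    unfolding H_def cardJ by (intro nn_integral_cong) auto
  finally show ?thesis by simp
qed

section \<open>Exponential gaps\<close>

definition exp1 :: "real measure" where
  "exp1 = density lborel (exponential_density 1)"

definition unif01 :: "real measure" where
  "unif01 = uniform_measure lborel {0..1}"

lemma prob_space_exp1: "prob_space exp1"
  unfolding exp1_def by (rule prob_space_exponential_density) simp

lemma prob_space_unif01: "prob_space unif01"
  unfolding unif01_def by (rule prob_space_uniform_measure) auto

lemma sets_exp1 [simp, measurable_cong]: "sets exp1 = sets borel"
  by (simp add: exp1_def)

lemma sets_unif01 [simp, measurable_cong]: "sets unif01 = sets borel"
  by (simp add: unif01_def)

lemma prob_space_square_unif: "prob_space square_unif"
  unfolding square_unif_def
  by (rule prob_space_uniform_measure)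
     (simp_all add: emeasure_lborel_cbox_eq Basis_point inner_axis axis_eq_axis)

lemma sets_flat_unif [simp, measurable_cong]: "sets (flat_unif m) = sets borel"
  by (simp add: flat_unif_def)

lemma prob_space_flat_unif: "prob_space (flat_unif m)"
  unfolding flat_unif_def
  by (rule prob_space.prob_space_distr[OF prob_space_square_unif]) (simp add: square_unif_def)

lemma nn_integral_unif01:
  assumes [measurable]: "f \<in> borel_measurable borel"
  shows "(\<integral>\<^sup>+u. f u \<partial>unif01) = (\<integral>\<^sup>+u. f u * indicator {0..1} u \<partial>lborel)"
  unfolding unif01_def by (subst nn_integral_uniform_measure) (auto simp: divide_ennreal_def)

lemma nn_integral_exp1:
  assumes [measurable]: "f \<in> borel_measurable borel"
  shows "(\<integral>\<^sup>+z. f z \<partial>exp1) = (\<integral>\<^sup>+z. ennreal (exp (- z)) * f z * indicator {0..} z \<partial>lborel)"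
  unfolding exp1_def
  by (subst nn_integral_density)
    (auto simp: exponential_density_def indicator_def intro!: nn_integral_cong)

lemma AE_flat_unif:
  assumes m: "0 < m"
  shows "AE y in flat_unif m. 0 \<le> fst y \<and> fst y \<le> real m"
proof -
  let ?N = "{y :: real \<times> real. \<not> (0 \<le> fst y \<and> fst y \<le> real m)}"
  have N: "?N \<in> sets borel" by measurable
  have "emeasure (flat_unif m) ?N = (\<integral>\<^sup>+y. indicator ?N y \<partial>flat_unif m)"
    using N by simp
  also have "\<dots> = ennreal (1 / real m) *
    (\<integral>\<^sup>+t. (\<integral>\<^sup>+u. indicator ?N (t, u) * indicator {0..1} u \<partial>lborel) * indicator {0..real m} t \<partial>lborel)"
    using m N by (intro nn_integral_flat_unif) auto
  also have "(\<integral>\<^sup>+t. (\<integral>\<^sup>+u. indicator ?N (t, u) * indicator {0..1} u \<partial>lborel) * indicator {0..real m} t \<partial>lborel) = (\<integral>\<^sup>+(t::real). 0 \<partial>lborel)"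
    by (intro nn_integral_cong) (auto simp: indicator_def)
  finally show ?thesis
    using N by (intro AE_I[of _ _ ?N]) auto
qed

text \<open>The probability is exactly 1 minus the relative length of the interval;
  \<open>1 - x \<le> exp (- x)\<close> replaces it by a weight that is multiplicative over
  successive gaps.\<close>

lemma emeasure_flat_unif_avoid_le:
  assumes m: "0 < m" and y: "0 \<le> fst y0" "fst y0 \<le> fst y3" "fst y3 \<le> real m"
  shows "emeasure (flat_unif m) (avoid y0 y3) \<le> ennreal (exp (- ((fst y3 - fst y0) / real m)))"
proof -
  have A: "avoid y0 y3 \<in> sets borel" unfolding avoid_def by measurable
  have "emeasure (flat_unif m) (avoid y0 y3) = (\<integral>\<^sup>+y. indicator (avoid y0 y3) y \<partial>flat_unif m)"
    using A by simp
  also have "\<dots> = ennreal (1 / real m) *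
    (\<integral>\<^sup>+t. (\<integral>\<^sup>+u. indicator (avoid y0 y3) (t, u) * indicator {0..1} u \<partial>lborel) * indicator {0..real m} t \<partial>lborel)"
    using m A by (intro nn_integral_flat_unif) auto
  also have "(\<integral>\<^sup>+t. (\<integral>\<^sup>+u. indicator (avoid y0 y3) (t, u) * indicator {0..1} u \<partial>lborel) * indicator {0..real m} t \<partial>lborel)
    = (\<integral>\<^sup>+t. indicator {0..fst y0} t + indicator {fst y3..real m} t \<partial>lborel)"
  proof (rule nn_integral_cong_AE)
    have "AE t in lborel. t \<noteq> fst y0 \<and> t \<noteq> fst y3"
      using AE_lborel_singleton[of "fst y0"] AE_lborel_singleton[of "fst y3"] by auto
    moreover have "(\<integral>\<^sup>+u. indicator (avoid y0 y3) (t, u) * indicator {0..1} u \<partial>lborel) =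
      (if fst y0 < t \<and> t < fst y3 then 0 else 1)" for t :: real
    proof -
      have "(\<lambda>u. indicator (avoid y0 y3) (t, u) * indicator {0..1} u :: ennreal) =
        (if fst y0 < t \<and> t < fst y3 then (\<lambda>u. 0) else indicator {0..1})"
        by (auto simp: avoid_def fun_eq_iff)
      then show ?thesis by simp
    qed
    ultimately show "AE t in lborel. (\<integral>\<^sup>+u. indicator (avoid y0 y3) (t, u) * indicator {0..1} u \<partial>lborel) * indicator {0..real m} t =
      indicator {0..fst y0} t + indicator {fst y3..real m} t"
      using y by (auto simp: indicator_def elim!: eventually_mono)
  qed
  also have "\<dots> = ennreal (fst y0) + ennreal (real m - fst y3)"
    using y by (simp add: nn_integral_add)
  also have "\<dots> = ennreal (real m - (fst y3 - fst y0))"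
    using y by (simp add: algebra_simps flip: ennreal_plus)
  also have "ennreal (1 / real m) * \<dots> = ennreal (1 - (fst y3 - fst y0) / real m)"
    using m by (subst ennreal_mult'[symmetric]) (auto simp: diff_divide_distrib)
  also have "\<dots> \<le> ennreal (exp (- ((fst y3 - fst y0) / real m)))"
    using exp_ge_add_one_self[of "- ((fst y3 - fst y0) / real m)"] by (intro ennreal_leI) simp
  finally show ?thesis .
qed

text \<open>
  The substitution \<open>t = s + z / c\<close> turns the next point after \<open>s\<close> into an exponential gap.
\<close>

lemma nn_integral_flat_unif_peel:
  fixes K :: "real \<times> real \<Rightarrow> ennreal"
  assumes m: "0 < m" and c: "0 < c" and [measurable]: "K \<in> borel_measurable borel"
  shows "(\<integral>\<^sup>+y. (if s < fst y then ennreal (exp (- (c * (fst y - s)))) * K y else 0) \<partial>flat_unif m) \<le>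
    ennreal (1 / (real m * c)) * (\<integral>\<^sup>+z. \<integral>\<^sup>+u. K (s + z / c, u) \<partial>unif01 \<partial>exp1)"
proof -
  interpret unif01: prob_space unif01 by (rule prob_space_unif01)
  have [measurable]: "(\<lambda>z. K (f z, g z)) \<in> borel_measurable N"
    if [measurable]: "f \<in> borel_measurable N" "g \<in> borel_measurable N" for f g and N :: "'z measure"
  proof -
    have "(\<lambda>z. (f z, g z)) \<in> N \<rightarrow>\<^sub>M borel" unfolding borel_prod[symmetric] by measurable
    then show ?thesis by measurable
  qed
  let ?V = "\<lambda>t. \<integral>\<^sup>+u. K (t, u) \<partial>unif01"
  have V[measurable]: "(\<lambda>z. ?V (f z)) \<in> borel_measurable N" 
    if [measurable]: "f \<in> borel_measurable N" for f and N :: "real measure"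
    by measurable
  let ?g = "\<lambda>t. if s < t then ennreal (exp (- (c * (t - s)))) * ?V t else 0"
  have "(\<integral>\<^sup>+y. (if s < fst y then ennreal (exp (- (c * (fst y - s)))) * K y else 0) \<partial>flat_unif m) =
    ennreal (1 / real m) * (\<integral>\<^sup>+t. (\<integral>\<^sup>+u. (if s < t then ennreal (exp (- (c * (t - s)))) * K (t, u) else 0) * indicator {0..1} u \<partial>lborel)
      * indicator {0..real m} t \<partial>lborel)"
    using m by (subst nn_integral_flat_unif) (auto cong: if_cong)
  also have "\<dots> = ennreal (1 / real m) * (\<integral>\<^sup>+t. ?g t * indicator {0..real m} t \<partial>lborel)"
  proof -
    have "(\<integral>\<^sup>+u. (if s < t then ennreal (exp (- (c * (t - s)))) * K (t, u) else 0) * indicator {0..1} u \<partial>lborel) = ?g t" for t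
    proof -
      have "(\<integral>\<^sup>+u. ennreal (exp (- (c * (t - s)))) * K (t, u) * indicator {0..1} u \<partial>lborel) =
        ennreal (exp (- (c * (t - s)))) * ?V t"
        by (simp add: nn_integral_unif01 nn_integral_cmult mult.assoc)
      then show ?thesis by simp
    qed
    then show ?thesis by simp
  qed
  \<comment> \<open>Letting the next point lie beyond the end \<open>m\<close> of the snake only
    enlarges the integral and makes the gap a full exponential variable.\<close>
  also have "\<dots> \<le> ennreal (1 / real m) * (\<integral>\<^sup>+t. ?g t \<partial>lborel)"
    by (intro mult_left_mono nn_integral_mono) (auto simp: indicator_def)
  also have "(\<integral>\<^sup>+t. ?g t \<partial>lborel) = ennreal (1 / c) * (\<integral>\<^sup>+z. ?g (s + z / c) \<partial>lborel)"
    using c by (subst nn_integral_real_affine[of _ "1 / c" s]) (auto cong: if_cong)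
  also have "ennreal (1 / real m) * (ennreal (1 / c) * (\<integral>\<^sup>+z. ?g (s + z / c) \<partial>lborel)) \<le>
     ennreal (1 / real m) * (ennreal (1 / c) * (\<integral>\<^sup>+z. ?V (s + z / c) \<partial>exp1))"
  proof (intro mult_left_mono)
    show "(\<integral>\<^sup>+z. ?g (s + z / c) \<partial>lborel) \<le> (\<integral>\<^sup>+z. ?V (s + z / c) \<partial>exp1)"
      using c by (subst nn_integral_exp1)
        (auto intro!: nn_integral_mono simp: indicator_def zero_less_divide_iff)
  qed auto
  also have "\<dots> = ennreal (1 / (real m * c)) * (\<integral>\<^sup>+z. ?V (s + z / c) \<partial>exp1)"
    using c by (simp add: mult.assoc[symmetric] ennreal_mult[symmetric])
  finally show ?thesis .
qed

section \<open>Rescaled ring costs and chains of exponential gaps\<close>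

definition strip_dist :: "real \<Rightarrow> real \<Rightarrow> real \<Rightarrow> real" where
  "strip_dist h w v = sqrt (w\<^sup>2 + h ^ 4 * v\<^sup>2)"

definition strip_cost :: "real \<Rightarrow> real \<Rightarrow> real \<Rightarrow> real \<Rightarrow> real \<Rightarrow> real \<Rightarrow> real \<Rightarrow> real \<Rightarrow> real \<Rightarrow> real" where
  "strip_cost \<alpha> h u0 z1 u1 z2 u2 z3 u3 =
     ring4 \<alpha> (strip_dist h z1 (u0 - u1) + strip_dist h (z2 + z3) (u1 - u3))
             (strip_dist h (z1 + z2) (u0 - u2) + strip_dist h z3 (u2 - u3))"

text \<open>The mean of \<open>C4\<close> as an iterated integral, in the order in which the points
  are met along the snake. Its values are extended reals, so that bounds can be stated before the
  mean is known to be finite.\<close>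

definition strip_mean :: "real \<Rightarrow> real \<Rightarrow> ennreal" where
  "strip_mean \<alpha> h = (\<integral>\<^sup>+u0. \<integral>\<^sup>+z1. \<integral>\<^sup>+u1. \<integral>\<^sup>+z2. \<integral>\<^sup>+u2. \<integral>\<^sup>+z3. \<integral>\<^sup>+u3.
     ennreal (strip_cost \<alpha> h u0 z1 u1 z2 u2 z3 u3)
     \<partial>unif01 \<partial>exp1 \<partial>unif01 \<partial>exp1 \<partial>unif01 \<partial>exp1 \<partial>unif01)"

lemma measurable_ring4 [measurable (raw)]:
  assumes [measurable]: "f \<in> borel_measurable N" "g \<in> borel_measurable N"
  shows "(\<lambda>x. ring4 \<alpha> (f x) (g x)) \<in> borel_measurable N"
  unfolding ring4_def by measurable

lemma measurable_strip_dist [measurable (raw)]: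
  assumes [measurable]: "f \<in> borel_measurable N" "g \<in> borel_measurable N"
  shows "(\<lambda>x. strip_dist h (f x) (g x)) \<in> borel_measurable N"
  unfolding strip_dist_def by measurable

lemma measurable_flat_dist [measurable (raw)]:
  assumes [measurable]: "f \<in> N \<rightarrow>\<^sub>M borel" "g \<in> N \<rightarrow>\<^sub>M borel"
  shows "(\<lambda>x. flat_dist m (f x) (g x)) \<in> borel_measurable N"
  unfolding flat_dist_def by measurable

lemma measurable_cross_cost [measurable (raw)]:
  assumes [measurable]: "f \<in> N \<rightarrow>\<^sub>M borel" "g \<in> N \<rightarrow>\<^sub>M borel"
  shows "(\<lambda>x. cross_cost m (f x) (g x)) \<in> borel_measurable N"
  unfolding cross_cost_def by measurable

text \<open>The weight of the total distance factors into the weights of the three gaps. The last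
  point is removed first because its gap starts at the point before it; each removal costs
  \<open>1 / (m * c)\<close>. The rate \<open>c\<close> stays free: runs inside a strip use
  \<open>k / m\<close>, runs across strips a quarter of it.\<close>

lemma nn_integral_flat_unif_chain:
  fixes G :: "real \<times> real \<Rightarrow> real \<times> real \<Rightarrow> real \<times> real \<Rightarrow> ennreal"
  assumes m: "0 < m" and c: "0 < c"
    and G: "(\<lambda>(y1,y2,y3). G y1 y2 y3) \<in> borel_measurable (borel \<Otimes>\<^sub>M borel \<Otimes>\<^sub>M borel)"
  shows "(\<integral>\<^sup>+y1. \<integral>\<^sup>+y2. \<integral>\<^sup>+y3. (if s < fst y1 \<and> fst y1 < fst y2 \<and> fst y2 < fst y3
      then ennreal (exp (- (c * (fst y3 - s)))) * G y1 y2 y3 else 0) \<partial>flat_unif m \<partial>flat_unif m \<partial>flat_unif m) \<le>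
    ennreal (1 / (real m * c)) ^ 3 * (\<integral>\<^sup>+z1. \<integral>\<^sup>+u1. \<integral>\<^sup>+z2. \<integral>\<^sup>+u2. \<integral>\<^sup>+z3. \<integral>\<^sup>+u3.
      G (s + z1 / c, u1) (s + z1 / c + z2 / c, u2) (s + z1 / c + z2 / c + z3 / c, u3)
      \<partial>unif01 \<partial>exp1 \<partial>unif01 \<partial>exp1 \<partial>unif01 \<partial>exp1)"
proof -
  interpret U: prob_space unif01 by (rule prob_space_unif01)
  interpret E: prob_space exp1 by (rule prob_space_exp1)
  interpret P: prob_space "flat_unif m" by (rule prob_space_flat_unif)
  have [measurable (raw)]: "(\<lambda>x. G (f1 x) (f2 x) (f3 x)) \<in> borel_measurable N"
    if "f1 \<in> N \<rightarrow>\<^sub>M borel" "f2 \<in> N \<rightarrow>\<^sub>M borel" "f3 \<in> N \<rightarrow>\<^sub>M borel" for f1 f2 f3 and N :: "'z measure"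
    using measurable_compose[OF measurable_Pair[OF that(1) measurable_Pair[OF that(2,3)]] G] by simp
  let ?q = "ennreal (1 / (real m * c))"
  let ?e = "\<lambda>w. ennreal (exp (- (c * w)))"
  define K2 where "K2 y1 y2 = (\<integral>\<^sup>+z3. \<integral>\<^sup>+u3. G y1 y2 (fst y2 + z3 / c, u3) \<partial>unif01 \<partial>exp1)" for y1 y2
  define K1 where "K1 y1 = (\<integral>\<^sup>+z2. \<integral>\<^sup>+u2. K2 y1 (fst y1 + z2 / c, u2) \<partial>unif01 \<partial>exp1)" for y1
  have K2[measurable (raw)]: "(\<lambda>x. K2 (f1 x) (f2 x)) \<in> borel_measurable N"
    if [measurable]: "f1 \<in> N \<rightarrow>\<^sub>M borel" "f2 \<in> N \<rightarrow>\<^sub>M borel" for f1 f2 and N :: "'z measure"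
    unfolding K2_def by measurable
  have K1[measurable (raw)]: "(\<lambda>x. K1 (f1 x)) \<in> borel_measurable N"
    if [measurable]: "f1 \<in> N \<rightarrow>\<^sub>M borel" for f1 and N :: "'z measure"
    unfolding K1_def by measurable
  have e: "?e (b - a) * ?e (d - b) = ?e (d - a)" for a b d
  proof -
    have "exp (- (c * (b - a))) * exp (- (c * (d - b))) = exp (- (c * (d - a)))"
      unfolding exp_add[symmetric] by (rule arg_cong[where f=exp]) (simp add: algebra_simps)
    then show ?thesis by (subst ennreal_mult''[symmetric]) simp_all
  qed
  have peel3: "(\<integral>\<^sup>+y3. (if s < fst y1 \<and> fst y1 < fst y2 \<and> fst y2 < fst y3
      then ?e (fst y3 - s) * G y1 y2 y3 else 0) \<partial>flat_unif m) \<le>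
    ?q * (if s < fst y1 \<and> fst y1 < fst y2 then ?e (fst y2 - s) * K2 y1 y2 else 0)" for y1 y2
  proof (cases "s < fst y1 \<and> fst y1 < fst y2")
    case True
    then have "(\<integral>\<^sup>+y3. (if s < fst y1 \<and> fst y1 < fst y2 \<and> fst y2 < fst y3
        then ?e (fst y3 - s) * G y1 y2 y3 else 0) \<partial>flat_unif m) =
      (\<integral>\<^sup>+y3. ?e (fst y2 - s) * (if fst y2 < fst y3 then ?e (fst y3 - fst y2) * G y1 y2 y3 else 0) \<partial>flat_unif m)"
      by (intro nn_integral_cong) (auto simp: mult.assoc[symmetric] e)
    also have "\<dots> = ?e (fst y2 - s) * (\<integral>\<^sup>+y3. (if fst y2 < fst y3 then ?e (fst y3 - fst y2) * G y1 y2 y3 else 0) \<partial>flat_unif m)"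
      by (rule nn_integral_cmult) measurable
    also have "\<dots> \<le> ?e (fst y2 - s) * (?q * K2 y1 y2)"
      unfolding K2_def using m c by (intro mult_left_mono nn_integral_flat_unif_peel) auto
    finally show ?thesis using True by (simp add: mult_ac)
  next
    case False
    then have "(s < fst y1 \<and> fst y1 < fst y2 \<and> fst y2 < fst y3) = False" for y3 :: "real \<times> real" by blast
    then show ?thesis by (simp only: if_False nn_integral_const mult_zero_left zero_le)
  qed
  have peel2: "(\<integral>\<^sup>+y2. (if s < fst y1 \<and> fst y1 < fst y2 then ?e (fst y2 - s) * K2 y1 y2 else 0) \<partial>flat_unif m) \<le>
    ?q * (if s < fst y1 then ?e (fst y1 - s) * K1 y1 else 0)" for y1
  proof (cases "s < fst y1")
    case True
    then have "(\<integral>\<^sup>+y2. (if s < fst y1 \<and> fst y1 < fst y2 then ?e (fst y2 - s) * K2 y1 y2 else 0) \<partial>flat_unif m) =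
      (\<integral>\<^sup>+y2. ?e (fst y1 - s) * (if fst y1 < fst y2 then ?e (fst y2 - fst y1) * K2 y1 y2 else 0) \<partial>flat_unif m)"
      by (intro nn_integral_cong) (auto simp: mult.assoc[symmetric] e)
    also have "\<dots> = ?e (fst y1 - s) * (\<integral>\<^sup>+y2. (if fst y1 < fst y2 then ?e (fst y2 - fst y1) * K2 y1 y2 else 0) \<partial>flat_unif m)"
      by (rule nn_integral_cmult) measurable
    also have "\<dots> \<le> ?e (fst y1 - s) * (?q * K1 y1)"
      unfolding K1_def using m c by (intro mult_left_mono nn_integral_flat_unif_peel) auto
    finally show ?thesis using True by (simp add: mult_ac)
  qed simp
  have "(\<integral>\<^sup>+y1. \<integral>\<^sup>+y2. \<integral>\<^sup>+y3. (if s < fst y1 \<and> fst y1 < fst y2 \<and> fst y2 < fst y3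
      then ?e (fst y3 - s) * G y1 y2 y3 else 0) \<partial>flat_unif m \<partial>flat_unif m \<partial>flat_unif m) \<le>
    (\<integral>\<^sup>+y1. \<integral>\<^sup>+y2. ?q * (if s < fst y1 \<and> fst y1 < fst y2 then ?e (fst y2 - s) * K2 y1 y2 else 0) \<partial>flat_unif m \<partial>flat_unif m)"
    by (intro nn_integral_mono peel3)
  also have "\<dots> = (\<integral>\<^sup>+y1. ?q * (\<integral>\<^sup>+y2. (if s < fst y1 \<and> fst y1 < fst y2 then ?e (fst y2 - s) * K2 y1 y2 else 0) \<partial>flat_unif m) \<partial>flat_unif m)"
    by (intro nn_integral_cong nn_integral_cmult) measurable
  also have "\<dots> \<le> (\<integral>\<^sup>+y1. ?q * (?q * (if s < fst y1 then ?e (fst y1 - s) * K1 y1 else 0)) \<partial>flat_unif m)"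
    by (intro nn_integral_mono mult_left_mono peel2) auto
  also have "\<dots> = (?q * ?q) * (\<integral>\<^sup>+y1. (if s < fst y1 then ?e (fst y1 - s) * K1 y1 else 0) \<partial>flat_unif m)"
    unfolding mult.assoc[symmetric] by (rule nn_integral_cmult) measurable
  also have "\<dots> \<le> (?q * ?q) * (?q * (\<integral>\<^sup>+z1. \<integral>\<^sup>+u1. K1 (s + z1 / c, u1) \<partial>unif01 \<partial>exp1))"
    using m c by (intro mult_left_mono nn_integral_flat_unif_peel) auto
  finally show ?thesis
    by (simp add: K1_def K2_def power3_eq_cube mult.assoc)
qed

text \<open>In units of \<open>1 / lam\<close> a strip has height \<open>lam / m\<close>, which is
  at most \<open>h ^ 2\<close> by assumption; squaring gives the weight \<open>h ^ 4\<close>. Only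
  squares enter, so the two points may come in either order.\<close>

lemma flat_dist_scale:
  assumes lam: "0 < lam" "lam \<le> h\<^sup>2 * real m" and m: "0 < m" and w: "t - t' = w / lam \<or> t' - t = w / lam"
  shows "flat_dist m (t, u) (t', u') \<le> 1 / lam * strip_dist h w (u - u')"
proof -
  have "(lam / real m)\<^sup>2 \<le> (h\<^sup>2)\<^sup>2"
    using lam m by (intro power_mono) (auto simp: field_simps)
  then have h4: "(lam / real m)\<^sup>2 \<le> h ^ 4" by (simp add: power_mult[symmetric])
  have "(t - t')\<^sup>2 = (w / lam)\<^sup>2" using w by (metis power2_commute)
  then have "(t - t')\<^sup>2 = (1 / lam)\<^sup>2 * w\<^sup>2" by (simp add: power_divide)
  moreover have "((u - u') / real m)\<^sup>2 = (1 / lam)\<^sup>2 * ((lam / real m)\<^sup>2 * (u - u')\<^sup>2)"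
    using lam by (simp add: power_divide)
  ultimately have "(t - t')\<^sup>2 + ((u - u') / real m)\<^sup>2 = (1 / lam)\<^sup>2 * (w\<^sup>2 + (lam / real m)\<^sup>2 * (u - u')\<^sup>2)"
    by (simp only: distrib_left)
  also have "\<dots> \<le> (1 / lam)\<^sup>2 * (w\<^sup>2 + h ^ 4 * (u - u')\<^sup>2)"
    using h4 by (intro mult_left_mono add_left_mono mult_right_mono) auto
  finally have "flat_dist m (t, u) (t', u') \<le> sqrt ((1 / lam)\<^sup>2 * (w\<^sup>2 + h ^ 4 * (u - u')\<^sup>2))"
    by (simp add: flat_dist_def)
  then show ?thesis
    using lam by (simp add: real_sqrt_mult strip_dist_def)
qed

lemma flat_cost_scale:
  assumes \<alpha>: "1 \<le> \<alpha>" and lam: "0 < lam" "lam \<le> h\<^sup>2 * real m" and m: "0 < m"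
  shows "flat_cost \<alpha> m (t, u0) (t + z1 / lam, u1) (t + z1 / lam + z2 / lam, u2) (t + z1 / lam + z2 / lam + z3 / lam, u3)
    \<le> 1 / lam * strip_cost \<alpha> h u0 z1 u1 z2 u2 z3 u3"
proof -
  have "flat_cost \<alpha> m (t, u0) (t + z1 / lam, u1) (t + z1 / lam + z2 / lam, u2) (t + z1 / lam + z2 / lam + z3 / lam, u3) \<le>
    ring4 \<alpha> (1 / lam * strip_dist h z1 (u0 - u1) + 1 / lam * strip_dist h (z2 + z3) (u1 - u3))
      (1 / lam * strip_dist h (z1 + z2) (u0 - u2) + 1 / lam * strip_dist h z3 (u2 - u3))"
    unfolding flat_cost_def using \<alpha> lam m
    by (intro ring4_mono add_mono flat_dist_scale) (auto simp: add_divide_distrib)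
  also have "\<dots> = 1 / lam * strip_cost \<alpha> h u0 z1 u1 z2 u2 z3 u3"
    unfolding strip_cost_def using \<alpha> lam by (subst ring4_scale[symmetric]) (auto simp: add_divide_distrib)
  finally show ?thesis .
qed

text \<open>
  A quadruple meeting two strips passes the next integer after \<open>t0\<close>. Half of the exponential weight is
  spent on that distance, a quarter absorbs the linear factor.
\<close>

lemma cross_cost_le:
  assumes lam: "0 < lam" and w: "t0 < t3"
  shows "exp (- (lam * (t3 - t0))) * cross_cost m (t0, u0) (t3, u3) \<le>
    exp (- (lam / 4 * (t3 - t0))) * ((16 / lam + 4 / real m) * exp (- (lam / 2 * (of_int \<lfloor>t0\<rfloor> + 1 - t0))))"
proof (cases "\<lfloor>t0\<rfloor> = \<lfloor>t3\<rfloor>")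
  case True
  then show ?thesis using lam by (simp add: cross_cost_def)
next
  case False
  define w where "w = t3 - t0"
  have "\<lfloor>t0\<rfloor> \<le> \<lfloor>t3\<rfloor>" using assms by (intro floor_mono) simp
  then have "\<lfloor>t0\<rfloor> + 1 \<le> \<lfloor>t3\<rfloor>" using False by simp
  then have r: "of_int \<lfloor>t0\<rfloor> + 1 - t0 \<le> w" unfolding w_def by linarith
  have w0: "0 < w" using assms by (simp add: w_def)
  have ge: "1 \<le> exp (lam / 4 * w)" using lam w0 by simp
  \<comment> \<open>The linear factor is absorbed by \<open>x \<le> exp x\<close> at
    \<open>x = lam / 4 * w\<close>.\<close>
  have "4 * w = 16 / lam * (lam / 4 * w)" using lam by (simp add: field_simps)
  also have "\<dots> \<le> 16 / lam * exp (lam / 4 * w)"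
  proof (intro mult_left_mono)
    show "lam / 4 * w \<le> exp (lam / 4 * w)"
      using exp_ge_add_one_self[of "lam / 4 * w"] by linarith
  qed (use lam in simp)
  finally have a: "4 * w \<le> 16 / lam * exp (lam / 4 * w)" .
  have "4 / real m * 1 \<le> 4 / real m * exp (lam / 4 * w)"
    using ge by (intro mult_left_mono) auto
  then have "4 * w + 4 / real m \<le> (16 / lam + 4 / real m) * exp (lam / 4 * w)"
    using a by (simp only: distrib_right)
  then have "exp (- (lam * w)) * (4 * w + 4 / real m) \<le> exp (- (lam * w)) * ((16 / lam + 4 / real m) * exp (lam / 4 * w))"
    by (intro mult_left_mono) auto
  \<comment> \<open>Three quarters of the exponent are left, split as \<open>1 / 4 + 1 / 2\<close>.
    The quarter kept as a function of \<open>w\<close> is the rate at which the three gaps are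
    integrated later.\<close>
  also have "\<dots> = exp (- (lam / 4 * w)) * ((16 / lam + 4 / real m) * exp (- (lam / 2 * w)))"
  proof -
    have "exp (- (lam * w)) * exp (lam / 4 * w) = exp (- (lam / 4 * w)) * exp (- (lam / 2 * w))"
      by (simp add: exp_add[symmetric])
    moreover have "x * (a * y) = u * (a * v)" if "x * y = u * v" for a x y u v :: real
      using that by (metis mult.left_commute)
    ultimately show ?thesis by blast
  qed
  also have "\<dots> \<le> exp (- (lam / 4 * w)) * ((16 / lam + 4 / real m) * exp (- (lam / 2 * (of_int \<lfloor>t0\<rfloor> + 1 - t0))))"
    using r lam by (intro mult_left_mono) auto
  finally show ?thesis using False by (simp add: cross_cost_def w_def)
qed

text \<open>On each unit interval the integrand is an exponential in the distance to the next turn,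
  and \<open>2 / lam\<close> is the total mass of that exponential. This is the small probability of
  starting near a turn.\<close>

lemma nn_integral_flat_unif_boundary:
  assumes m: "0 < m" and lam: "0 < lam"
  shows "(\<integral>\<^sup>+y. ennreal (exp (- (lam / 2 * (of_int \<lfloor>fst y\<rfloor> + 1 - fst y)))) \<partial>flat_unif m) \<le> ennreal (2 / lam)"
proof -
  let ?f = "\<lambda>t. ennreal (exp (- (lam / 2 * (of_int \<lfloor>t\<rfloor> + 1 - t))))"
  have unit: "(\<integral>\<^sup>+s. ?f (real j + s) * indicator {0..1} s \<partial>lborel) \<le> ennreal (2 / lam)" for j
  proof -
    have "(\<integral>\<^sup>+s. ?f (real j + s) * indicator {0..1} s \<partial>lborel) = (\<integral>\<^sup>+s. ?f (real j + s) * indicator {0..<1} s \<partial>lborel)"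
      by (rule nn_integral_half_open[symmetric])
    also have "\<dots> \<le> (\<integral>\<^sup>+s. ennreal (exp (- (lam / 2 * (1 - s)))) * indicator {0..1} s \<partial>lborel)"
    proof (intro nn_integral_mono)
      fix s :: real
      have "\<lfloor>real j + s\<rfloor> = int j" if "0 \<le> s" "s < 1" using that by (simp add: floor_eq_iff)
      then show "?f (real j + s) * indicator {0..<1} s \<le> ennreal (exp (- (lam / 2 * (1 - s)))) * indicator {0..1} s"
        by (simp add: indicator_def)
    qed
    also have "\<dots> = (\<integral>\<^sup>+s. ennreal (exp (- (lam / 2 * s))) * indicator {0..1} s \<partial>lborel)"
      by (rule nn_integral_reflect_unit) measurable
    also have "\<dots> \<le> (\<integral>\<^sup>+s. ennreal (2 / lam) * ennreal (exponential_density (lam / 2) s) \<partial>lborel)"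
      using lam by (intro nn_integral_mono)
        (auto simp: indicator_def exponential_density_def ennreal_mult[symmetric] mult_ac)
    also have "\<dots> = ennreal (2 / lam) * (\<integral>\<^sup>+s. ennreal (exponential_density (lam / 2) s) \<partial>lborel)"
      by (rule nn_integral_cmult) measurable
    also have "(\<integral>\<^sup>+s. ennreal (exponential_density (lam / 2) s) \<partial>lborel) = 1"
      using prob_space.emeasure_space_1[OF prob_space_exponential_density[of "lam / 2"]] lam
      by (simp add: emeasure_density)
    finally show ?thesis by simp
  qed
  have "(\<integral>\<^sup>+y. ?f (fst y) \<partial>flat_unif m) = ennreal (1 / real m) *
    (\<Sum>j<m. \<integral>\<^sup>+s. (\<integral>\<^sup>+(u::real). ?f (real j + s) * indicator {0..1} u \<partial>lborel) * indicator {0..1} s \<partial>lborel)"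
    using m by (subst nn_integral_flat_unif_strips) auto
  also have "\<dots> = ennreal (1 / real m) * (\<Sum>j<m. \<integral>\<^sup>+s. ?f (real j + s) * indicator {0..1} s \<partial>lborel)"
  proof -
    have "(\<integral>\<^sup>+(u::real). K * indicator {0..1} u \<partial>lborel) = K" for K
      by (subst nn_integral_cmult) (auto simp: nn_integral_indicator)
    then show ?thesis by (simp only:)
  qed
  also have "\<dots> \<le> ennreal (1 / real m) * (\<Sum>j<m. ennreal (2 / lam))"
    by (intro mult_left_mono sum_mono unit) auto
  also have "\<dots> = ennreal (2 / lam)"
    using m lam by (simp add: ennreal_of_nat_eq_real_of_nat ennreal_mult[symmetric])
  finally show ?thesis .
qed

text \<open>The integrand is dominated by \<open>A + B\<close>: \<open>A\<close> carries the cost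
  inside the flat picture with rate \<open>lam\<close>, \<open>B\<close> the crossing cost with rate
  \<open>lam / 4\<close>. The weight \<open>C\<close> in \<open>B\<close> depends on the first point
  alone, so it is constant while the three gaps are integrated.\<close>

lemma nn_integral_chain_le:
  assumes \<alpha>: "1 \<le> \<alpha>" and m: "0 < m" and k: "0 < k" "real k \<le> (h * real m)\<^sup>2"
  shows "(\<integral>\<^sup>+y0. \<integral>\<^sup>+y1. \<integral>\<^sup>+y2. \<integral>\<^sup>+y3. (if fst y0 < fst y1 \<and> fst y1 < fst y2 \<and> fst y2 < fst y3
      then ennreal (flat_cost \<alpha> m y0 y1 y2 y3 + cross_cost m y0 y3) * emeasure (flat_unif m) (avoid y0 y3) ^ k else 0)
      \<partial>flat_unif m \<partial>flat_unif m \<partial>flat_unif m \<partial>flat_unif m) \<le>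
    ennreal (1 / real k) ^ 3 * (ennreal (real m / real k) * strip_mean \<alpha> h) +
    ennreal (4 / real k) ^ 3 * (ennreal (16 * real m / real k + 4 / real m) * ennreal (2 * real m / real k))"
proof -
  interpret U: prob_space unif01 by (rule prob_space_unif01)
  interpret E: prob_space exp1 by (rule prob_space_exp1)
  interpret P: prob_space "flat_unif m" by (rule prob_space_flat_unif)
  \<comment> \<open>The density of the \<open>k\<close> remaining points along the snake. The
    assumption on \<open>k\<close> is exactly \<open>lam \<le> h ^ 2 * m\<close>, as
    \<open>flat_dist_scale\<close> requires.\<close>
  define lam where "lam = real k / real m"
  have lam: "0 < lam" "lam \<le> h\<^sup>2 * real m" "real m * lam = real k" "1 / lam = real m / real k"
    using m k by (auto simp: lam_def field_simps power2_eq_square)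
  let ?e = "\<lambda>c w. ennreal (exp (- (c * w)))"
  define C where "C t0 = (16 / lam + 4 / real m) * exp (- (lam / 2 * (of_int \<lfloor>t0\<rfloor> + 1 - t0)))" for t0
  have C0: "0 \<le> C t" for t using lam by (simp add: C_def)
  have [measurable]: "C \<in> borel_measurable borel" unfolding C_def by measurable
  define A where "A y0 y1 y2 y3 = (if fst y0 < fst y1 \<and> fst y1 < fst y2 \<and> fst y2 < fst y3
      then ?e lam (fst y3 - fst y0) * ennreal (flat_cost \<alpha> m y0 y1 y2 y3) else 0)" for y0 y1 y2 y3
  define B where "B y0 y1 y2 y3 = (if fst y0 < fst y1 \<and> fst y1 < fst y2 \<and> fst y2 < fst y3
      then ?e (lam / 4) (fst y3 - fst y0) * ennreal (C (fst y0)) else 0)" for y0 y1 y2 y3 :: "real \<times> real"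
  have fc[measurable (raw)]: "(\<lambda>x. flat_cost \<alpha> m (f0 x) (f1 x) (f2 x) (f3 x)) \<in> borel_measurable N"
    if [measurable]: "f0 \<in> N \<rightarrow>\<^sub>M borel" "f1 \<in> N \<rightarrow>\<^sub>M borel" "f2 \<in> N \<rightarrow>\<^sub>M borel" "f3 \<in> N \<rightarrow>\<^sub>M borel"
    for f0 f1 f2 f3 and N :: "'z measure"
    unfolding flat_cost_def by measurable
  have [measurable (raw)]: "(\<lambda>x. A (f0 x) (f1 x) (f2 x) (f3 x)) \<in> borel_measurable N"
    if [measurable]: "f0 \<in> N \<rightarrow>\<^sub>M borel" "f1 \<in> N \<rightarrow>\<^sub>M borel" "f2 \<in> N \<rightarrow>\<^sub>M borel" "f3 \<in> N \<rightarrow>\<^sub>M borel"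
    for f0 f1 f2 f3 and N :: "'z measure"
    unfolding A_def by measurable
  have [measurable (raw)]: "(\<lambda>x. B (f0 x) (f1 x) (f2 x) (f3 x)) \<in> borel_measurable N"
    if [measurable]: "f0 \<in> N \<rightarrow>\<^sub>M borel" "f1 \<in> N \<rightarrow>\<^sub>M borel" "f2 \<in> N \<rightarrow>\<^sub>M borel" "f3 \<in> N \<rightarrow>\<^sub>M borel"
    for f0 f1 f2 f3 and N :: "'z measure"
    unfolding B_def by measurable
  have pointwise: "(if fst y0 < fst y1 \<and> fst y1 < fst y2 \<and> fst y2 < fst y3
      then ennreal (flat_cost \<alpha> m y0 y1 y2 y3 + cross_cost m y0 y3) * emeasure (flat_unif m) (avoid y0 y3) ^ k else 0)
      \<le> A y0 y1 y2 y3 + B y0 y1 y2 y3"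
    if y: "0 \<le> fst y0" "fst y3 \<le> real m" for y0 y1 y2 y3
  proof (cases "fst y0 < fst y1 \<and> fst y1 < fst y2 \<and> fst y2 < fst y3")
    case True
    then have less: "fst y0 < fst y3" by simp
    have "emeasure (flat_unif m) (avoid y0 y3) ^ k \<le> ennreal (exp (- ((fst y3 - fst y0) / real m))) ^ k"
      using y less by (intro power_mono emeasure_flat_unif_avoid_le m) auto
    also have "\<dots> = ?e lam (fst y3 - fst y0)"
      by (simp add: ennreal_power exp_of_nat_mult[symmetric] lam_def)
    finally have "ennreal (flat_cost \<alpha> m y0 y1 y2 y3 + cross_cost m y0 y3) * emeasure (flat_unif m) (avoid y0 y3) ^ k
      \<le> ennreal (flat_cost \<alpha> m y0 y1 y2 y3 + cross_cost m y0 y3) * ?e lam (fst y3 - fst y0)"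
      by (rule mult_left_mono) simp
    also have "\<dots> = ?e lam (fst y3 - fst y0) * ennreal (flat_cost \<alpha> m y0 y1 y2 y3) +
        ennreal (exp (- (lam * (fst y3 - fst y0))) * cross_cost m y0 y3)"
    proof -
      have "0 \<le> cross_cost m y0 y3" using less by (simp add: cross_cost_def)
      moreover have "0 \<le> flat_cost \<alpha> m y0 y1 y2 y3" using \<alpha> by (intro flat_cost_nonneg) simp
      ultimately show ?thesis
        by (simp add: ennreal_mult distrib_left mult.commute)
    qed
    also have "\<dots> \<le> ?e lam (fst y3 - fst y0) * ennreal (flat_cost \<alpha> m y0 y1 y2 y3) +
        ennreal (exp (- (lam / 4 * (fst y3 - fst y0))) * C (fst y0))"
      using cross_cost_le[OF lam(1) less, of m "snd y0" "snd y3"]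
      by (intro add_left_mono ennreal_leI) (simp add: C_def)
    also have "\<dots> = A y0 y1 y2 y3 + B y0 y1 y2 y3"
      using True C0 by (simp add: A_def B_def ennreal_mult)
    finally show ?thesis using True by simp
  next
    case False
    then show ?thesis by (simp only: if_False zero_le)
  qed
  have "(\<integral>\<^sup>+y0. \<integral>\<^sup>+y1. \<integral>\<^sup>+y2. \<integral>\<^sup>+y3. (if fst y0 < fst y1 \<and> fst y1 < fst y2 \<and> fst y2 < fst y3
      then ennreal (flat_cost \<alpha> m y0 y1 y2 y3 + cross_cost m y0 y3) * emeasure (flat_unif m) (avoid y0 y3) ^ k else 0)
      \<partial>flat_unif m \<partial>flat_unif m \<partial>flat_unif m \<partial>flat_unif m) \<le>
    (\<integral>\<^sup>+y0. \<integral>\<^sup>+y1. \<integral>\<^sup>+y2. \<integral>\<^sup>+y3. A y0 y1 y2 y3 + B y0 y1 y2 y3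
      \<partial>flat_unif m \<partial>flat_unif m \<partial>flat_unif m \<partial>flat_unif m)"
  \<comment> \<open>The bound on the avoidance probability holds for outer points with coordinates
    in the interval from 0 to \<open>m\<close>, hence almost everywhere in \<open>y0\<close> and in
    \<open>y3\<close>.\<close>
  proof (rule nn_integral_mono_AE, rule AE_mp[OF AE_flat_unif[OF m]], rule AE_I2, rule impI,
      rule nn_integral_mono, rule nn_integral_mono)
    fix y0 y1 y2 :: "real \<times> real" assume y0: "0 \<le> fst y0 \<and> fst y0 \<le> real m"
    show "(\<integral>\<^sup>+y3. (if fst y0 < fst y1 \<and> fst y1 < fst y2 \<and> fst y2 < fst y3
      then ennreal (flat_cost \<alpha> m y0 y1 y2 y3 + cross_cost m y0 y3) * emeasure (flat_unif m) (avoid y0 y3) ^ k else 0)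
      \<partial>flat_unif m) \<le> (\<integral>\<^sup>+y3. A y0 y1 y2 y3 + B y0 y1 y2 y3 \<partial>flat_unif m)"
      by (rule nn_integral_mono_AE, rule AE_mp[OF AE_flat_unif[OF m]], intro AE_I2 impI pointwise) (use y0 in auto)
  qed
  also have "\<dots> = (\<integral>\<^sup>+y0. \<integral>\<^sup>+y1. \<integral>\<^sup>+y2. \<integral>\<^sup>+y3. A y0 y1 y2 y3 \<partial>flat_unif m \<partial>flat_unif m \<partial>flat_unif m \<partial>flat_unif m) +
    (\<integral>\<^sup>+y0. \<integral>\<^sup>+y1. \<integral>\<^sup>+y2. \<integral>\<^sup>+y3. B y0 y1 y2 y3 \<partial>flat_unif m \<partial>flat_unif m \<partial>flat_unif m \<partial>flat_unif m)"
    by (simp add: nn_integral_add)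
  also have "\<dots> \<le> ennreal (1 / real k) ^ 3 * (ennreal (real m / real k) * strip_mean \<alpha> h) +
    ennreal (4 / real k) ^ 3 * (ennreal (16 * real m / real k + 4 / real m) * ennreal (2 * real m / real k))"
  proof (rule add_mono)
    define Jm where "Jm u0 = (\<integral>\<^sup>+z1. \<integral>\<^sup>+u1. \<integral>\<^sup>+z2. \<integral>\<^sup>+u2. \<integral>\<^sup>+z3. \<integral>\<^sup>+u3.
      ennreal (strip_cost \<alpha> h u0 z1 u1 z2 u2 z3 u3)
      \<partial>unif01 \<partial>exp1 \<partial>unif01 \<partial>exp1 \<partial>unif01 \<partial>exp1)" for u0
    have [measurable]: "Jm \<in> borel_measurable borel"
      unfolding Jm_def strip_cost_def by measurable
    have sc: "0 \<le> strip_cost \<alpha> h u0 z1 u1 z2 u2 z3 u3" for u0 z1 u1 z2 u2 z3 u3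
      unfolding strip_cost_def using \<alpha> by (intro ring4_nonneg add_nonneg_nonneg) (auto simp: strip_dist_def)
    have "(\<integral>\<^sup>+y1. \<integral>\<^sup>+y2. \<integral>\<^sup>+y3. A y0 y1 y2 y3 \<partial>flat_unif m \<partial>flat_unif m \<partial>flat_unif m) \<le>
      ennreal (1 / real k) ^ 3 * (ennreal (1 / lam) * Jm (snd y0))" for y0
    proof -
      have "(\<integral>\<^sup>+y1. \<integral>\<^sup>+y2. \<integral>\<^sup>+y3. A y0 y1 y2 y3 \<partial>flat_unif m \<partial>flat_unif m \<partial>flat_unif m) \<le>
        ennreal (1 / (real m * lam)) ^ 3 * (\<integral>\<^sup>+z1. \<integral>\<^sup>+u1. \<integral>\<^sup>+z2. \<integral>\<^sup>+u2. \<integral>\<^sup>+z3. \<integral>\<^sup>+u3.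
          ennreal (flat_cost \<alpha> m y0 (fst y0 + z1 / lam, u1) (fst y0 + z1 / lam + z2 / lam, u2)
            (fst y0 + z1 / lam + z2 / lam + z3 / lam, u3))
          \<partial>unif01 \<partial>exp1 \<partial>unif01 \<partial>exp1 \<partial>unif01 \<partial>exp1)"
        unfolding A_def by (rule nn_integral_flat_unif_chain[OF m lam(1)]) (measurable)
      also have "\<dots> \<le> ennreal (1 / (real m * lam)) ^ 3 * (\<integral>\<^sup>+z1. \<integral>\<^sup>+u1. \<integral>\<^sup>+z2. \<integral>\<^sup>+u2. \<integral>\<^sup>+z3. \<integral>\<^sup>+u3.
          ennreal (1 / lam) * ennreal (strip_cost \<alpha> h (snd y0) z1 u1 z2 u2 z3 u3)
          \<partial>unif01 \<partial>exp1 \<partial>unif01 \<partial>exp1 \<partial>unif01 \<partial>exp1)"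
      proof (intro mult_left_mono nn_integral_mono)
        fix z1 u1 z2 u2 z3 u3
        show "ennreal (flat_cost \<alpha> m y0 (fst y0 + z1 / lam, u1) (fst y0 + z1 / lam + z2 / lam, u2)
            (fst y0 + z1 / lam + z2 / lam + z3 / lam, u3)) \<le>
          ennreal (1 / lam) * ennreal (strip_cost \<alpha> h (snd y0) z1 u1 z2 u2 z3 u3)"
          using flat_cost_scale[OF \<alpha> lam(1,2) m, of "fst y0" "snd y0" z1 u1 z2 u2 z3 u3] sc lam(1)
          by (simp add: ennreal_mult'[symmetric] ennreal_leI)
      qed simp
      also have "\<dots> = ennreal (1 / real k) ^ 3 * (ennreal (1 / lam) * Jm (snd y0))"
        unfolding Jm_def lam(3) by (simp add: nn_integral_cmult strip_cost_def)
      finally show ?thesis .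
    qed
    then have "(\<integral>\<^sup>+y0. \<integral>\<^sup>+y1. \<integral>\<^sup>+y2. \<integral>\<^sup>+y3. A y0 y1 y2 y3 \<partial>flat_unif m \<partial>flat_unif m \<partial>flat_unif m \<partial>flat_unif m) \<le>
      (\<integral>\<^sup>+y0. ennreal (1 / real k) ^ 3 * (ennreal (1 / lam) * Jm (snd y0)) \<partial>flat_unif m)"
      by (intro nn_integral_mono)
    also have "\<dots> = ennreal (1 / real k) ^ 3 * (ennreal (1 / lam) * (\<integral>\<^sup>+y0. Jm (snd y0) \<partial>flat_unif m))"
      by (simp add: nn_integral_cmult)
    \<comment> \<open>After rescaling, the cost no longer depends on the position of the first point
      along the snake; only its uniform height remains.\<close>
    also have "(\<integral>\<^sup>+y0. Jm (snd y0) \<partial>flat_unif m) = (\<integral>\<^sup>+u0. Jm u0 \<partial>unif01)"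
    proof -
      have "(\<integral>\<^sup>+y0. Jm (snd y0) \<partial>flat_unif m) = ennreal (1 / real m) *
        (\<integral>\<^sup>+t. (\<integral>\<^sup>+u. Jm u * indicator {0..1} u \<partial>lborel) * indicator {0..real m} t \<partial>lborel)"
        using m by (subst nn_integral_flat_unif) auto
      also have "\<dots> = ennreal (1 / real m) * ((\<integral>\<^sup>+u. Jm u \<partial>unif01) * ennreal (real m))"
        by (subst nn_integral_cmult) (auto simp: nn_integral_unif01)
      also have "\<dots> = (ennreal (1 / real m) * ennreal (real m)) * (\<integral>\<^sup>+u. Jm u \<partial>unif01)"
        by (simp only: mult_ac)
      finally show ?thesis using m by (simp add: ennreal_mult'[symmetric])
    qed
    also have "(\<integral>\<^sup>+u0. Jm u0 \<partial>unif01) = strip_mean \<alpha> h"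
      by (simp add: Jm_def strip_mean_def)
    finally show "(\<integral>\<^sup>+y0. \<integral>\<^sup>+y1. \<integral>\<^sup>+y2. \<integral>\<^sup>+y3. A y0 y1 y2 y3 \<partial>flat_unif m \<partial>flat_unif m \<partial>flat_unif m \<partial>flat_unif m) \<le>
      ennreal (1 / real k) ^ 3 * (ennreal (real m / real k) * strip_mean \<alpha> h)"
      unfolding lam(4) .
  next
    have k4: "1 / (real m * (lam / 4)) = 4 / real k" using lam(3) by simp
    have "(\<integral>\<^sup>+y1. \<integral>\<^sup>+y2. \<integral>\<^sup>+y3. B y0 y1 y2 y3 \<partial>flat_unif m \<partial>flat_unif m \<partial>flat_unif m) \<le>
      ennreal (4 / real k) ^ 3 * ennreal (C (fst y0))" for y0
    proof -
      have "(\<integral>\<^sup>+y1. \<integral>\<^sup>+y2. \<integral>\<^sup>+y3. B y0 y1 y2 y3 \<partial>flat_unif m \<partial>flat_unif m \<partial>flat_unif m) \<le>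
        ennreal (1 / (real m * (lam / 4))) ^ 3 * (\<integral>\<^sup>+z1. \<integral>\<^sup>+u1. \<integral>\<^sup>+z2. \<integral>\<^sup>+u2. \<integral>\<^sup>+z3. \<integral>\<^sup>+u3.
          ennreal (C (fst y0))
          \<partial>unif01 \<partial>exp1 \<partial>unif01 \<partial>exp1 \<partial>unif01 \<partial>exp1)"
        unfolding B_def using lam(1) by (intro nn_integral_flat_unif_chain[OF m]) auto
      then show ?thesis unfolding k4 by (simp add: U.emeasure_space_1 E.emeasure_space_1)
    qed
    then have "(\<integral>\<^sup>+y0. \<integral>\<^sup>+y1. \<integral>\<^sup>+y2. \<integral>\<^sup>+y3. B y0 y1 y2 y3 \<partial>flat_unif m \<partial>flat_unif m \<partial>flat_unif m \<partial>flat_unif m) \<le>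
      (\<integral>\<^sup>+y0. ennreal (4 / real k) ^ 3 * ennreal (C (fst y0)) \<partial>flat_unif m)"
      by (intro nn_integral_mono)
    also have "\<dots> = ennreal (4 / real k) ^ 3 * (\<integral>\<^sup>+y0. ennreal (C (fst y0)) \<partial>flat_unif m)"
      by (simp add: nn_integral_cmult)
    also have "(\<integral>\<^sup>+y0. ennreal (C (fst y0)) \<partial>flat_unif m) = ennreal (16 / lam + 4 / real m) *
        (\<integral>\<^sup>+y. ennreal (exp (- (lam / 2 * (of_int \<lfloor>fst y\<rfloor> + 1 - fst y)))) \<partial>flat_unif m)"
      using lam(1) unfolding C_def by (subst nn_integral_cmult[symmetric]) (auto simp: ennreal_mult)
    also have "ennreal (4 / real k) ^ 3 * \<dots> \<le> ennreal (4 / real k) ^ 3 * (ennreal (16 / lam + 4 / real m) * ennreal (2 / lam))"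
      by (intro mult_left_mono nn_integral_flat_unif_boundary m lam(1)) auto
    also have "16 / lam = 16 * real m / real k" using lam(4) by (simp add: lam_def)
    also have "2 / lam = 2 * real m / real k" using lam(4) by (simp add: lam_def)
    finally show "(\<integral>\<^sup>+y0. \<integral>\<^sup>+y1. \<integral>\<^sup>+y2. \<integral>\<^sup>+y3. B y0 y1 y2 y3 \<partial>flat_unif m \<partial>flat_unif m \<partial>flat_unif m \<partial>flat_unif m) \<le>
      ennreal (4 / real k) ^ 3 * (ennreal (16 * real m / real k + 4 / real m) * ennreal (2 * real m / real k))" .
  qed
  finally show ?thesis .
qed

section \<open>General position of the sample and the expected optimum\<close>

text \<open>Keeps the sample off the vertical sides, where \<open>snake_t\<close> may reach the
  number of the next strip.\<close>

lemma AE_square_unif: "AE p in square_unif. 0 < p $ 1 \<and> p $ 1 < 1 \<and> 0 \<le> p $ 2 \<and> p $ 2 \<le> 1"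
proof -
  let ?N = "{p :: point. \<not> (0 < p $ 1 \<and> p $ 1 < 1 \<and> 0 \<le> p $ 2 \<and> p $ 2 \<le> 1)}"
  have N: "?N \<in> sets borel" by measurable
  have sets: "sets square_unif = sets borel" by (simp add: square_unif_def)
  have "emeasure square_unif ?N = (\<integral>\<^sup>+p. indicator ?N p \<partial>square_unif)"
    using N sets by simp
  also have "\<dots> = (\<integral>\<^sup>+x. (\<integral>\<^sup>+y. indicator ?N (mk_point (x, y)) * indicator {0..1} y \<partial>lborel) * indicator {0..1} x \<partial>lborel)"
    using N by (intro nn_integral_square_unif) auto
  also have "\<dots> = (\<integral>\<^sup>+(x::real). 0 \<partial>lborel)"
  proof (rule nn_integral_cong_AE)
    have ne: "AE x in lborel. x \<noteq> 0 \<and> x \<noteq> (1::real)"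
      using AE_lborel_singleton[of "0::real"] AE_lborel_singleton[of "1::real"] by auto
    have zero: "(\<integral>\<^sup>+y. indicator ?N (mk_point (x, y)) * indicator {0..1} y \<partial>lborel) * indicator {0..1} x = 0"
      if "x \<noteq> 0 \<and> x \<noteq> 1" for x :: real
    proof (cases "x \<in> {0..1}")
      case True
      then have "(\<integral>\<^sup>+y. indicator ?N (mk_point (x, y)) * indicator {0..1} y \<partial>lborel) = (\<integral>\<^sup>+(y::real). 0 \<partial>lborel)"
        using that by (intro nn_integral_cong) (auto simp: indicator_def)
      then show ?thesis by simp
    qed simp
    show "AE x in lborel. (\<integral>\<^sup>+y. indicator ?N (mk_point (x, y)) * indicator {0..1} y \<partial>lborel) * indicator {0..1} x = 0"
      by (rule eventually_mono[OF ne zero])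
  qed
  finally show ?thesis
    using N sets by (intro AE_I[of _ _ ?N]) auto
qed

lemma emeasure_flat_unif_line:
  assumes m: "0 < m"
  shows "emeasure (flat_unif m) {y. fst y = t} = 0"
proof -
  let ?N = "{y :: real \<times> real. fst y = t}"
  have N: "?N \<in> sets borel" by measurable
  have "emeasure (flat_unif m) ?N = (\<integral>\<^sup>+y. indicator ?N y \<partial>flat_unif m)"
    using N by simp
  also have "\<dots> = ennreal (1 / real m) *
    (\<integral>\<^sup>+t'. (\<integral>\<^sup>+u. indicator ?N (t', u) * indicator {0..1} u \<partial>lborel) * indicator {0..real m} t' \<partial>lborel)"
    using m N by (intro nn_integral_flat_unif) auto
  also have "(\<integral>\<^sup>+t'. (\<integral>\<^sup>+u. indicator ?N (t', u) * indicator {0..1} u \<partial>lborel) * indicator {0..real m} t' \<partial>lborel) =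
    (\<integral>\<^sup>+(t'::real). 0 \<partial>lborel)"
    using AE_lborel_singleton[of t] by (intro nn_integral_cong_AE) (auto elim!: eventually_mono)
  finally show ?thesis by simp
qed

text \<open>By Fubini: once one point is fixed, a tie puts the other one on a line of measure zero.
  This makes the sorting key injective almost surely.\<close>

lemma (in prob_space) AE_indep_fst_neq:
  fixes Y :: "'i \<Rightarrow> 'a \<Rightarrow> real \<times> real"
  assumes indep: "indep_vars (\<lambda>_. borel) Y I" and ij: "i \<in> I" "j \<in> I" "i \<noteq> j"
    and P: "\<And>i. i \<in> I \<Longrightarrow> distr M borel (Y i) = flat_unif m" and m: "0 < m"
  shows "AE \<omega> in M. fst (Y i \<omega>) \<noteq> fst (Y j \<omega>)"
proof -
  interpret P: prob_space "flat_unif m" by (rule prob_space_flat_unif)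
  interpret PJ: product_sigma_finite "\<lambda>_::'i. flat_unif m" by standard
  have [measurable]: "Y i \<in> borel_measurable M" "Y j \<in> borel_measurable M"
    using indep ij by (auto simp: indep_vars_def)
  define g :: "real \<times> real \<Rightarrow> real \<times> real \<Rightarrow> ennreal" where "g y y' = (if fst y = fst y' then 1 else 0)" for y y'
  have g[measurable (raw)]: "(\<lambda>x. g (f x) (f' x)) \<in> borel_measurable N"
    if [measurable]: "f \<in> N \<rightarrow>\<^sub>M borel" "f' \<in> N \<rightarrow>\<^sub>M borel" for f f' and N :: "'z measure"
    unfolding g_def by measurable
  have sub: "indep_vars (\<lambda>_. borel) Y {i, j}"
    using ij by (intro indep_vars_subset[OF indep]) auto
  have g0: "(\<integral>\<^sup>+y'. g y y' \<partial>flat_unif m) = 0" for y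
  proof -
    have "(\<integral>\<^sup>+y'. g y y' \<partial>flat_unif m) = (\<integral>\<^sup>+y'. indicator {y'. fst y' = fst y} y' \<partial>flat_unif m)"
      by (intro nn_integral_cong) (auto simp: g_def)
    also have "\<dots> = emeasure (flat_unif m) {y'. fst y' = fst y}"
      by (intro nn_integral_indicator) simp
    finally show ?thesis using m by (simp add: emeasure_flat_unif_line)
  qed
  have "(\<integral>\<^sup>+\<omega>. g (Y i \<omega>) (Y j \<omega>) \<partial>M) = (\<integral>\<^sup>+x. g (x i) (x j) \<partial>(\<Pi>\<^sub>M l\<in>{i,j}. distr M borel (Y l)))"
    using nn_integral_indep_vars[OF sub, of "\<lambda>x. g (x i) (x j)"] by (simp add: measurable_component_singleton g)
  also have "(\<Pi>\<^sub>M l\<in>{i,j}. distr M borel (Y l)) = PiM {i,j} (\<lambda>_. flat_unif m)"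
    using P ij by (intro PiM_cong) auto
  also have "(\<integral>\<^sup>+x. g (x i) (x j) \<partial>PiM {i,j} (\<lambda>_. flat_unif m)) = (\<integral>\<^sup>+z. g (fst z) (snd z) \<partial>(flat_unif m \<Otimes>\<^sub>M flat_unif m))"
    using ij by (intro PJ.product_nn_integral_pair) (simp_all add: split_beta')
  also have "\<dots> = (\<integral>\<^sup>+y. \<integral>\<^sup>+y'. g y y' \<partial>flat_unif m \<partial>flat_unif m)"
    by (subst P.nn_integral_fst[symmetric]) simp_all
  also have "\<dots> = 0" by (simp add: g0)
  finally have "(\<integral>\<^sup>+\<omega>. g (Y i \<omega>) (Y j \<omega>) \<partial>M) = 0" .
  then have "AE \<omega> in M. g (Y i \<omega>) (Y j \<omega>) = 0"
    by (subst (asm) nn_integral_0_iff_AE) simp_all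
  then show ?thesis
    by (auto simp: g_def elim!: eventually_mono split: if_splits)
qed

text \<open>The factor \<open>(k + 4) ^ 4\<close> counts index quadruples, all with the same bound;
  \<open>k\<close> is the number of points outside a quadruple. The nonnegative integral is monotone
  for arbitrary functions, so measurability is only asked of the sum that dominates the
  optimum.\<close>

lemma (in prob_space) nn_integral_TSPD_speed_le:
  fixes X :: "nat \<Rightarrow> 'a \<Rightarrow> point"
  assumes \<alpha>: "1 \<le> \<alpha>" and indep: "indep_vars (\<lambda>_. borel) X I" and I: "finite I" "card I = k + 4" "2 \<le> k"
    and unif: "\<And>i. i \<in> I \<Longrightarrow> distr M borel (X i) = square_unif"
    and m: "0 < m" "real k \<le> (h * real m)\<^sup>2"
  shows "(\<integral>\<^sup>+\<omega>. ennreal (3 * TSPD_speed \<alpha> ((\<lambda>i. X i \<omega>) ` I)) \<partial>M) \<le>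
    of_nat (k + 4) ^ 4 * (ennreal (1 / real k) ^ 3 * (ennreal (real m / real k) * strip_mean \<alpha> h) +
      ennreal (4 / real k) ^ 3 * (ennreal (16 * real m / real k + 4 / real m) * ennreal (2 * real m / real k))) + 30"
    (is "_ \<le> _ * ?T + 30")
proof -
  define Y where "Y i \<omega> = snake m (X i \<omega>)" for i \<omega>
  have rv: "X i \<in> borel_measurable M" if "i \<in> I" for i
    using indep that by (auto simp: indep_vars_def)
  have rvY: "Y i \<in> borel_measurable M" if "i \<in> I" for i
    unfolding Y_def using rv[OF that] by measurable
  have indepY: "indep_vars (\<lambda>_. borel) Y I"
    unfolding Y_def by (rule indep_vars_compose2[OF indep]) simp
  have lawY: "distr M borel (Y i) = flat_unif m" if "i \<in> I" for i
  proof -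
    have "Y i = snake m \<circ> X i" by (simp add: Y_def fun_eq_iff)
    then have "distr M borel (Y i) = distr (distr M borel (X i)) borel (snake m)"
      using rv[OF that] by (simp add: distr_distr)
    then show ?thesis using unif[OF that] by (simp add: flat_unif_def)
  qed
  let ?G = "\<lambda>y0 y1 y2 y3. ennreal (flat_cost \<alpha> m y0 y1 y2 y3 + cross_cost m y0 y3)"
  have G: "(\<lambda>(y0,y1,y2,y3). ?G y0 y1 y2 y3) \<in> borel_measurable (borel \<Otimes>\<^sub>M borel \<Otimes>\<^sub>M borel \<Otimes>\<^sub>M borel)"
    unfolding flat_cost_def split_beta' by measurable
  let ?t = "\<lambda>\<omega> a b c d. if consecutive (\<lambda>i. fst (Y i \<omega>)) I a b c d then ?G (Y a \<omega>) (Y b \<omega>) (Y c \<omega>) (Y d \<omega>) else 0"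
  have meas: "(\<lambda>\<omega>. ?t \<omega> a b c d) \<in> borel_measurable M" if "a \<in> I" "b \<in> I" "c \<in> I" "d \<in> I" for a b c d
  proof -
    have [measurable]: "Y a \<in> borel_measurable M" "Y b \<in> borel_measurable M" "Y c \<in> borel_measurable M" "Y d \<in> borel_measurable M"
      using that rvY by auto
    have [measurable]: "Measurable.pred M (\<lambda>\<omega>. \<forall>l\<in>I - {a,b,c,d}. \<not> (fst (Y a \<omega>) < fst (Y l \<omega>) \<and> fst (Y l \<omega>) < fst (Y d \<omega>)))"
    proof (rule pred_intros_finite)
      fix l assume "l \<in> I - {a,b,c,d}"
      then have [measurable]: "Y l \<in> borel_measurable M" using rvY by auto
      show "Measurable.pred M (\<lambda>\<omega>. \<not> (fst (Y a \<omega>) < fst (Y l \<omega>) \<and> fst (Y l \<omega>) < fst (Y d \<omega>)))" by measurable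
    qed (use I in auto)
    show ?thesis unfolding consecutive_def flat_cost_def by measurable
  qed
  have AE1: "AE \<omega> in M. \<forall>i\<in>I. 0 < X i \<omega> $ 1 \<and> X i \<omega> $ 1 < 1 \<and> 0 \<le> X i \<omega> $ 2 \<and> X i \<omega> $ 2 \<le> 1"
  proof (rule AE_finite_allI[OF I(1)])
    fix i assume i: "i \<in> I"
    have "AE p in distr M borel (X i). 0 < p $ 1 \<and> p $ 1 < 1 \<and> 0 \<le> p $ 2 \<and> p $ 2 \<le> 1"
      unfolding unif[OF i] by (rule AE_square_unif)
    then show "AE \<omega> in M. 0 < X i \<omega> $ 1 \<and> X i \<omega> $ 1 < 1 \<and> 0 \<le> X i \<omega> $ 2 \<and> X i \<omega> $ 2 \<le> 1"
      by (subst (asm) AE_distr_iff) (use rv[OF i] in auto)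
  qed
  have AE2: "AE \<omega> in M. \<forall>i\<in>I. \<forall>j\<in>I. i \<noteq> j \<longrightarrow> fst (Y i \<omega>) \<noteq> fst (Y j \<omega>)"
    using AE_indep_fst_neq[OF indepY _ _ _ lawY m(1)] I(1)
    by (intro AE_finite_allI) (auto simp: AE_impI)
  have term_le: "(\<integral>\<^sup>+\<omega>. ?t \<omega> a b c d \<partial>M) \<le> ?T" if "a \<in> I" "b \<in> I" "c \<in> I" "d \<in> I" for a b c d
  proof -
    have "(\<integral>\<^sup>+\<omega>. ?t \<omega> a b c d \<partial>M) \<le>
      (\<integral>\<^sup>+y0. \<integral>\<^sup>+y1. \<integral>\<^sup>+y2. \<integral>\<^sup>+y3. (if fst y0 < fst y1 \<and> fst y1 < fst y2 \<and> fst y2 < fst y3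
      then ?G y0 y1 y2 y3 * emeasure (flat_unif m) (avoid y0 y3) ^ (card I - 4) else 0)
      \<partial>flat_unif m \<partial>flat_unif m \<partial>flat_unif m \<partial>flat_unif m)"
      using that lawY by (intro nn_integral_consecutive[OF indepY I(1) _ _ G]) auto
    also have "\<dots> \<le> ?T"
    proof -
      have k: "card I - 4 = k" "0 < k" using I by auto
      show ?thesis unfolding k(1) by (rule nn_integral_chain_le[OF \<alpha> m(1) k(2) m(2)])
    qed
    finally show ?thesis .
  qed
  have "(\<integral>\<^sup>+\<omega>. ennreal (3 * TSPD_speed \<alpha> ((\<lambda>i. X i \<omega>) ` I)) \<partial>M) \<le>
    (\<integral>\<^sup>+\<omega>. (\<Sum>a\<in>I. \<Sum>b\<in>I. \<Sum>c\<in>I. \<Sum>d\<in>I. ?t \<omega> a b c d) + 30 \<partial>M)"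
  proof (rule nn_integral_mono_AE, rule AE_mp[OF AE_conjI[OF AE1 AE2]], intro AE_I2 impI)
    fix \<omega> assume *: "(\<forall>i\<in>I. 0 < X i \<omega> $ 1 \<and> X i \<omega> $ 1 < 1 \<and> 0 \<le> X i \<omega> $ 2 \<and> X i \<omega> $ 2 \<le> 1) \<and>
      (\<forall>i\<in>I. \<forall>j\<in>I. i \<noteq> j \<longrightarrow> fst (Y i \<omega>) \<noteq> fst (Y j \<omega>))"
    let ?r = "\<lambda>a b c d. if consecutive (\<lambda>i. fst (Y i \<omega>)) I a b c d then
        flat_cost \<alpha> m (Y a \<omega>) (Y b \<omega>) (Y c \<omega>) (Y d \<omega>) + cross_cost m (Y a \<omega>) (Y d \<omega>) else 0"
    have r0: "0 \<le> ?r a b c d" for a b c d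
      using flat_cost_nonneg[of \<alpha> m] \<alpha> by (auto simp: consecutive_def cross_cost_def intro!: add_nonneg_nonneg)
    have "inj_on (\<lambda>i. snake_t m (X i \<omega>)) I"
      using * by (auto simp: Y_def snake_def inj_on_def)
    then have "3 * TSPD_speed \<alpha> ((\<lambda>i. X i \<omega>) ` I) \<le> (\<Sum>a\<in>I. \<Sum>b\<in>I. \<Sum>c\<in>I. \<Sum>d\<in>I. ?r a b c d) + 30"
      using TSPD_speed_le_sum_consecutive[OF \<alpha> m(1) I(1), of "\<lambda>i. X i \<omega>"] I *
      by (simp add: Y_def snake_def cong: if_cong)
    then have "ennreal (3 * TSPD_speed \<alpha> ((\<lambda>i. X i \<omega>) ` I)) \<le> ennreal ((\<Sum>a\<in>I. \<Sum>b\<in>I. \<Sum>c\<in>I. \<Sum>d\<in>I. ?r a b c d) + 30)"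
      by (rule ennreal_leI)
    also have "\<dots> = (\<Sum>a\<in>I. \<Sum>b\<in>I. \<Sum>c\<in>I. \<Sum>d\<in>I. ennreal (?r a b c d)) + 30"
      using r0 by (simp add: sum_nonneg)
    also have "\<dots> = (\<Sum>a\<in>I. \<Sum>b\<in>I. \<Sum>c\<in>I. \<Sum>d\<in>I. ?t \<omega> a b c d) + 30"
      by (simp add: if_distrib[of ennreal] cong: if_cong)
    finally show "ennreal (3 * TSPD_speed \<alpha> ((\<lambda>i. X i \<omega>) ` I)) \<le> (\<Sum>a\<in>I. \<Sum>b\<in>I. \<Sum>c\<in>I. \<Sum>d\<in>I. ?t \<omega> a b c d) + 30" .
  qed
  also have "\<dots> = (\<Sum>a\<in>I. \<Sum>b\<in>I. \<Sum>c\<in>I. \<Sum>d\<in>I. (\<integral>\<^sup>+\<omega>. ?t \<omega> a b c d \<partial>M)) + 30"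
    using meas by (simp add: nn_integral_add nn_integral_sum emeasure_space_1)
  also have "\<dots> \<le> (\<Sum>a\<in>I. \<Sum>b\<in>I. \<Sum>c\<in>I. \<Sum>d\<in>I. ?T) + 30"
    by (intro add_right_mono sum_mono term_le)
  also have "\<dots> = of_nat (k + 4) ^ 4 * ?T + 30"
    using I(2) by (simp add: power4_eq_xxxx mult.assoc)
  finally show ?thesis .
qed

section \<open>The limiting ring cost\<close>

text \<open>The dependence on coordinate \<open>i\<close> is made an explicit first argument of
  \<open>g\<close>; the last premise then discards the function update that splitting off this
  coordinate creates.\<close>

lemma (in product_sigma_finite) nn_integral_PiM_peel:
  assumes "finite J" "i \<notin> J" "(\<lambda>x. g (x i) x) \<in> borel_measurable (PiM (insert i J) M)"
    and "\<And>y x z. g y (x(i := z)) = g y x"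
  shows "(\<integral>\<^sup>+x. g (x i) x \<partial>PiM (insert i J) M) = (\<integral>\<^sup>+y. \<integral>\<^sup>+x. g y x \<partial>PiM J M \<partial>M i)"
  using product_nn_integral_insert_rev[OF assms(1-3)] assms(4) by simp

lemma (in prob_space) nn_integral_strip_cost:
  fixes Z U :: "nat \<Rightarrow> 'a \<Rightarrow> real"
  assumes indep: "indep_vars (\<lambda>_. borel) (case_sum Z U) ({1..3} <+> {0..3})"
    and Z: "\<And>i. i \<in> {1..3} \<Longrightarrow> distr M borel (Z i) = exp1"
    and U: "\<And>i. i \<in> {0..3} \<Longrightarrow> distr M borel (U i) = unif01"
  shows "(\<integral>\<^sup>+\<omega>. ennreal (strip_cost \<alpha> h (U 0 \<omega>) (Z 1 \<omega>) (U 1 \<omega>) (Z 2 \<omega>) (U 2 \<omega>) (Z 3 \<omega>) (U 3 \<omega>)) \<partial>M) = strip_mean \<alpha> h"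
proof -
  \<comment> \<open>Gaps and heights form one family over a sum type, so that their joint law is a
    single product measure whose factors depend on the tag.\<close>
  define L :: "nat + nat \<Rightarrow> real measure" where "L = case_sum (\<lambda>_. exp1) (\<lambda>_. unif01)"
  have L_simps[simp]: "L (Inl i) = exp1" "L (Inr i) = unif01" for i by (simp_all add: L_def)
  have "prob_space (L i)" for i
    by (cases i) (simp_all add: prob_space_exp1 prob_space_unif01)
  then interpret L: product_sigma_finite L
    by (intro product_sigma_finite.intro prob_space_imp_sigma_finite)
  have sets_L: "sets (L i) = sets borel" for i by (cases i) simp_all
  define S where "S u0 z1 u1 z2 u2 z3 u3 = ennreal (strip_cost \<alpha> h u0 z1 u1 z2 u2 z3 u3)" for u0 z1 u1 z2 u2 z3 u3
  have S_meas: "(\<lambda>x. S (f0 x) (f1 x) (f2 x) (f3 x) (f4 x) (f5 x) (f6 x)) \<in> borel_measurable N"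
    if [measurable]: "f0 \<in> borel_measurable N" "f1 \<in> borel_measurable N" "f2 \<in> borel_measurable N"
      "f3 \<in> borel_measurable N" "f4 \<in> borel_measurable N" "f5 \<in> borel_measurable N" "f6 \<in> borel_measurable N"
    for f0 f1 f2 f3 f4 f5 f6 and N :: "(nat + nat \<Rightarrow> real) measure"
    unfolding S_def strip_cost_def by measurable
  have comp: "(\<lambda>x. x i) \<in> borel_measurable (PiM K L)" if "i \<in> K" for i K
    using measurable_component_singleton[OF that, of L] measurable_cong_sets[OF refl sets_L] by blast
  let ?I = "{Inr 0, Inl 1, Inr 1, Inl 2, Inr 2, Inl 3, Inr 3} :: (nat + nat) set"
  have three: "{1..3::nat} = {1,2,3}" "{0..3::nat} = {0,1,2,3}" by auto
  have I: "{1..3} <+> {0..3} = ?I"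
    unfolding three by auto
  have "(\<Pi>\<^sub>M i\<in>?I. distr M borel (case_sum Z U i)) = PiM ?I L"
    using Z U by (intro PiM_cong) auto
  then have law: "(\<integral>\<^sup>+x. F x \<partial>(\<Pi>\<^sub>M i\<in>?I. distr M borel (case_sum Z U i))) = (\<integral>\<^sup>+x. F x \<partial>PiM ?I L)" for F
    by simp
  have sets_I: "sets (\<Pi>\<^sub>M i\<in>?I. borel) = sets (PiM ?I L)"
    using sets_L by (intro sets_PiM_cong) auto
  have peel:
    "(\<integral>\<^sup>+x. S (x (Inr 0)) (x (Inl 1)) (x (Inr 1)) (x (Inl 2)) (x (Inr 2)) (x (Inl 3)) (x (Inr 3)) \<partial>PiM ?I L) =
      (\<integral>\<^sup>+u0. \<integral>\<^sup>+x. S u0 (x (Inl 1)) (x (Inr 1)) (x (Inl 2)) (x (Inr 2)) (x (Inl 3)) (x (Inr 3)) \<partial>PiM {Inl 1, Inr 1, Inl 2, Inr 2, Inl 3, Inr 3} L \<partial>L (Inr 0))"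
    "\<And>u0. (\<integral>\<^sup>+x. S u0 (x (Inl 1)) (x (Inr 1)) (x (Inl 2)) (x (Inr 2)) (x (Inl 3)) (x (Inr 3)) \<partial>PiM {Inl 1, Inr 1, Inl 2, Inr 2, Inl 3, Inr 3} L) =
      (\<integral>\<^sup>+z1. \<integral>\<^sup>+x. S u0 z1 (x (Inr 1)) (x (Inl 2)) (x (Inr 2)) (x (Inl 3)) (x (Inr 3)) \<partial>PiM {Inr 1, Inl 2, Inr 2, Inl 3, Inr 3} L \<partial>L (Inl 1))"
    "\<And>u0 z1. (\<integral>\<^sup>+x. S u0 z1 (x (Inr 1)) (x (Inl 2)) (x (Inr 2)) (x (Inl 3)) (x (Inr 3)) \<partial>PiM {Inr 1, Inl 2, Inr 2, Inl 3, Inr 3} L) =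
      (\<integral>\<^sup>+u1. \<integral>\<^sup>+x. S u0 z1 u1 (x (Inl 2)) (x (Inr 2)) (x (Inl 3)) (x (Inr 3)) \<partial>PiM {Inl 2, Inr 2, Inl 3, Inr 3} L \<partial>L (Inr 1))"
    "\<And>u0 z1 u1. (\<integral>\<^sup>+x. S u0 z1 u1 (x (Inl 2)) (x (Inr 2)) (x (Inl 3)) (x (Inr 3)) \<partial>PiM {Inl 2, Inr 2, Inl 3, Inr 3} L) =
      (\<integral>\<^sup>+z2. \<integral>\<^sup>+x. S u0 z1 u1 z2 (x (Inr 2)) (x (Inl 3)) (x (Inr 3)) \<partial>PiM {Inr 2, Inl 3, Inr 3} L \<partial>L (Inl 2))"
    "\<And>u0 z1 u1 z2. (\<integral>\<^sup>+x. S u0 z1 u1 z2 (x (Inr 2)) (x (Inl 3)) (x (Inr 3)) \<partial>PiM {Inr 2, Inl 3, Inr 3} L) =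
      (\<integral>\<^sup>+u2. \<integral>\<^sup>+x. S u0 z1 u1 z2 u2 (x (Inl 3)) (x (Inr 3)) \<partial>PiM {Inl 3, Inr 3} L \<partial>L (Inr 2))"
    "\<And>u0 z1 u1 z2 u2. (\<integral>\<^sup>+x. S u0 z1 u1 z2 u2 (x (Inl 3)) (x (Inr 3)) \<partial>PiM {Inl 3, Inr 3} L) =
      (\<integral>\<^sup>+z3. \<integral>\<^sup>+x. S u0 z1 u1 z2 u2 z3 (x (Inr 3)) \<partial>PiM {Inr 3} L \<partial>L (Inl 3))"
    "\<And>u0 z1 u1 z2 u2 z3. (\<integral>\<^sup>+x. S u0 z1 u1 z2 u2 z3 (x (Inr 3)) \<partial>PiM {Inr 3} L) =
      (\<integral>\<^sup>+u3. \<integral>\<^sup>+x. S u0 z1 u1 z2 u2 z3 u3 \<partial>PiM {} L \<partial>L (Inr 3))"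
    by (rule L.nn_integral_PiM_peel; auto intro!: S_meas comp)+
  have "(\<integral>\<^sup>+\<omega>. S (U 0 \<omega>) (Z 1 \<omega>) (U 1 \<omega>) (Z 2 \<omega>) (U 2 \<omega>) (Z 3 \<omega>) (U 3 \<omega>) \<partial>M) =
    (\<integral>\<^sup>+\<omega>. (\<lambda>x. S (x (Inr 0)) (x (Inl 1)) (x (Inr 1)) (x (Inl 2)) (x (Inr 2)) (x (Inl 3)) (x (Inr 3)))
      (\<lambda>i\<in>?I. case_sum Z U i \<omega>) \<partial>M)"
    by simp
  also have "\<dots> = (\<integral>\<^sup>+x. S (x (Inr 0)) (x (Inl 1)) (x (Inr 1)) (x (Inl 2)) (x (Inr 2)) (x (Inl 3)) (x (Inr 3))
      \<partial>(\<Pi>\<^sub>M i\<in>?I. distr M borel (case_sum Z U i)))"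
    using indep unfolding I
    by (intro nn_integral_indep_vars) (auto simp: measurable_cong_sets[OF sets_I refl] intro!: S_meas comp)
  also have "\<dots> = (\<integral>\<^sup>+x. S (x (Inr 0)) (x (Inl 1)) (x (Inr 1)) (x (Inl 2)) (x (Inr 2)) (x (Inl 3)) (x (Inr 3)) \<partial>PiM ?I L)"
    by (rule law)
  also have "\<dots> = strip_mean \<alpha> h"
    unfolding peel strip_mean_def S_def[symmetric] by (simp add: PiM_empty nn_integral_count_space_finite)
  finally show ?thesis by (simp add: S_def)
qed

section \<open>Second moment of the ring cost\<close>

text \<open>Send the truck along the shorter route \<open>x\<close> and the drone along the longer
  route \<open>y\<close>. The smaller square is at most the average, \<open>y ^ 2\<close> is at most
  \<open>x ^ 2 + y ^ 2\<close>, and the maximum of two nonnegative terms is at most their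
  sum.\<close>

lemma ring4_power2_le:
  assumes \<alpha>: "1 \<le> \<alpha>" and ab: "0 \<le> a" "0 \<le> b"
  shows "(ring4 \<alpha> a b)\<^sup>2 \<le> (1 / 2 + 1 / \<alpha>\<^sup>2) * (a\<^sup>2 + b\<^sup>2)"
proof -
  have aux: "(max x (y / \<alpha>))\<^sup>2 \<le> (1 / 2 + 1 / \<alpha>\<^sup>2) * (x\<^sup>2 + y\<^sup>2)" if "0 \<le> x" "x \<le> y" for x y
  proof -
    have "x\<^sup>2 \<le> y\<^sup>2" using that by (intro power_mono) auto
    then have "x\<^sup>2 \<le> 1 / 2 * (x\<^sup>2 + y\<^sup>2)" by simp
    moreover have "(y / \<alpha>)\<^sup>2 \<le> 1 / \<alpha>\<^sup>2 * (x\<^sup>2 + y\<^sup>2)"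
      by (simp add: power_divide divide_right_mono)
    moreover have "0 \<le> 1 / 2 * (x\<^sup>2 + y\<^sup>2)" "0 \<le> 1 / \<alpha>\<^sup>2 * (x\<^sup>2 + y\<^sup>2)" by auto
    moreover have "(max x (y / \<alpha>))\<^sup>2 = x\<^sup>2 \<or> (max x (y / \<alpha>))\<^sup>2 = (y / \<alpha>)\<^sup>2"
      by (simp add: max_def)
    moreover have "(1 / 2 + 1 / \<alpha>\<^sup>2) * (x\<^sup>2 + y\<^sup>2) = 1 / 2 * (x\<^sup>2 + y\<^sup>2) + 1 / \<alpha>\<^sup>2 * (x\<^sup>2 + y\<^sup>2)"
      by (rule distrib_right)
    ultimately show ?thesis by linarith
  qed
  show ?thesis
  proof (cases "a \<le> b")
    case True
    have "(ring4 \<alpha> a b)\<^sup>2 \<le> (max a (b / \<alpha>))\<^sup>2"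
      using ring4_nonneg[of \<alpha> a b] assms by (intro power_mono) (auto simp: ring4_def)
    then show ?thesis using aux[OF ab(1) True] by linarith
  next
    case False
    have "(ring4 \<alpha> a b)\<^sup>2 \<le> (max b (a / \<alpha>))\<^sup>2"
      using ring4_nonneg[of \<alpha> a b] assms by (intro power_mono) (auto simp: ring4_def)
    then show ?thesis using aux[OF ab(2), of a] False by (simp add: add.commute)
  qed
qed

text \<open>Squaring removes the roots once the mixed products are bounded by
  \<open>(x + y) ^ 2 \<le> 2 * (x ^ 2 + y ^ 2)\<close>. What remains is a quadratic polynomial in
  the gaps and heights, with explicit mean.\<close>

lemma strip_cost_power2_le:
  assumes \<alpha>: "1 \<le> \<alpha>"
  shows "(strip_cost \<alpha> h u0 z1 u1 z2 u2 z3 u3)\<^sup>2 \<le> (1 / 2 + 1 / \<alpha>\<^sup>2) * (2 *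
    (z1\<^sup>2 + (z2 + z3)\<^sup>2 + (z1 + z2)\<^sup>2 + z3\<^sup>2 + h ^ 4 * ((u0 - u1)\<^sup>2 + (u1 - u3)\<^sup>2 + (u0 - u2)\<^sup>2 + (u2 - u3)\<^sup>2)))"
proof -
  have sq: "(strip_dist h w v)\<^sup>2 = w\<^sup>2 + h ^ 4 * v\<^sup>2" for w v
    by (simp add: strip_dist_def)
  have two: "(x + y)\<^sup>2 \<le> 2 * (x\<^sup>2 + y\<^sup>2)" for x y :: real
    using sum_squares_ge_zero[of "x - y" 0] by (simp add: power2_eq_square algebra_simps)
  let ?a = "strip_dist h z1 (u0 - u1) + strip_dist h (z2 + z3) (u1 - u3)"
  let ?b = "strip_dist h (z1 + z2) (u0 - u2) + strip_dist h z3 (u2 - u3)"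
  have "(strip_cost \<alpha> h u0 z1 u1 z2 u2 z3 u3)\<^sup>2 \<le> (1 / 2 + 1 / \<alpha>\<^sup>2) * (?a\<^sup>2 + ?b\<^sup>2)"
    unfolding strip_cost_def using \<alpha> by (intro ring4_power2_le) (auto simp: strip_dist_def)
  also have "\<dots> \<le> (1 / 2 + 1 / \<alpha>\<^sup>2) * (2 * (z1\<^sup>2 + h ^ 4 * (u0 - u1)\<^sup>2 + ((z2 + z3)\<^sup>2 + h ^ 4 * (u1 - u3)\<^sup>2)) +
      2 * ((z1 + z2)\<^sup>2 + h ^ 4 * (u0 - u2)\<^sup>2 + (z3\<^sup>2 + h ^ 4 * (u2 - u3)\<^sup>2)))"
    by (intro mult_left_mono add_mono order_trans[OF two]) (simp_all add: sq)
  also have "\<dots> = (1 / 2 + 1 / \<alpha>\<^sup>2) * (2 *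
    (z1\<^sup>2 + (z2 + z3)\<^sup>2 + (z1 + z2)\<^sup>2 + z3\<^sup>2 + h ^ 4 * ((u0 - u1)\<^sup>2 + (u1 - u3)\<^sup>2 + (u0 - u2)\<^sup>2 + (u2 - u3)\<^sup>2)))"
    by (rule arg_cong[where f="\<lambda>x. (1 / 2 + 1 / \<alpha>\<^sup>2) * x"]) (simp add: algebra_simps)
  finally show ?thesis .
qed

lemma C4_eq_strip_cost: "C4 \<alpha> h z u = strip_cost \<alpha> h (u 0) (z 1) (u 1) (z 2) (u 2) (z 3) (u 3)"
proof -
  have W: "strip_W z 0 = 0" "strip_W z 1 = z 1" "strip_W z 2 = z 1 + z 2" "strip_W z 3 = z 1 + z 2 + z 3"
    by (simp_all add: strip_W_def eval_nat_numeral)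
  show ?thesis
    unfolding C4_def Let_def strip_L_def W strip_cost_def ring4_def strip_dist_def
    by (simp add: algebra_simps add_divide_distrib)
qed

lemma (in prob_space) indep_vars_product_moment:
  fixes Y :: "'i \<Rightarrow> 'a \<Rightarrow> real"
  assumes indep: "indep_vars (\<lambda>_. borel) Y I" and ij: "i \<in> I" "j \<in> I" "i \<noteq> j"
    and int: "integrable M (Y i)" "integrable M (Y j)"
  shows "expectation (\<lambda>\<omega>. Y i \<omega> * Y j \<omega>) = expectation (Y i) * expectation (Y j)"
    and "integrable M (\<lambda>\<omega>. Y i \<omega> * Y j \<omega>)"
proof -
  have sub: "indep_vars (\<lambda>_. borel) Y {i, j}"
    using ij by (intro indep_vars_subset[OF indep]) auto
  show "expectation (\<lambda>\<omega>. Y i \<omega> * Y j \<omega>) = expectation (Y i) * expectation (Y j)"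
    using indep_vars_lebesgue_integral[OF _ sub] int ij(3) by auto
  show "integrable M (\<lambda>\<omega>. Y i \<omega> * Y j \<omega>)"
    using indep_vars_integrable[OF _ sub] int ij(3) by auto
qed

lemma (in prob_space) indep_vars_quadratic_moments:
  fixes Y :: "'i \<Rightarrow> 'a \<Rightarrow> real"
  assumes indep: "indep_vars (\<lambda>_. borel) Y I" and ij: "i \<in> I" "j \<in> I" "i \<noteq> j"
    and int: "integrable M (Y i)" "integrable M (Y j)" "integrable M (\<lambda>\<omega>. (Y i \<omega>)\<^sup>2)" "integrable M (\<lambda>\<omega>. (Y j \<omega>)\<^sup>2)"
  shows "integrable M (\<lambda>\<omega>. (Y i \<omega> + Y j \<omega>)\<^sup>2)" "integrable M (\<lambda>\<omega>. (Y i \<omega> - Y j \<omega>)\<^sup>2)"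
    and "expectation (\<lambda>\<omega>. (Y i \<omega> + Y j \<omega>)\<^sup>2) =
      expectation (\<lambda>\<omega>. (Y i \<omega>)\<^sup>2) + expectation (\<lambda>\<omega>. (Y j \<omega>)\<^sup>2) + 2 * (expectation (Y i) * expectation (Y j))"
    and "expectation (\<lambda>\<omega>. (Y i \<omega> - Y j \<omega>)\<^sup>2) =
      expectation (\<lambda>\<omega>. (Y i \<omega>)\<^sup>2) + expectation (\<lambda>\<omega>. (Y j \<omega>)\<^sup>2) - 2 * (expectation (Y i) * expectation (Y j))"
  using indep_vars_product_moment[OF indep ij int(1,2)] int
  by (simp_all add: power2_sum power2_diff mult.assoc)

lemma (in prob_space) unif01_moments:
  assumes X: "X \<in> borel_measurable M" "distr M borel X = unif01"
  shows "integrable M (\<lambda>\<omega>. X \<omega> ^ k)" "expectation (\<lambda>\<omega>. X \<omega> ^ k) = 1 / (real k + 1)"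
proof -
  have d: "unif01 = density lborel (\<lambda>x. ennreal (indicator {0..1} x))"
    unfolding unif01_def uniform_measure_def
    by (intro density_cong) (auto simp: indicator_def divide_ennreal_def)
  have int: "integrable lborel (\<lambda>x::real. x ^ k * indicator {0..1} x)"
    using borel_integrable_atLeastAtMost[of 0 1 "\<lambda>x::real. x ^ k"]
    by (auto simp: indicator_def if_distrib cong: if_cong)
  then have "integrable unif01 (\<lambda>x. x ^ k)"
    unfolding d by (subst integrable_density) (auto simp: mult.commute)
  then show "integrable M (\<lambda>\<omega>. X \<omega> ^ k)"
    unfolding X(2)[symmetric] using X(1) by (subst (asm) integrable_distr_eq) auto
  have "expectation (\<lambda>\<omega>. X \<omega> ^ k) = integral\<^sup>L unif01 (\<lambda>x. x ^ k)"
    unfolding X(2)[symmetric] using X(1) by (subst integral_distr) auto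
  also have "\<dots> = (\<integral>x. x ^ k * indicator {0..1} x \<partial>lborel)"
    unfolding d by (subst integral_density) (auto simp: mult.commute)
  also have "\<dots> = 1 / (real k + 1)"
    by (subst integral_power) (auto simp: add.commute)
  finally show "expectation (\<lambda>\<omega>. X \<omega> ^ k) = 1 / (real k + 1)" .
qed

lemma (in prob_space) power2_expectation_le:
  fixes X :: "'a \<Rightarrow> real"
  assumes "integrable M X" "integrable M (\<lambda>\<omega>. (X \<omega>)\<^sup>2)"
  shows "(expectation X)\<^sup>2 \<le> expectation (\<lambda>\<omega>. (X \<omega>)\<^sup>2)"
  using variance_positive[of X] variance_eq[OF assms] by simp

text \<open>The bound on the second moment does double duty: it shows that \<open>C4\<close> is
  integrable, so that \<open>strip_mean\<close> is a genuine expectation, and it bounds that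
  expectation because the variance is nonnegative.\<close>

lemma (in prob_space) C4_moments:
  fixes Z U :: "nat \<Rightarrow> 'a \<Rightarrow> real"
  assumes \<alpha>: "1 \<le> \<alpha>" and indep: "indep_vars (\<lambda>_. borel) (case_sum Z U) ({1..3} <+> {0..3})"
    and Z: "\<And>i. i \<in> {1..3} \<Longrightarrow> distributed M lborel (Z i) (exponential_density 1)"
    and U: "\<And>i. i \<in> {0..3} \<Longrightarrow> distr M borel (U i) = unif01"
  shows "strip_mean \<alpha> h = ennreal (expectation (\<lambda>\<omega>. C4 \<alpha> h (\<lambda>i. Z i \<omega>) (\<lambda>i. U i \<omega>)))"
    and "(expectation (\<lambda>\<omega>. C4 \<alpha> h (\<lambda>i. Z i \<omega>) (\<lambda>i. U i \<omega>)))\<^sup>2 \<le> (1 / 2 + 1 / \<alpha>\<^sup>2) * (32 + 4 / 3 * h ^ 4)"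
    and "0 \<le> expectation (\<lambda>\<omega>. C4 \<alpha> h (\<lambda>i. Z i \<omega>) (\<lambda>i. U i \<omega>))"
proof -
  let ?I = "{1..3} <+> {0..3} :: (nat + nat) set"
  have rvZ[measurable]: "Z 1 \<in> borel_measurable M" "Z 2 \<in> borel_measurable M" "Z 3 \<in> borel_measurable M"
    using Z[of 1] Z[of 2] Z[of 3] by (auto dest: distributed_measurable)
  have rvU: "U i \<in> borel_measurable M" if "i \<in> {0..3}" for i
  proof -
    have "random_variable borel (case_sum Z U (Inr i))"
      using indep that unfolding indep_vars_def by blast
    then show ?thesis by simp
  qed
  then have [measurable]: "U 0 \<in> borel_measurable M" "U 1 \<in> borel_measurable M" "U 2 \<in> borel_measurable M" "U 3 \<in> borel_measurable M"
    by auto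
  have lawZ: "distr M borel (Z i) = exp1" if "i \<in> {1..3}" for i
  proof -
    have "distr M borel (Z i) = distr M lborel (Z i)" by (intro distr_cong) auto
    then show ?thesis
      using distributed_distr_eq_density[OF Z[OF that]] by (simp add: exp1_def)
  qed
  \<comment> \<open>The exponential law is the Erlang law of shape 0, whose \<open>k\<close>-th
    moment at rate 1 is \<open>fact k\<close>.\<close>
  have mZ: "integrable M (\<lambda>\<omega>. Z i \<omega> ^ k)" "expectation (\<lambda>\<omega>. Z i \<omega> ^ k) = fact k" if "i \<in> {1..3}" for i k
    using erlang_ith_moment_integrable[OF _ Z[OF that], of k] erlang_ith_moment[OF _ Z[OF that], of k] by auto
  have mU: "integrable M (\<lambda>\<omega>. U i \<omega> ^ k)" "expectation (\<lambda>\<omega>. U i \<omega> ^ k) = 1 / (real k + 1)" if "i \<in> {0..3}" for i k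
    using unif01_moments[OF rvU[OF that] U[OF that]] by auto
  have Z1: "integrable M (Z i)" "expectation (Z i) = 1" "integrable M (\<lambda>\<omega>. (Z i \<omega>)\<^sup>2)" "expectation (\<lambda>\<omega>. (Z i \<omega>)\<^sup>2) = 2"
    if "i \<in> {1..3}" for i
    using mZ[OF that, of 1] mZ[OF that, of 2] by (simp_all add: fact_2)
  have U1: "integrable M (U i)" "expectation (U i) = 1 / 2" "integrable M (\<lambda>\<omega>. (U i \<omega>)\<^sup>2)" "expectation (\<lambda>\<omega>. (U i \<omega>)\<^sup>2) = 1 / 3"
    if "i \<in> {0..3}" for i
    using mU[OF that, of 1] mU[OF that, of 2] by simp_all
  have ZZ: "integrable M (\<lambda>\<omega>. (Z i \<omega> + Z j \<omega>)\<^sup>2)" "expectation (\<lambda>\<omega>. (Z i \<omega> + Z j \<omega>)\<^sup>2) = 6"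
    if "i \<in> {1..3}" "j \<in> {1..3}" "i \<noteq> j" for i j
    using indep_vars_quadratic_moments(1,3)[OF indep InlI[OF that(1)] InlI[OF that(2)]] that
    by (simp_all add: Z1)
  have UU: "integrable M (\<lambda>\<omega>. (U i \<omega> - U j \<omega>)\<^sup>2)" "expectation (\<lambda>\<omega>. (U i \<omega> - U j \<omega>)\<^sup>2) = 1 / 6"
    if "i \<in> {0..3}" "j \<in> {0..3}" "i \<noteq> j" for i j
    using indep_vars_quadratic_moments(2,4)[OF indep InrI[OF that(1)] InrI[OF that(2)]] that
    by (simp_all add: U1)
  define Q where "Q \<omega> = (Z 1 \<omega>)\<^sup>2 + (Z 2 \<omega> + Z 3 \<omega>)\<^sup>2 + (Z 1 \<omega> + Z 2 \<omega>)\<^sup>2 + (Z 3 \<omega>)\<^sup>2 +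
    h ^ 4 * ((U 0 \<omega> - U 1 \<omega>)\<^sup>2 + (U 1 \<omega> - U 3 \<omega>)\<^sup>2 + (U 0 \<omega> - U 2 \<omega>)\<^sup>2 + (U 2 \<omega> - U 3 \<omega>)\<^sup>2)" for \<omega>
  \<comment> \<open>The gap terms have means 2, 6, 6 and 2, and each of the four height terms has
    mean \<open>1 / 6\<close>. Doubling gives \<open>32 + 4 / 3 * h ^ 4\<close>.\<close>
  have Q: "integrable M Q" "expectation Q = 16 + h ^ 4 * (4 / 6)"
    unfolding Q_def by (simp_all add: Z1 ZZ UU)
  define c where "c \<omega> = strip_cost \<alpha> h (U 0 \<omega>) (Z 1 \<omega>) (U 1 \<omega>) (Z 2 \<omega>) (U 2 \<omega>) (Z 3 \<omega>) (U 3 \<omega>)" for \<omega>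
  have c_eq: "(\<lambda>\<omega>. C4 \<alpha> h (\<lambda>i. Z i \<omega>) (\<lambda>i. U i \<omega>)) = c"
    by (simp add: fun_eq_iff c_def C4_eq_strip_cost)
  have [measurable]: "c \<in> borel_measurable M"
    unfolding c_def strip_cost_def by measurable
  have c0: "0 \<le> c \<omega>" for \<omega>
    unfolding c_def strip_cost_def using \<alpha>
    by (intro ring4_nonneg add_nonneg_nonneg) (auto simp: strip_dist_def)
  have c2: "(c \<omega>)\<^sup>2 \<le> (1 / 2 + 1 / \<alpha>\<^sup>2) * (2 * Q \<omega>)" for \<omega>
    unfolding c_def Q_def by (rule strip_cost_power2_le[OF \<alpha>])
  have int2: "integrable M (\<lambda>\<omega>. (c \<omega>)\<^sup>2)"
  proof (rule Bochner_Integration.integrable_bound)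
    show "integrable M (\<lambda>\<omega>. (1 / 2 + 1 / \<alpha>\<^sup>2) * (2 * Q \<omega>))"
      using Q(1) by (intro integrable_mult_right)
    show "AE \<omega> in M. norm ((c \<omega>)\<^sup>2) \<le> norm ((1 / 2 + 1 / \<alpha>\<^sup>2) * (2 * Q \<omega>))"
    proof (rule AE_I2)
      fix \<omega>
      show "norm ((c \<omega>)\<^sup>2) \<le> norm ((1 / 2 + 1 / \<alpha>\<^sup>2) * (2 * Q \<omega>))"
        using c2[of \<omega>] unfolding real_norm_def by (simp only: abs_power2)
    qed
  qed measurable
  then have int: "integrable M c"
    by (rule square_integrable_imp_integrable[rotated]) measurable
  show "0 \<le> expectation (\<lambda>\<omega>. C4 \<alpha> h (\<lambda>i. Z i \<omega>) (\<lambda>i. U i \<omega>))"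
    unfolding c_eq using c0 by simp
  show "strip_mean \<alpha> h = ennreal (expectation (\<lambda>\<omega>. C4 \<alpha> h (\<lambda>i. Z i \<omega>) (\<lambda>i. U i \<omega>)))"
    unfolding c_eq using nn_integral_strip_cost[OF indep lawZ U, of \<alpha> h] nn_integral_eq_integral[OF int] c0
    by (simp add: c_def)
  have "(expectation c)\<^sup>2 \<le> expectation (\<lambda>\<omega>. (c \<omega>)\<^sup>2)"
    by (rule power2_expectation_le[OF int int2])
  also have "\<dots> \<le> expectation (\<lambda>\<omega>. (1 / 2 + 1 / \<alpha>\<^sup>2) * (2 * Q \<omega>))"
    using Q(1) by (intro integral_mono int2 c2) auto
  also have "\<dots> = (1 / 2 + 1 / \<alpha>\<^sup>2) * (32 + 4 / 3 * h ^ 4)"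
    by (simp add: Q)
  finally show "(expectation (\<lambda>\<omega>. C4 \<alpha> h (\<lambda>i. Z i \<omega>) (\<lambda>i. U i \<omega>)))\<^sup>2 \<le> (1 / 2 + 1 / \<alpha>\<^sup>2) * (32 + 4 / 3 * h ^ 4)"
    unfolding c_eq .
qed

text \<open>
  Needs no measurability, since the integral of a non-integrable function is 0. This avoids
  measurability of the optimum.
\<close>

lemma integral_le_enn2real:
  fixes f :: "'a \<Rightarrow> real"
  shows "integral\<^sup>L M f \<le> enn2real (\<integral>\<^sup>+x. ennreal (f x) \<partial>M)"
  by (cases "integrable M f") (simp_all add: real_lebesgue_integral_def not_integrable_integral_eq)

section \<open>Passage to the limit\<close>

text \<open>The bound for finite \<open>n\<close>, divided by \<open>3 * sqrt n\<close>, is a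
  polynomial in three explicit sequences with limits 1, \<open>1 / h\<close> and 0, so comparing
  limits suffices.\<close>

lemma (in prob_space) TSPD_limit_le:
  fixes X :: "nat \<Rightarrow> 'a \<Rightarrow> point"
  assumes \<alpha>: "1 \<le> \<alpha>" and h: "0 < h" and indep: "indep_vars (\<lambda>_. borel) X {1..}"
    and unif: "\<And>i. 1 \<le> i \<Longrightarrow> distr M borel (X i) = square_unif"
    and lim: "(\<lambda>n. expectation (\<lambda>\<omega>. TSPD_speed \<alpha> ((\<lambda>i. X i \<omega>) ` {1..n}) / sqrt (real n))) \<longlonglongrightarrow> \<beta>"
    and c: "strip_mean \<alpha> h = ennreal c" "0 \<le> c"
  shows "\<beta> \<le> 1 / (3 * h) * c"
proof -
  \<comment> \<open>Rounding up ensures \<open>sqrt n \<le> h * m n\<close>, from which the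
    condition on \<open>k\<close> follows; the rounding changes \<open>q n\<close> by at most
    \<open>r n\<close>.\<close>
  define m where "m n = nat \<lceil>sqrt (real n) / h\<rceil>" for n
  define p where "p n = real n / real (n - 4)" for n
  define q where "q n = real (m n) / sqrt (real n)" for n
  define r where "r n = 1 / sqrt (real n)" for n
  \<comment> \<open>The coefficient is \<open>128 = 4 ^ 3 * 2\<close>, from the three gaps at a
    quarter of the rate and the mass \<open>2 / lam\<close> near a turn. Every term except the first
    carries the vanishing factor \<open>r n\<close>.\<close>
  define B where "B n = 1 / 3 * (p n ^ 4 * q n * c + 128 * p n ^ 4 * (16 * (q n)\<^sup>2 * p n + 4) * r n + 30 * r n)" for n
  have m_ge: "sqrt (real n) / h \<le> real (m n)" for n
    unfolding m_def by (rule real_nat_ceiling_ge)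
  have m_le: "real (m n) \<le> sqrt (real n) / h + 1" for n
  proof -
    have "0 \<le> sqrt (real n) / h" using h by simp
    then have "real (m n) = of_int \<lceil>sqrt (real n) / h\<rceil>" by (simp add: m_def)
    then show ?thesis using of_int_ceiling_le_add_one[of "sqrt (real n) / h"] by linarith
  qed
  have le: "expectation (\<lambda>\<omega>. TSPD_speed \<alpha> ((\<lambda>i. X i \<omega>) ` {1..n}) / sqrt (real n)) \<le> B n" if n: "6 \<le> n" for n
  proof -
    define k where "k = n - 4"
    have k: "n = k + 4" "2 \<le> k" using n by (auto simp: k_def)
    define s where "s = sqrt (real n)"
    have s: "0 < s" "real n = s\<^sup>2" using n by (auto simp: s_def)
    have m0: "0 < m n"
    proof -
      have "0 < sqrt (real n) / h" using n h by simp
      then have "0 < real (m n)" using m_ge[of n] by linarith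
      then show ?thesis by simp
    qed
    have "sqrt (real n) \<le> h * real (m n)"
      using m_ge[of n] h by (simp add: field_simps)
    then have "(sqrt (real n))\<^sup>2 \<le> (h * real (m n))\<^sup>2"
      by (intro power_mono) auto
    then have km: "real k \<le> (h * real (m n))\<^sup>2" using k by simp
    define D where "D = real (k + 4) ^ 4 * ((1 / real k) ^ 3 * (real (m n) / real k * c) +
      (4 / real k) ^ 3 * ((16 * real (m n) / real k + 4 / real (m n)) * (2 * real (m n) / real k))) + 30"
    have D0: "0 \<le> D" using c by (simp add: D_def)
    have "(\<integral>\<^sup>+\<omega>. ennreal (3 * TSPD_speed \<alpha> ((\<lambda>i. X i \<omega>) ` {1..n})) \<partial>M) \<le>
      of_nat (k + 4) ^ 4 * (ennreal (1 / real k) ^ 3 * (ennreal (real (m n) / real k) * strip_mean \<alpha> h) +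
      ennreal (4 / real k) ^ 3 * (ennreal (16 * real (m n) / real k + 4 / real (m n)) * ennreal (2 * real (m n) / real k))) + 30"
      using k unif by (intro nn_integral_TSPD_speed_le \<alpha> indep_vars_subset[OF indep] m0 km) auto
    also have "\<dots> = ennreal D"
    proof -
      have "(of_nat (k + 4) :: ennreal) = ennreal (real (k + 4))"
        by (rule ennreal_of_nat_eq_real_of_nat)
      moreover have "(30 :: ennreal) = ennreal 30" by simp
      ultimately show ?thesis unfolding c(1) D_def using c(2)
        by (simp only: ennreal_power ennreal_mult'[symmetric] ennreal_plus[symmetric]
            of_nat_0_le_iff zero_le_divide_iff zero_le_power mult_nonneg_nonneg add_nonneg_nonneg
            zero_le_numeral zero_le_one divide_nonneg_nonneg simp_thms)
    qed
    finally have "enn2real (\<integral>\<^sup>+\<omega>. ennreal (3 * TSPD_speed \<alpha> ((\<lambda>i. X i \<omega>) ` {1..n})) \<partial>M) \<le> D"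
      using D0 by (intro enn2real_leI)
    then have "expectation (\<lambda>\<omega>. 3 * TSPD_speed \<alpha> ((\<lambda>i. X i \<omega>) ` {1..n})) \<le> D"
      by (rule order_trans[OF integral_le_enn2real])
    then have "expectation (\<lambda>\<omega>. TSPD_speed \<alpha> ((\<lambda>i. X i \<omega>) ` {1..n}) / sqrt (real n)) \<le> D / (3 * s)"
      unfolding s_def[symmetric] using s(1) by (simp add: field_simps)
    also have "D / (3 * s) = B n"
    proof -
      have "real (k + 4) = s\<^sup>2" using s k by simp
      moreover have "p n = s\<^sup>2 / real k" "q n = real (m n) / s" "r n = 1 / s"
        using s k by (simp_all add: p_def q_def r_def s_def)
      \<comment> \<open>Writing \<open>n\<close> as \<open>s ^ 2\<close> leaves a rational identity
        without roots.\<close>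
      moreover have "((s\<^sup>2) ^ 4 * ((1 / K) ^ 3 * (L / K * c) + (4 / K) ^ 3 * ((16 * L / K + 4 / L) * (2 * L / K))) + 30) / (3 * s) =
        1 / 3 * ((s\<^sup>2 / K) ^ 4 * (L / s) * c + 128 * (s\<^sup>2 / K) ^ 4 * (16 * (L / s)\<^sup>2 * (s\<^sup>2 / K) + 4) * (1 / s) + 30 * (1 / s))"
        if "0 < K" "0 < L" for K L
        using that s(1) by (simp add: field_simps power2_eq_square power3_eq_cube power4_eq_xxxx)
      ultimately show ?thesis
        unfolding D_def B_def using k m0 by simp
    qed
    finally show ?thesis .
  qed
  have "p \<longlonglongrightarrow> 1"
  proof -
    have "(\<lambda>n. real n / (real n - 4)) \<longlonglongrightarrow> 1" by real_asymp
    moreover have "\<forall>\<^sub>F n in sequentially. real n / (real n - 4) = p n"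
      using eventually_ge_at_top[of 4] by eventually_elim (simp add: p_def of_nat_diff)
    ultimately show ?thesis by (rule Lim_transform_eventually)
  qed
  moreover have r: "r \<longlonglongrightarrow> 0" unfolding r_def by real_asymp
  moreover have "q \<longlonglongrightarrow> 1 / h"
  proof (rule tendsto_sandwich)
    show "\<forall>\<^sub>F n in sequentially. 1 / h \<le> q n"
      using eventually_gt_at_top[of 0]
      by eventually_elim (use m_ge h in \<open>simp add: q_def field_simps\<close>)
    show "\<forall>\<^sub>F n in sequentially. q n \<le> 1 / h + r n"
      using eventually_gt_at_top[of 0]
    proof eventually_elim
      case (elim n)
      have "q n \<le> (sqrt (real n) / h + 1) / sqrt (real n)"
        unfolding q_def by (intro divide_right_mono m_le) simp
      then show ?case using elim h by (simp add: r_def field_simps)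
    qed
    show "(\<lambda>n. 1 / h + r n) \<longlonglongrightarrow> 1 / h" using tendsto_add[OF tendsto_const r, of "1 / h"] by simp
  qed simp
  ultimately have "B \<longlonglongrightarrow> 1 / 3 * (1 ^ 4 * (1 / h) * c + 128 * 1 ^ 4 * (16 * (1 / h)\<^sup>2 * 1 + 4) * 0 + 30 * 0)"
    unfolding B_def by (intro tendsto_intros)
  then have "B \<longlonglongrightarrow> 1 / (3 * h) * c" by simp
  moreover have "\<forall>\<^sub>F n in sequentially. expectation (\<lambda>\<omega>. TSPD_speed \<alpha> ((\<lambda>i. X i \<omega>) ` {1..n}) / sqrt (real n)) \<le> B n"
    using eventually_ge_at_top[of 6] by eventually_elim (rule le)
  ultimately show ?thesis
    using lim by (intro tendsto_le[OF sequentially_bot])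
qed

theorem mainTheorem6:
  fixes \<alpha> \<beta>\<^sub>T\<^sub>S\<^sub>P\<^sub>D :: real
    and M :: "'a measure" and X :: "nat \<Rightarrow> 'a \<Rightarrow> real^2"
    and N :: "'b measure" and Z U :: "nat \<Rightarrow> 'b \<Rightarrow> real"
  assumes alpha: "\<alpha> \<ge> 1"
    and M: "prob_space M"
    and X_indep: "prob_space.indep_vars M (\<lambda>_. borel) X {1..}"
    and X_unif: "\<And>i. i \<ge> 1 \<Longrightarrow> distr M borel (X i) = uniform_measure lborel (cbox 0 1)"
    and beta_AE: "AE \<omega> in M.
          (\<lambda>n. TSPD_speed \<alpha> ((\<lambda>i. X i \<omega>) ` {1..n}) / sqrt (real n)) \<longlonglongrightarrow> \<beta>\<^sub>T\<^sub>S\<^sub>P\<^sub>D"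
    and beta_expectation:
          "(\<lambda>n. prob_space.expectation M
              (\<lambda>\<omega>. TSPD_speed \<alpha> ((\<lambda>i. X i \<omega>) ` {1..n}) / sqrt (real n))) \<longlonglongrightarrow> \<beta>\<^sub>T\<^sub>S\<^sub>P\<^sub>D"
    and N: "prob_space N"
    and ZU_indep: "prob_space.indep_vars N (\<lambda>_. borel) (case_sum Z U) ({1..3} <+> {0..3})"
    and Z_exp: "\<And>i. i \<in> {1..3} \<Longrightarrow> distributed N lborel (Z i) (exponential_density 1)"
    and U_unif: "\<And>i. i \<in> {0..3} \<Longrightarrow> distr N borel (U i) = uniform_measure lborel {0..1}"
  shows "(\<forall>h>0. \<beta>\<^sub>T\<^sub>S\<^sub>P\<^sub>D \<le> 1 / (3 * h) *
              prob_space.expectation N (\<lambda>\<omega>. C4 \<alpha> h (\<lambda>i. Z i \<omega>) (\<lambda>i. U i \<omega>))) \<and>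
         \<beta>\<^sub>T\<^sub>S\<^sub>P\<^sub>D \<le> 1 / 3 * sqrt (1 / 2 + 1 / \<alpha>\<^sup>2) * sqrt (2 * sqrt (128 / 3))"
proof -
  interpret M: prob_space M by (rule M)
  interpret N: prob_space N by (rule N)
  let ?c = "\<lambda>h. N.expectation (\<lambda>\<omega>. C4 \<alpha> h (\<lambda>i. Z i \<omega>) (\<lambda>i. U i \<omega>))"
  note moments = N.C4_moments[OF alpha ZU_indep Z_exp U_unif[folded unif01_def]]
  have bound: "\<beta>\<^sub>T\<^sub>S\<^sub>P\<^sub>D \<le> 1 / (3 * h) * ?c h" if "0 < h" for h
    using M.TSPD_limit_le[OF alpha that X_indep X_unif[folded square_unif_def] beta_expectation moments(1,3)]
    by simp
  \<comment> \<open>This \<open>h\<close> minimises \<open>(32 + 4 / 3 * h ^ 4) / h ^ 2\<close>; at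
    the minimum both summands of the numerator equal 32, whence the 64 below.\<close>
  define h :: real where "h = sqrt (sqrt 24)"
  have h: "0 < h" "h\<^sup>2 = sqrt 24" "h ^ 4 = 24"
  proof -
    show "0 < h" and h2: "h\<^sup>2 = sqrt 24" by (simp_all add: h_def)
    have "h ^ 4 = (h\<^sup>2)\<^sup>2" by simp
    then show "h ^ 4 = 24" by (simp add: h2)
  qed
  let ?K = "1 / 2 + 1 / \<alpha>\<^sup>2"
  have "?c h \<le> sqrt (?K * 64)"
    using moments(2)[of h] by (intro real_le_rsqrt) (simp add: h(3))
  then have "1 / (3 * h) * ?c h \<le> 1 / (3 * h) * sqrt (?K * 64)"
    using h(1) by (intro mult_left_mono) auto
  also have "\<dots> = 1 / 3 * sqrt ?K * (sqrt 64 / h)"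
    unfolding real_sqrt_mult by simp
  \<comment> \<open>Both sides are nonnegative with equal fourth powers: \<open>64 ^ 2 / 24\<close>
    and \<open>4 * 128 / 3\<close> are both \<open>512 / 3\<close>.\<close>
  also have "sqrt 64 / h = sqrt (2 * sqrt (128 / 3))"
  proof (rule real_sqrt_unique[symmetric])
    have "(64 / sqrt 24)\<^sup>2 = (2 * sqrt (128 / 3))\<^sup>2"
      by (simp add: power_divide power_mult_distrib)
    then have "64 / sqrt 24 = 2 * sqrt (128 / 3)"
      by (subst (asm) power2_eq_iff_nonneg) auto
    then show "(sqrt 64 / h)\<^sup>2 = 2 * sqrt (128 / 3)"
      by (simp add: power_divide h(2))
    show "0 \<le> sqrt 64 / h" using h(1) by simp
  qed
  finally show ?thesis using bound h(1) by fastforce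
qed

end
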